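(* Let $X$ be either the interval $I=[0,1)$ or the circle $\mathbb{T}=\mathbb{R}/\mathbb{Z}$, and let $\lambda$ be the uniform probability measure on $X$. For $p\in[1,\infty]$ set $\alpha_p=\tfrac12$ if $p<\infty$ and $\alpha_\infty=1$. For a sequence $(x_n)_{n\in\mathbb{N}}\subset X$, let $\mu_N=\frac1N\sum_{n=1}^N\delta_{x_n}$ for $N \in \mathbb{N}$. For every $p\in[1,\infty]$ there exists a constant $C_p>0$ such that for any sequence $(x_n)_{n\in\mathbb{N}}\subset X$, $$W_p^X(\mu_N,\lambda)\ \ge\ C_p\,\frac{(\log N)^{\alpha_p}}{N}$$ holds for infinitely many $N\in\mathbb{N}$. Furthermore, this bound is sharp: for every $p\in[1,\infty]$ there exist a sequence $(x_n)_{n\in\mathbb{N}}\subset X$ and a constant $C_p'<\infty$ such that $W_p^X(\mu_N,\lambda)\le C_p'\,\frac{(\log N)^{\alpha_p}}{N}$ for all $N\ge 2$.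
   Context: The metric $d_X$ is the usual distance $|x-y|$ on $I=[0,1)$, and the arc-length (quotient) distance $\min_{k\in\mathbb{Z}}|x-y+k|$ on $\mathbb{T}=\mathbb{R}/\mathbb{Z}$. For Borel probability measures $\mu,\nu$ on $X$ and $p\in[1,\infty]$, the Wasserstein-$p$ distance is $$W_p^X(\mu,\nu)=\inf_{\pi\in\Pi(\mu,\nu)}\|d_X\|_{L^p(\pi)},$$ where $\Pi(\mu,\nu)$ is the set of Borel probability measures on $X\times X$ with marginals $\mu$ and $\nu$ (for $p=\infty$, the norm is the $\pi$-essential supremum of $d_X$). *)

theory Defs
  imports "HOL-Probability.Probability"
begin

subsection \<open>The circle as a metric space\<close>

quotient_type circle = real / "\<lambda>x y::real. x - y \<in> \<int>"
  morphisms rep_circle to_circle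
proof (rule equivpI)
  show "reflp (\<lambda>x y::real. x - y \<in> \<int>)"
    by (auto intro: reflpI)
  show "symp (\<lambda>x y::real. x - y \<in> \<int>)"
    by (metis (no_types, lifting) Ints_minus minus_diff_eq sympI)
  show "transp (\<lambda>x y::real. x - y \<in> \<int>)"
  proof (rule transpI)
    fix x y z :: real
    assume "x - y \<in> \<int>" "y - z \<in> \<int>"
    then have "(x - y) + (y - z) \<in> \<int>" by (rule Ints_add)
    then show "x - z \<in> \<int>" by simp
  qed
qed

definition arc_dist :: "real \<Rightarrow> real \<Rightarrow> real" where
  "arc_dist x y = (INF k::int. \<bar>x - y + of_int k\<bar>)"

lemma arc_dist_le: "arc_dist x y \<le> \<bar>x - y + of_int k\<bar>"
  unfolding arc_dist_def by (rule cINF_lower) (auto intro!: bdd_belowI2[where m=0])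

lemma arc_dist_attained: "\<exists>k::int. arc_dist x y = \<bar>x - y + of_int k\<bar>"
proof -
  have "\<bar>x - y + of_int (- round (x - y))\<bar> \<le> \<bar>x - y + of_int k\<bar>" for k :: int
    using round_diff_minimal[of "x - y" "- k"] by simp
  then have "\<bar>x - y + of_int (- round (x - y))\<bar> \<le> arc_dist x y"
    unfolding arc_dist_def by (intro cINF_greatest) auto
  with arc_dist_le[of x y "- round (x - y)"] show ?thesis
    by (meson antisym)
qed

lemma arc_dist_shift_le:
  assumes "x - x' \<in> \<int>" "y - y' \<in> \<int>"
  shows "arc_dist x y \<le> arc_dist x' y'"
proof -
  obtain k where k: "arc_dist x' y' = \<bar>x' - y' + of_int k\<bar>"
    using arc_dist_attained by blast
  obtain m n :: int where "x - x' = of_int m" "y - y' = of_int n"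
    using assms by (auto elim!: Ints_cases)
  then have "x' - y' + of_int k = x - y + of_int (k - m + n)"
    by simp
  with k arc_dist_le[of x y "k - m + n"] show ?thesis by metis
qed

instantiation circle :: metric_space
begin

lift_definition dist_circle :: "circle \<Rightarrow> circle \<Rightarrow> real" is arc_dist
proof (rule antisym)
  fix x x' y y' :: real
  assume *: "x - x' \<in> \<int>" "y - y' \<in> \<int>"
  show "arc_dist x y \<le> arc_dist x' y'"
    using * by (rule arc_dist_shift_le)
  show "arc_dist x' y' \<le> arc_dist x y"
    using * by (intro arc_dist_shift_le) (metis Ints_minus minus_diff_eq)+
qed

definition uniformity_circle :: "(circle \<times> circle) filter" where
  "uniformity_circle = (INF e\<in>{0 <..}. principal {(x, y). dist x y < e})"

definition open_circle :: "circle set \<Rightarrow> bool" where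
  "open_circle U \<longleftrightarrow> (\<forall>x\<in>U. \<forall>\<^sub>F (x', y) in uniformity. x' = x \<longrightarrow> y \<in> U)"

instance
proof
  fix x y :: circle
  show "dist x y = 0 \<longleftrightarrow> x = y"
  proof transfer
    fix x y :: real
    show "arc_dist x y = 0 \<longleftrightarrow> x - y \<in> \<int>"
    proof
      assume "arc_dist x y = 0"
      then obtain k :: int where "x - y + of_int k = 0"
        using arc_dist_attained[of x y] by auto
      then have "x - y = of_int (- k)" by simp
      then show "x - y \<in> \<int>" by (metis Ints_of_int)
    next
      assume "x - y \<in> \<int>"
      then obtain k :: int where "x - y = of_int k" by (auto elim: Ints_cases)
      then have "arc_dist x y \<le> 0"
        using arc_dist_le[of x y "- k"] by simp
      moreover have "0 \<le> arc_dist x y"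
        using arc_dist_attained[of x y] by auto
      ultimately show "arc_dist x y = 0" by simp
    qed
  qed
next
  fix x y z :: circle
  show "dist x y \<le> dist x z + dist y z"
  proof transfer
    fix x y z :: real
    obtain k l :: int where kl: "arc_dist x z = \<bar>x - z + of_int k\<bar>" "arc_dist y z = \<bar>y - z + of_int l\<bar>"
      using arc_dist_attained by metis
    have "arc_dist x y \<le> \<bar>x - y + of_int (k - l)\<bar>"
      by (rule arc_dist_le)
    also have "\<dots> \<le> \<bar>x - z + of_int k\<bar> + \<bar>y - z + of_int l\<bar>"
      by simp
    finally show "arc_dist x y \<le> arc_dist x z + arc_dist y z"
      using kl by simp
  qed
qed (simp_all add: uniformity_circle_def open_circle_def)

end

lemma dist_to_circle: "dist (to_circle x) (to_circle y) = (INF k::int. \<bar>x - y + of_int k\<bar>)"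
  by (simp add: dist_circle.abs_eq arc_dist_def)

lemma continuous_on_to_circle: "continuous_on A to_circle"
proof -
  have "dist (to_circle x) (to_circle y) \<le> dist x y" for x y
    using arc_dist_le[of x y 0] by (simp add: dist_circle.abs_eq dist_real_def)
  then show ?thesis
    unfolding continuous_on_iff by (meson le_less_trans)
qed

lemma surj_to_circle: "surj to_circle"
  by (metis Quotient_abs_rep Quotient_circle surjI)

instance circle :: second_countable_topology
proof
  define D :: "circle set" where "D = to_circle ` \<rat>"
  define B where "B = (\<Union>d\<in>D. \<Union>r\<in>\<rat>. {ball d r})"
  have "countable D"
    unfolding D_def by (intro countable_image countable_rat)
  then have "countable B"
    unfolding B_def by (intro countable_UN countable_rat) auto
  moreover have "topological_basis B"
  proof (rule topological_basisI)
    show "\<And>B'. B' \<in> B \<Longrightarrow> open B'" by (auto simp: B_def)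
    fix U :: "circle set" and x assume "open U" "x \<in> U"
    then obtain e where e: "e > 0" "ball x e \<subseteq> U"
      by (meson openE)
    obtain t where t: "x = to_circle t"
      using surj_to_circle by auto
    obtain r where r: "r \<in> \<rat>" "e / 4 < r" "r < e / 2"
      using Rats_dense_in_real[of "e / 4" "e / 2"] e by auto
    obtain q where q: "q \<in> \<rat>" "t < q" "q < t + e / 4"
      using Rats_dense_in_real[of t "t + e / 4"] e by auto
    have "dist (to_circle q) x \<le> \<bar>q - t\<bar>"
      using arc_dist_le[of q t 0] t by (simp add: dist_circle.abs_eq)
    then have d: "dist (to_circle q) x < e / 4"
      using q by simp
    have "ball (to_circle q) r \<subseteq> ball x e"
    proof
      fix y assume "y \<in> ball (to_circle q) r"
      then show "y \<in> ball x e"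
        using d r dist_triangle[of x y "to_circle q"] by (simp add: dist_commute)
    qed
    then show "\<exists>B'\<in>B. x \<in> B' \<and> B' \<subseteq> U"
      using e d r q by (intro bexI[of _ "ball (to_circle q) r"]) (auto simp: B_def D_def)
  qed
  ultimately show "\<exists>B :: circle set set. countable B \<and> open = generate_topology B"
    using topological_basis_imp_subbasis by blast
qed

subsection \<open>Uniform and empirical measures\<close>

definition unif_interval :: "real measure" where
  "unif_interval = restrict_space lborel {0..<1}"

definition unif_circle :: "circle measure" where
  "unif_circle = distr unif_interval borel to_circle"

lemma measurable_to_circle: "to_circle \<in> unif_interval \<rightarrow>\<^sub>M borel"
  unfolding unif_interval_def
  by (intro measurable_restrict_space1) (simp add: borel_measurable_continuous_onI continuous_on_to_circle)

lemma prob_space_unif_interval: "prob_space unif_interval"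
  by (rule prob_spaceI) (simp add: unif_interval_def emeasure_restrict_space)

lemma prob_space_unif_circle: "prob_space unif_circle"
  unfolding unif_circle_def
  by (rule prob_space.prob_space_distr[OF prob_space_unif_interval measurable_to_circle])

(* The measure M contributes only its space and sigma-algebra. *)
definition empirical :: "'a measure \<Rightarrow> (nat \<Rightarrow> 'a) \<Rightarrow> nat \<Rightarrow> 'a measure" where
  "empirical M x N =
     measure_of (space M) (sets M) (\<lambda>A. (\<Sum>n = 1..N. emeasure (return M (x n)) A) / of_nat N)"

lemma sets_empirical [simp]: "sets (empirical M x N) = sets M"
  by (simp add: empirical_def)

lemma space_empirical [simp]: "space (empirical M x N) = space M"
  by (simp add: empirical_def)

lemma emeasure_empirical:
  assumes "A \<in> sets M"
  shows "emeasure (empirical M x N) A = (\<Sum>n = 1..N. indicator A (x n)) / of_nat N"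
proof -
  define m where "m = (\<lambda>A. (\<Sum>n = 1..N. emeasure (return M (x n)) A) / of_nat N)"
  have "countably_additive (sets M) m"
    unfolding countably_additive_def
  proof (intro allI impI)
    fix F :: "nat \<Rightarrow> 'a set"
    assume F: "range F \<subseteq> sets M" "disjoint_family F" "\<Union>(range F) \<in> sets M"
    have "(\<Sum>i. m (F i)) = (\<Sum>i. (\<Sum>n = 1..N. emeasure (return M (x n)) (F i))) / of_nat N"
      unfolding m_def divide_ennreal_def by (rule ennreal_suminf_multc)
    also have "\<dots> = (\<Sum>n = 1..N. \<Sum>i. emeasure (return M (x n)) (F i)) / of_nat N"
      by (subst suminf_sum) auto
    also have "\<dots> = m (\<Union>(range F))"
      unfolding m_def using F by (subst suminf_emeasure) auto
    finally show "(\<Sum>i. m (F i)) = m (\<Union>(range F))" .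
  qed
  moreover have "positive (sets M) m"
    by (simp add: positive_def m_def)
  ultimately have "emeasure (empirical M x N) A = m A"
    using assms unfolding empirical_def m_def[symmetric]
    by (intro emeasure_measure_of_sigma sets.sigma_algebra_axioms) auto
  with assms show ?thesis by (simp add: m_def)
qed

lemma prob_space_empirical:
  assumes "N \<ge> 1" "\<And>n. x n \<in> space M"
  shows "prob_space (empirical M x N)"
proof (rule prob_spaceI)
  have "emeasure (empirical M x N) (space M) = (\<Sum>n = 1..N. 1) / of_nat N"
    using assms(2) by (subst emeasure_empirical) (auto intro!: sum.cong arg_cong2[where f="(/)"])
  also have "\<dots> = 1"
    using assms(1) by (simp add: of_nat_less_top)
  finally show "emeasure (empirical M x N) (space (empirical M x N)) = 1" by simp
qed

subsection \<open>Wasserstein distances\<close>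

definition Lp_norm :: "ennreal \<Rightarrow> 'a measure \<Rightarrow> ('a \<Rightarrow> real) \<Rightarrow> ennreal" where
  "Lp_norm p M f =
     (if p = \<infinity> then esssup M (\<lambda>z. ennreal \<bar>f z\<bar>)
      else let I = (\<integral>\<^sup>+ z. ennreal (\<bar>f z\<bar> powr enn2real p) \<partial>M)
           in if I = \<infinity> then \<infinity> else ennreal (enn2real I powr (1 / enn2real p)))"

(* For the two spaces considered, the product sigma-algebra used here is the
   Borel sigma-algebra of the product space: see the two lemmas below. *)
definition couplings :: "'a measure \<Rightarrow> 'b measure \<Rightarrow> ('a \<times> 'b) measure set" where
  "couplings \<mu> \<nu> =
     {\<pi>. prob_space \<pi> \<and> sets \<pi> = sets (\<mu> \<Otimes>\<^sub>M \<nu>) \<and> distr \<pi> \<mu> fst = \<mu> \<and> distr \<pi> \<nu> snd = \<nu>}"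

lemma sets_pair_unif_circle:
  assumes "sets \<mu> = sets unif_circle" "sets \<nu> = sets unif_circle"
  shows "sets (\<mu> \<Otimes>\<^sub>M \<nu>) = sets borel"
proof -
  have "sets (\<mu> \<Otimes>\<^sub>M \<nu>) = sets (borel \<Otimes>\<^sub>M borel :: (circle \<times> circle) measure)"
    using assms by (intro sets_pair_measure_cong) (simp_all add: unif_circle_def)
  then show ?thesis by (simp only: borel_prod)
qed

lemma sets_pair_unif_interval:
  assumes "sets \<mu> = sets unif_interval" "sets \<nu> = sets unif_interval"
  shows "sets (\<mu> \<Otimes>\<^sub>M \<nu>) = sets (restrict_space borel ({0..<1} \<times> {0..<1}))"
proof -
  have *: "sets unif_interval = sets (restrict_space borel {0..<1})"
    unfolding unif_interval_def by (rule sets_restrict_space_cong) simp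
  have "sets (\<mu> \<Otimes>\<^sub>M \<nu>) = sets (restrict_space borel {0..<1} \<Otimes>\<^sub>M restrict_space borel {0..<1 :: real})"
    using assms * by (intro sets_pair_measure_cong) simp_all
  also have "\<dots> = sets (restrict_space borel ({0..<1} \<times> {0..<1}))" (is "sets (?R \<Otimes>\<^sub>M ?R) = sets ?B")
  proof (rule antisym)
    show "sets (?R \<Otimes>\<^sub>M ?R) \<subseteq> sets ?B"
    proof (rule sets_pair_in_sets)
      fix a b assume "a \<in> sets ?R" "b \<in> sets ?R"
      then have "a \<in> sets borel" "b \<in> sets borel" "a \<subseteq> {0..<1}" "b \<subseteq> {0..<1}"
        by (auto simp: sets_restrict_space)
      then have "a \<times> b \<in> sets borel" "a \<times> b = ({0..<1} \<times> {0..<1}) \<inter> (a \<times> b)"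
        by (auto simp: borel_Times)
      then show "a \<times> b \<in> sets ?B"
        unfolding sets_restrict_space by (rule_tac image_eqI) auto
    qed
    show "sets ?B \<subseteq> sets (?R \<Otimes>\<^sub>M ?R)"
    proof
      fix S assume "S \<in> sets ?B"
      then obtain E :: "(real \<times> real) set" where E: "E \<in> sets borel" "S = ({0..<1} \<times> {0..<1}) \<inter> E"
        unfolding sets_restrict_space by auto
      have "(\<lambda>z. (fst z, snd z)) \<in> ?R \<Otimes>\<^sub>M ?R \<rightarrow>\<^sub>M borel \<Otimes>\<^sub>M borel"
        by (intro measurable_Pair measurable_compose[OF measurable_fst] measurable_compose[OF measurable_snd]
            measurable_restrict_space1 measurable_ident_sets) simp_all
      then have "(\<lambda>z. z) \<in> ?R \<Otimes>\<^sub>M ?R \<rightarrow>\<^sub>M (borel :: (real \<times> real) measure)"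
        by (simp add: borel_prod)
      from measurable_sets[OF this E(1)] show "S \<in> sets (?R \<Otimes>\<^sub>M ?R)"
        using E(2) by (simp add: space_pair_measure space_restrict_space Int_commute)
    qed
  qed
  finally show ?thesis .
qed

definition wasserstein ::
    "ennreal \<Rightarrow> 'a::metric_space measure \<Rightarrow> 'a measure \<Rightarrow> ennreal" where
  "wasserstein p \<mu> \<nu> = (INF \<pi>\<in>couplings \<mu> \<nu>. Lp_norm p \<pi> (\<lambda>(x, y). dist x y))"

definition log_exponent :: "ennreal \<Rightarrow> real" where
  "log_exponent p = (if p = \<infinity> then 1 else 1 / 2)"

end

theory Submission
  imports Defs
begin

text \<open>Pushing couplings forward along the projection of the interval onto the circle shows that distances
  on the circle are the smaller ones, so lower bounds are needed on the circle and upper bounds on the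
  interval only.

  The lower bound is the planar discrepancy argument of Roth, Schmidt and Halasz. Take the points
  \<open>(x\<^sub>m, m)\<close> with \<open>m < 2^L\<close>. On each of the \<open>L\<close> families of dyadic rectangles of equal area, the Haar
  functions of the empty rectangles correlate with the discrepancy by a fixed amount, because the counting
  part does not see them. A Riesz product of these \<open>L\<close> functions \<open>h\<^sub>b\<close> correlates by a multiple of \<open>L\<close> times
  its weight \<open>c\<close>, products of two or more of them contributing less. With \<open>\<Prod>(1 + c h\<^sub>b) - 1\<close> and constant \<open>c\<close> the test
  function is bounded in \<open>L\<^sup>1\<close>, which gives \<open>log N\<close> for \<open>p = \<infinity>\<close>; with \<open>Im (\<Prod>(1 + \<i> c h\<^sub>b))\<close> and \<open>c\<close> of order
  \<open>1 / sqrt L\<close> it is bounded uniformly, so that its primitive is Lipschitz, which gives \<open>sqrt (log N)\<close>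
  for \<open>p = 1\<close>.

  For the upper bound the points are distributed by rotors at the nodes of the dyadic tree, the rotors of
  the two children of a node starting in opposite directions. The discrepancy is then a sum of signed tent
  functions over the nodes above a point. Up to a bounded drift it is a martingale with bounded increments
  in the binary digits, so its exponential moments are those of a sum of \<open>log N\<close> independent signs. The
  monotone rearrangement turns this into a bound on the transport cost.\<close>

subsection \<open>Riesz products of Haar functions\<close>

lemma sum_alternating_halves:
  fixes g :: "nat \<Rightarrow> real"
  assumes "h > 0"
  shows "(\<Sum>u<2*h. (-1)^(u div h) * g u) = (\<Sum>u<h. g u - g (u + h))"
proof -
  have "(\<Sum>u<2*h. (-1)^(u div h) * g u)
      = (\<Sum>i<2. \<Sum>u\<in>{i*h..<i*h+h}. (-1)^(u div h) * g u)"
    by (simp add: sum.nat_group)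
  also have "\<dots> = (\<Sum>u\<in>{0..<h}. (-1)^(u div h) * g u) + (\<Sum>u\<in>{h..<h+h}. (-1)^(u div h) * g u)"
    by (simp add: numeral_2_eq_2)
  also have "(\<Sum>u\<in>{h..<h+h}. (-1)^(u div h) * g u) = (\<Sum>u<h. - g (u + h))"
    using sum.shift_bounds_nat_ivl[of "\<lambda>u. (-1)^(u div h) * g u" 0 h h] assms
    by (simp add: lessThan_atLeast0)
  also have "(\<Sum>u\<in>{0..<h}. (-1)^(u div h) * g u) = (\<Sum>u<h. g u)"
    by (auto simp: lessThan_atLeast0)
  finally show ?thesis by (simp add: sum_subtractf sum_negf)
qed

text \<open>The two halves carry opposite signs and cancel. This is how the Haar functions fail to
  see the counting part of the discrepancy.\<close>

lemma sum_alternating_const: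
  assumes "h > 0"
  shows "(\<Sum>u<2*h. (-1)^(u div h) * (k::real)) = 0"
  using sum_alternating_halves[OF assms, of "\<lambda>_. k"] by simp

lemma sum_alternating_linear:
  assumes "h > 0"
  shows "(\<Sum>u<2*h. (-1)^(u div h) * (real (p + u))) = - (real h)\<^sup>2"
  using sum_alternating_halves[OF assms, of "\<lambda>u. real (p + u)"]
  by (simp add: power2_eq_square)

lemma div_power2_cong:
  fixes x y :: nat
  assumes "x div 2^a = y div 2^a" "a \<le> b"
  shows "x div 2^b = y div 2^b"
proof -
  have "(2::nat)^b = 2^a * 2^(b-a)" using assms(2) by (simp flip: power_add)
  then show ?thesis using assms(1) by (simp add: div_mult2_eq)
qed

lemma sum_lessThan_blocks:
  fixes g :: "nat \<Rightarrow> real"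
  shows "(\<Sum>x<n*k. g x) = (\<Sum>i<n. \<Sum>u<k. g (i*k + u))"
proof -
  have "(\<Sum>u\<in>{i*k..<i*k+k}. g u) = (\<Sum>u<k. g (i*k + u))" for i
    using sum.shift_bounds_nat_ivl[of g 0 "i*k" k] by (simp add: lessThan_atLeast0 add.commute)
  then show ?thesis by (simp flip: sum.nat_group)
qed

text \<open>Higher-order terms are bounded through the size and the extreme elements of
  \<open>S\<close> alone, so the sets are sorted by minimum \<open>a\<close>, maximum
  \<open>b\<close> and the free part \<open>R\<close> strictly between.\<close>

lemma sum_Min_Max:
  fixes g :: "nat set \<Rightarrow> real" and L :: nat
  shows "(\<Sum>S | S \<subseteq> {1..L} \<and> 2 \<le> card S. g S)
     = (\<Sum>a\<in>{1..L}. \<Sum>b\<in>{a<..L}. \<Sum>R\<in>Pow {a<..<b}. g (insert a (insert b R)))"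
proof -
  have mm: "Min (insert a (insert b R)) = a" "Max (insert a (insert b R)) = b"
    if "R \<subseteq> {a<..<b}" "a < b" for a b :: nat and R
  proof -
    have "finite R" using that finite_subset by blast
    with that show "Min (insert a (insert b R)) = a" "Max (insert a (insert b R)) = b"
      by (intro Min_eqI Max_eqI; auto)+
  qed
  have key: "Min S < Max S \<and> Min S \<in> S \<and> Max S \<in> S \<and> S - {Min S, Max S} \<subseteq> {Min S<..<Max S}"
    if "S \<subseteq> {1..L}" "2 \<le> card S" for S
  proof -
    have f: "finite S" "S \<noteq> {}" using that finite_subset by auto
    have "Min S \<noteq> Max S"
    proof
      assume "Min S = Max S"
      then have "S \<subseteq> {Min S}" using f by (metis Max_ge Min_le antisym insertCI subsetI)
      then have "card S \<le> 1" using card_mono[of "{Min S}" S] by simp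
      with that show False by simp
    qed
    moreover have "Min S \<le> Max S" using f by simp
    ultimately have lt: "Min S < Max S" by simp
    have "x \<in> {Min S<..<Max S}" if "x \<in> S - {Min S, Max S}" for x
    proof -
      have "x \<noteq> Min S" "x \<noteq> Max S" "Min S \<le> x" "x \<le> Max S" using that f by auto
      then show ?thesis unfolding greaterThanLessThan_iff by linarith
    qed
    with lt f show ?thesis by auto
  qed
  have "(\<Sum>S | S \<subseteq> {1..L} \<and> 2 \<le> card S. g S)
     = (\<Sum>(a,b,R)\<in>(SIGMA a:{1..L}. SIGMA b:{a<..L}. Pow {a<..<b}). g (insert a (insert b R)))"
  proof (rule sum.reindex_bij_witness[where i = "\<lambda>(a,b,R). insert a (insert b R)"
        and j = "\<lambda>S. (Min S, Max S, S - {Min S, Max S})"])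
    fix S assume "S \<in> {S. S \<subseteq> {1..L} \<and> 2 \<le> card S}"
    then have S: "S \<subseteq> {1..L}" "2 \<le> card S" by auto
    note k = key[OF S]
    then have ins: "insert (Min S) (insert (Max S) (S - {Min S, Max S})) = S" by auto
    then show "(case (Min S, Max S, S - {Min S, Max S}) of (a, b, R) \<Rightarrow> insert a (insert b R)) = S" by simp
    show "(Min S, Max S, S - {Min S, Max S}) \<in> (SIGMA a:{1..L}. SIGMA b:{a<..L}. Pow {a<..<b})"
      using k S by auto
    show "(case (Min S, Max S, S - {Min S, Max S}) of (a, b, R) \<Rightarrow> g (insert a (insert b R))) = g S"
      using ins by simp
  next
    fix t assume t: "t \<in> (SIGMA a:{1..L}. SIGMA b:{a<..L}. Pow {a<..<b})"
    then obtain a b R where t': "t = (a, b, R)" "a \<in> {1..L}" "a < b" "b \<le> L" "R \<subseteq> {a<..<b}" by auto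
    let ?S = "insert a (insert b R)"
    have "finite R" using t' finite_subset by blast
    then have "card {a, b} \<le> card ?S" by (intro card_mono) auto
    then show "(case t of (a, b, R) \<Rightarrow> insert a (insert b R)) \<in> {S. S \<subseteq> {1..L} \<and> 2 \<le> card S}"
      using t' by auto
    show "(Min (case t of (a, b, R) \<Rightarrow> insert a (insert b R)), Max (case t of (a, b, R) \<Rightarrow> insert a (insert b R)),
       (case t of (a, b, R) \<Rightarrow> insert a (insert b R)) - {Min (case t of (a, b, R) \<Rightarrow> insert a (insert b R)), Max (case t of (a, b, R) \<Rightarrow> insert a (insert b R))}) = t"
      using t' mm[of R a b] by auto
  qed
  then show ?thesis by (simp add: sum.Sigma)
qed

lemma sum_Pow_power_card:
  fixes c :: real
  assumes "finite A"
  shows "(\<Sum>R\<in>Pow A. c ^ card R) = (1 + c) ^ card A"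
  using prod_add[OF assms, of "\<lambda>_. c" "\<lambda>_. 1"] by (simp add: add.commute)

text \<open>For fixed extremes \<open>a < b\<close> the sets between them add up to
  \<open>(1 + c) ^ (b - a - 1)\<close>, which \<open>2 ^ (b - a)\<close> beats: the ratio is at most
  5/8, the geometric sum at most 8/3, and \<open>c^2 / 2 * (8/3)\<close> is at most
  \<open>c / 3\<close>.\<close>

lemma higher_order_sum_le:
  fixes c :: real and L :: nat
  assumes c: "0 \<le> c" "c \<le> 1/4"
  shows "(\<Sum>S | S \<subseteq> {1..L} \<and> 2 \<le> card S. c ^ card S / 2 ^ (Max S - Min S)) \<le> L * (c / 3)"
proof -
  have inner: "(\<Sum>b\<in>{a<..L}. \<Sum>R\<in>Pow {a<..<b}. c ^ card (insert a (insert b R))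
      / 2 ^ (Max (insert a (insert b R)) - Min (insert a (insert b R)))) \<le> c / 3" for a
  proof -
    have layer: "(\<Sum>R\<in>Pow {a<..<b}. c ^ card (insert a (insert b R))
      / 2 ^ (Max (insert a (insert b R)) - Min (insert a (insert b R))))
        \<le> c\<^sup>2 / 2 * (5/8)^(b - Suc a)" if "a < b" for b
    proof -
      have "c ^ card (insert a (insert b R)) / 2 ^ (Max (insert a (insert b R)) - Min (insert a (insert b R)))
         = c\<^sup>2 / 2^(b-a) * c ^ card R" if R: "R \<in> Pow {a<..<b}" for R
      proof -
        have f: "finite R" "a \<notin> insert b R" "b \<notin> R" using R \<open>a < b\<close> finite_subset by auto
        then have "card (insert a (insert b R)) = card R + 2" by simp
        moreover have "Min (insert a (insert b R)) = a" "Max (insert a (insert b R)) = b"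
          using R f \<open>a < b\<close> by (intro Min_eqI Max_eqI; auto)+
        ultimately show ?thesis by (simp only: power_add) simp
      qed
      then have "(\<Sum>R\<in>Pow {a<..<b}. c ^ card (insert a (insert b R))
          / 2 ^ (Max (insert a (insert b R)) - Min (insert a (insert b R))))
        = (\<Sum>R\<in>Pow {a<..<b}. c\<^sup>2 / 2^(b-a) * c ^ card R)"
        by (rule sum.cong[OF refl])
      also have "\<dots> = c\<^sup>2 / 2^(b-a) * (1 + c)^(b - Suc a)"
        by (simp only: sum_distrib_left[symmetric] sum_Pow_power_card[OF finite_greaterThanLessThan]) simp
      also have "\<dots> = c\<^sup>2 / 2 * ((1 + c)/2)^(b - Suc a)"
      proof -
        have "b - a = Suc (b - Suc a)" using that by simp
        then show ?thesis by (simp add: power_divide)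
      qed
      also have "\<dots> \<le> c\<^sup>2 / 2 * (5/8)^(b - Suc a)"
        using c by (intro mult_left_mono power_mono) auto
      finally show ?thesis .
    qed
    have "(\<Sum>b\<in>{a<..L}. \<Sum>R\<in>Pow {a<..<b}. c ^ card (insert a (insert b R))
      / 2 ^ (Max (insert a (insert b R)) - Min (insert a (insert b R))))
       \<le> (\<Sum>b\<in>{a<..L}. c\<^sup>2 / 2 * (5/8)^(b - Suc a))"
      using layer by (intro sum_mono) auto
    also have "\<dots> = c\<^sup>2 / 2 * (\<Sum>s<L-a. (5/8)^s)"
      unfolding sum_distrib_left
      by (rule sum.reindex_bij_witness[where i = "\<lambda>s. s + Suc a" and j = "\<lambda>b. b - Suc a"]) auto
    also have "(\<Sum>s<L-a. (5/8)^s) = (1 - (5/8::real)^(L-a)) * (8/3)"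
      by (subst sum_gp_strict) simp
    also have "c\<^sup>2 / 2 * \<dots> \<le> c\<^sup>2 / 2 * (8/3)"
      by (intro mult_left_mono) auto
    also have "\<dots> \<le> c / 3"
      using mult_left_mono[of c "1/4" c] c by (simp add: power2_eq_square)
    finally show ?thesis .
  qed
  have "(\<Sum>S | S \<subseteq> {1..L} \<and> 2 \<le> card S. c ^ card S / 2 ^ (Max S - Min S)) \<le> (\<Sum>a\<in>{1..L}. c / 3)"
    unfolding sum_Min_Max by (intro sum_mono inner)
  then show ?thesis by simp
qed

section \<open>Haar functions of free rectangles and their pairing with the discrepancy\<close>

locale row_discrepancy =
  fixes L :: nat and \<xi> :: "nat \<Rightarrow> nat"
begin

text \<open>The point with index \<open>m\<close> counts from row \<open>m\<close> on, so on a strip of rows starting at \<open>m\<close> itself its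
  contribution is still constant: only \<open>m mod 2^a \<noteq> 0\<close> makes a rectangle occupied.\<close>

definition occupied :: "nat \<Rightarrow> nat \<Rightarrow> nat \<Rightarrow> nat \<Rightarrow> bool" where
  "occupied a w i j \<longleftrightarrow> (\<exists>m. m div 2^a = i \<and> m mod 2^a \<noteq> 0 \<and> \<xi> m div w = j)"

text \<open>The grid has \<open>2^L\<close> rows \<open>M\<close> and \<open>2^(L+2)\<close> columns
  \<open>q\<close>. A rectangle of level \<open>b\<close> has \<open>2^b\<close> rows and
  \<open>2^(L+1-b)\<close> columns, and the signs change at its two midlines. Each level has
  \<open>2^(L+1)\<close> rectangles, twice the number of rows.\<close>

definition haar :: "nat \<Rightarrow> nat \<Rightarrow> nat \<Rightarrow> real" where
  "haar b q M = (if occupied b (2^(L+1-b)) (M div 2^b) (q div 2^(L+1-b)) then 0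
     else (-1)^(q div 2^(L-b)) * (-1)^(M div 2^(b-1)))"

definition haar_prod :: "nat set \<Rightarrow> nat \<Rightarrow> nat \<Rightarrow> real" where
  "haar_prod S q M = (\<Prod>b\<in>S. haar b q M)"

text \<open>Expected minus actual count; with this sign the free rectangles pair positively.\<close>

definition disc :: "nat \<Rightarrow> nat \<Rightarrow> real" where
  "disc M q = real M * real q / 2^(L+2) - real (card {m\<in>{1..M}. \<xi> m < q})"

definition pairing :: "nat set \<Rightarrow> real" where
  "pairing S = (\<Sum>M<2^L. \<Sum>q<2^(L+2). haar_prod S q M * disc M q)"

text \<open>The block of height \<open>2^a\<close> and width \<open>2^(L+1-c)\<close> lies in one
  rectangle of level \<open>b\<close>. It also stays on one side of the midlines of that rectangle,
  except for the row sign when \<open>b = a\<close> and the column sign when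
  \<open>b = c\<close>.\<close>

lemma haar_block:
  assumes "1 \<le> a" "a \<le> b" "b \<le> c" "c \<le> L" "u < 2^a" "v < 2^(L+1-c)"
  shows "haar b (j*2^(L+1-c)+v) (i*2^a+u) = haar b (j*2^(L+1-c)) (i*2^a)
     * (if b = c then (-1)^(v div 2^(L-c)) else 1) * (if b = a then (-1)^(u div 2^(a-1)) else 1)"
proof -
  define q q0 M M0 where "q = j*2^(L+1-c)+v" and "q0 = j*2^(L+1-c)" and "M = i*2^a+u" and "M0 = i*2^a"
  have M: "M div 2^a = M0 div 2^a" using assms by (simp add: M_def M0_def)
  have q: "q div 2^(L+1-c) = q0 div 2^(L+1-c)" using assms by (simp add: q_def q0_def)
  have Mb: "M div 2^b = M0 div 2^b" using div_power2_cong[OF M] assms by simp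
  have qb: "q div 2^(L+1-b) = q0 div 2^(L+1-b)" using div_power2_cong[OF q] assms by simp
  have sM: "(-1::real)^(M div 2^(b-1)) = (-1)^(M0 div 2^(b-1)) * (if b = a then (-1)^(u div 2^(a-1)) else 1)"
  proof (cases "b = a")
    case True
    have "(2::nat)^a = 2 * 2^(a-1)" using assms(1) by (cases a) auto
    then have "M = 2^(a-1) * (2*i) + u" "M0 = 2^(a-1) * (2*i)" by (simp_all add: M_def M0_def)
    then have "M div 2^(a-1) = 2*i + u div 2^(a-1)" "M0 div 2^(a-1) = 2*i" by simp_all
    with True show ?thesis by (simp add: power_add)
  next
    case False
    with assms have "a \<le> b - 1" by simp
    from div_power2_cong[OF M this] False show ?thesis by simp
  qed
  have sq: "(-1::real)^(q div 2^(L-b)) = (-1)^(q0 div 2^(L-b)) * (if b = c then (-1)^(v div 2^(L-c)) else 1)"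
  proof (cases "b = c")
    case True
    have "(2::nat)^(L+1-c) = 2 * 2^(L-c)" using assms by (simp add: Suc_diff_le)
    then have "q = 2^(L-c) * (2*j) + v" "q0 = 2^(L-c) * (2*j)" by (simp_all add: q_def q0_def)
    then have "q div 2^(L-c) = 2*j + v div 2^(L-c)" "q0 div 2^(L-c) = 2*j" by simp_all
    with True show ?thesis by (simp add: power_add)
  next
    case False
    with assms have "L+1-c \<le> L-b" by simp
    from div_power2_cong[OF q this] False show ?thesis by simp
  qed
  have "haar b q M = haar b q0 M0 * (if b = c then (-1)^(v div 2^(L-c)) else 1)
      * (if b = a then (-1)^(u div 2^(a-1)) else 1)"
    unfolding haar_def Mb qb sM sq by simp
  then show ?thesis by (simp only: q_def q0_def M_def M0_def)
qed

text \<open>A product over \<open>S\<close> is again of Haar type, on the common refinement of its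
  grids: the rows come from \<open>Min S\<close>, the columns from \<open>Max S\<close>, and
  intermediate levels only contribute a constant.\<close>

lemma haar_prod_block:
  assumes S: "S \<noteq> {}" "S \<subseteq> {1..L}" and u: "u < 2^(Min S)" and v: "v < 2^(L+1-Max S)"
  shows "haar_prod S (j*2^(L+1-Max S)+v) (i*2^Min S+u) = haar_prod S (j*2^(L+1-Max S)) (i*2^Min S)
     * (-1)^(v div 2^(L-Max S)) * (-1)^(u div 2^(Min S-1))"
proof -
  have fin: "finite S" using S finite_subset by blast
  have mem: "Min S \<in> S" "Max S \<in> S" using fin S by auto
  then have bnd: "1 \<le> Min S" "Max S \<le> L" using S by auto
  have "haar b (j*2^(L+1-Max S)+v) (i*2^Min S+u) = haar b (j*2^(L+1-Max S)) (i*2^Min S)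
     * (if b = Max S then (-1)^(v div 2^(L-Max S)) else 1) * (if b = Min S then (-1)^(u div 2^(Min S-1)) else 1)"
    if "b \<in> S" for b
    using that fin bnd u v by (intro haar_block) auto
  then have "haar_prod S (j*2^(L+1-Max S)+v) (i*2^Min S+u) = (\<Prod>b\<in>S. haar b (j*2^(L+1-Max S)) (i*2^Min S)
     * (if b = Max S then (-1)^(v div 2^(L-Max S)) else 1) * (if b = Min S then (-1)^(u div 2^(Min S-1)) else 1))"
    unfolding haar_prod_def by (rule prod.cong[OF refl])
  also have "\<dots> = haar_prod S (j*2^(L+1-Max S)) (i*2^Min S)
     * (-1)^(v div 2^(L-Max S)) * (-1)^(u div 2^(Min S-1))"
    using fin mem by (simp add: prod.distrib haar_prod_def prod.delta)
  finally show ?thesis .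
qed

text \<open>The rectangle of level \<open>Max S\<close> has the same columns as the block and
  contains its rows, so a point in the block already annihilates that factor.\<close>

lemma haar_prod_occupied:
  assumes S: "S \<noteq> {}" "S \<subseteq> {1..L}" and occ: "occupied (Min S) (2^(L+1-Max S)) i j"
  shows "haar_prod S (j*2^(L+1-Max S)) (i*2^Min S) = 0"
proof -
  have fin: "finite S" using S finite_subset by blast
  have mem: "Min S \<in> S" "Max S \<in> S" "Min S \<le> Max S" using fin S by auto
  obtain m where m: "m div 2^Min S = i" "m mod 2^Min S \<noteq> 0" "\<xi> m div 2^(L+1-Max S) = j"
    using occ unfolding occupied_def by auto
  have "m div 2^Min S = (i*2^Min S) div 2^Min S" using m by simp
  then have "m div 2^Max S = (i*2^Min S) div 2^Max S" by (rule div_power2_cong) fact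
  moreover have "m mod 2^Max S \<noteq> 0"
  proof
    assume "m mod 2^Max S = 0"
    then have "2^Max S dvd m" by (simp add: dvd_eq_mod_eq_0)
    then have "2^Min S dvd m" using mem(3) by (meson dvd_trans le_imp_power_dvd)
    with m(2) show False by (simp add: dvd_eq_mod_eq_0)
  qed
  ultimately have "occupied (Max S) (2^(L+1-Max S)) ((i*2^Min S) div 2^Max S) j"
    unfolding occupied_def using m(3) by blast
  then have "haar (Max S) (j*2^(L+1-Max S)) (i*2^Min S) = 0"
    unfolding haar_def by simp
  then show ?thesis unfolding haar_prod_def using fin mem by (meson prod_zero)
qed

text \<open>The area term is bilinear and gives a product of two alternating sums,
  \<open>- k^2\<close> with \<open>k = 2^(a-1)\<close> and \<open>- h^2\<close>. The counting term
  vanishes point by point.\<close>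

lemma disc_block_sum:
  assumes h: "h > 0" and w: "w = 2 * h" and a: "1 \<le> a" and free: "\<not> occupied a w i j"
  shows "(\<Sum>u<2^a. \<Sum>v<w. ((-1)^(v div h) * (-1)^(u div 2^(a-1))) * disc (i*2^a+u) (j*w+v))
     = (2^(a-1))\<^sup>2 * (real h)\<^sup>2 / 2^(L+2)"
proof -
  define k where "k = (2::nat)^(a-1)"
  have k: "k > 0" "(2::nat)^a = 2*k" using a by (cases a; simp add: k_def)+
  \<comment> \<open>A common bound for the rows of the block, so that all counts are sums over one
    range of \<open>m\<close>.\<close>
  define B where "B = (i+1)*2^a"
  define s r :: "nat \<Rightarrow> real" where "s = (\<lambda>u. (-1)^(u div k))" and "r = (\<lambda>v. (-1)^(v div h))"
  define X Y :: "nat \<Rightarrow> nat \<Rightarrow> real" where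
    "X = (\<lambda>m u. of_bool (m \<le> i*2^a+u))" and "Y = (\<lambda>m v. of_bool (\<xi> m < j*w+v))"
  have disc: "disc (i*2^a+u) (j*w+v) = real (i*2^a+u) * real (j*w+v) / 2^(L+2) - (\<Sum>m=1..B. X m u * Y m v)"
    if "u < 2^a" for u v
  proof -
    have "{m\<in>{1..i*2^a+u}. \<xi> m < j*w+v} = {m\<in>{1..B}. m \<le> i*2^a+u \<and> \<xi> m < j*w+v}"
      using that by (auto simp: B_def)
    then show ?thesis unfolding disc_def X_def Y_def
      by (simp add: sum.If_cases Int_def flip: of_bool_conj)
  qed
  \<comment> \<open>A point in a row of the strip other than the first lies outside the columns of
    the free block, so its contribution is constant in \<open>v\<close>. Any other point, including
    one in the first row \<open>i * 2^a\<close>, is counted for all \<open>u\<close> or for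
    none.\<close>
  have vanish: "(\<Sum>u<2^a. s u * X m u) * (\<Sum>v<w. r v * Y m v) = 0" for m
  proof (cases "m div 2^a = i \<and> m mod 2^a \<noteq> 0")
    case True
    then have ne: "\<xi> m div w \<noteq> j" using free unfolding occupied_def by blast
    obtain c where "\<And>v. v < w \<Longrightarrow> Y m v = c"
    proof (cases "\<xi> m div w < j")
      case True
      then have "\<xi> m < j * w" using w h by (simp add: div_less_iff_less_mult)
      then show ?thesis by (intro that[of 1]) (simp add: Y_def)
    next
      case False
      with ne have "j + 1 \<le> \<xi> m div w" by simp
      then have "(j+1) * w \<le> \<xi> m" using w h by (simp add: less_eq_div_iff_mult_less_eq)
      then show ?thesis by (intro that[of 0]) (simp add: Y_def)
    qed
    then have "(\<Sum>v<w. r v * Y m v) = (\<Sum>v<2*h. (-1)^(v div h) * c)"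
      unfolding w r_def by simp
    then show ?thesis using sum_alternating_const[OF h] by simp
  next
    case False
    obtain c where "\<And>u. u < 2^a \<Longrightarrow> X m u = c"
    proof (cases "m \<le> i * 2^a")
      case True
      then show ?thesis by (intro that[of 1]) (simp add: X_def)
    next
      case gt: False
      have "m div 2^a \<noteq> i"
      proof
        assume "m div 2^a = i"
        with False have "m = i * 2^a" by (metis add.right_neutral div_mult_mod_eq)
        with gt show False by simp
      qed
      moreover have "i \<le> m div 2^a" using gt by (simp add: less_eq_div_iff_mult_less_eq)
      ultimately have "i + 1 \<le> m div 2^a" by simp
      then have "(i+1) * 2^a \<le> m" by (simp add: less_eq_div_iff_mult_less_eq)
      then show ?thesis by (intro that[of 0]) (simp add: X_def)
    qed
    then have "(\<Sum>u<2^a. s u * X m u) = (\<Sum>u<2*k. (-1)^(u div k) * c)"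
      unfolding k s_def by simp
    then show ?thesis using sum_alternating_const[OF k(1)] by simp
  qed
  have "(\<Sum>u<2^a. \<Sum>v<w. (r v * s u) * disc (i*2^a+u) (j*w+v))
     = (\<Sum>u<2^a. \<Sum>v<w. (s u * real (i*2^a+u)) * (r v * real (j*w+v)) / 2^(L+2)
          - (\<Sum>m=1..B. (s u * X m u) * (r v * Y m v)))"
    by (intro sum.cong refl) (simp add: disc right_diff_distrib sum_distrib_left mult_ac)
  also have "\<dots> = (\<Sum>u<2^a. s u * real (i*2^a+u)) * (\<Sum>v<w. r v * real (j*w+v)) / 2^(L+2)
          - (\<Sum>u<2^a. \<Sum>v<w. \<Sum>m=1..B. (s u * X m u) * (r v * Y m v))"
    by (simp add: sum_subtractf sum_product sum_divide_distrib)
  also have "(\<Sum>u<2^a. \<Sum>v<w. \<Sum>m=1..B. (s u * X m u) * (r v * Y m v))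
     = (\<Sum>m=1..B. (\<Sum>u<2^a. s u * X m u) * (\<Sum>v<w. r v * Y m v))"
    unfolding sum_product by (subst sum.swap, rule sum.cong[OF refl], subst sum.swap, rule refl)
  also have "\<dots> = 0" by (intro sum.neutral ballI vanish)
  also have "(\<Sum>u<2^a. s u * real (i*2^a+u)) = - (real k)\<^sup>2"
    unfolding k(2) s_def by (rule sum_alternating_linear[OF k(1)])
  also have "(\<Sum>v<w. r v * real (j*w+v)) = - (real h)\<^sup>2"
    unfolding w r_def by (rule sum_alternating_linear[OF h])
  finally show ?thesis by (simp add: r_def s_def k_def)
qed

text \<open>Every block contributes its corner value times one constant. The constant displays the
  numbers \<open>2^(L - Min S)\<close> and \<open>2^(Max S + 1)\<close> of row and column blocks as
  divisors, so that they cancel against the number of terms in the sum.\<close>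

lemma pairing_eq:
  assumes S: "S \<noteq> {}" "S \<subseteq> {1..L}"
  shows "pairing S = (\<Sum>i<2^(L-Min S). \<Sum>j<2^(Max S+1). haar_prod S (j*2^(L+1-Max S)) (i*2^Min S))
     * (4^L / 16 / 2^(L - Min S) / 2^(Max S+1) / 2^(Max S - Min S) * 2)"
proof -
  have fin: "finite S" using S finite_subset by blast
  have mem: "Min S \<in> S" "Max S \<in> S" "Min S \<le> Max S" using fin S by auto
  then have bnd: "1 \<le> Min S" "Max S \<le> L" using S by auto
  define a c w where "a = Min S" and "c = Max S" and "w = (2::nat)^(L+1-c)"
  have ac: "1 \<le> a" "a \<le> c" "c \<le> L" using mem bnd by (auto simp: a_def c_def)
  have w: "w = 2 * 2^(L-c)" using ac by (simp add: w_def Suc_diff_le)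
  have eL: "(2::nat)^L = 2^(L-a) * 2^a" using ac by (simp flip: power_add)
  have eK: "(2::nat)^(L+2) = 2^(c+1) * w" using ac by (simp add: w_def flip: power_add)
  have const: "(2^(a-1))\<^sup>2 * (real (2^(L-c)))\<^sup>2 / 2^(L+2) = 4^L / 16 / 2^(L - a) / 2^(c+1) / 2^(c-a) * 2"
  proof -
    obtain a' where a': "a = Suc a'" using ac by (cases a) auto
    obtain d where d: "c = Suc a' + d" using ac a' by (metis le_iff_add)
    obtain e where e: "L = Suc a' + d + e" using ac d by (metis le_iff_add)
    have "(4::real)^n = 2^n * 2^n" for n by (simp flip: power_mult_distrib)
    then show ?thesis by (simp add: a' d e power_add power2_eq_square field_simps)
  qed
  have block: "(\<Sum>u<2^a. \<Sum>v<w. haar_prod S (j*w+v) (i*2^a+u) * disc (i*2^a+u) (j*w+v))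
     = haar_prod S (j*w) (i*2^a) * ((2^(a-1))\<^sup>2 * (real (2^(L-c)))\<^sup>2 / 2^(L+2))" for i j
  proof -
    have "(\<Sum>u<2^a. \<Sum>v<w. haar_prod S (j*w+v) (i*2^a+u) * disc (i*2^a+u) (j*w+v))
      = haar_prod S (j*w) (i*2^a) * (\<Sum>u<2^a. \<Sum>v<w.
          ((-1)^(v div 2^(L-c)) * (-1)^(u div 2^(a-1))) * disc (i*2^a+u) (j*w+v))"
      unfolding sum_distrib_left
      using haar_prod_block[OF S] by (intro sum.cong refl) (simp add: a_def c_def w_def mult_ac)
    moreover have "haar_prod S (j*w) (i*2^a) = 0 \<or> \<not> occupied a w i j"
      using haar_prod_occupied[OF S] unfolding a_def c_def w_def by blast
    ultimately show ?thesis
      using disc_block_sum[OF _ w ac(1), of i j] by auto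
  qed
  have "pairing S = (\<Sum>i<2^(L-a). \<Sum>u<2^a. \<Sum>j<2^(c+1). \<Sum>v<w.
      haar_prod S (j*w+v) (i*2^a+u) * disc (i*2^a+u) (j*w+v))"
    unfolding pairing_def eL eK sum_lessThan_blocks ..
  also have "\<dots> = (\<Sum>i<2^(L-a). \<Sum>j<2^(c+1). \<Sum>u<2^a. \<Sum>v<w.
      haar_prod S (j*w+v) (i*2^a+u) * disc (i*2^a+u) (j*w+v))"
    by (rule sum.cong[OF refl], rule sum.swap)
  also have "\<dots> = (\<Sum>i<2^(L-a). \<Sum>j<2^(c+1). haar_prod S (j*w) (i*2^a))
      * ((2^(a-1))\<^sup>2 * (real (2^(L-c)))\<^sup>2 / 2^(L+2))"
    unfolding block sum_distrib_right ..
  finally show ?thesis unfolding const by (simp add: a_def c_def w_def)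
qed

lemma abs_haar_le: "\<bar>haar b q M\<bar> \<le> 1"
  by (simp add: haar_def abs_mult)

lemma abs_haar_prod_le: "\<bar>haar_prod S q M\<bar> \<le> 1"
  unfolding haar_prod_def abs_prod by (rule prod_le_1) (simp add: abs_haar_le)

text \<open>Corner values are at most 1 in size, which leaves a decay in the spread of
  \<open>S\<close> that makes the higher orders summable.\<close>

lemma abs_pairing_le:
  assumes S: "S \<noteq> {}" "S \<subseteq> {1..L}"
  shows "\<bar>pairing S\<bar> \<le> 2 * (4^L/16) / 2^(Max S - Min S)"
proof -
  have "\<bar>\<Sum>i<2^(L-Min S). \<Sum>j<2^(Max S+1). haar_prod S (j*2^(L+1-Max S)) (i*2^Min S)\<bar>
     \<le> (\<Sum>i<(2::nat)^(L-Min S). \<Sum>j<(2::nat)^(Max S+1). 1)"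
    by (intro order_trans[OF sum_abs] sum_mono abs_haar_prod_le)
  also have "\<dots> = 2^(L-Min S) * 2^(Max S+1)" by simp
  finally have "\<bar>pairing S\<bar> \<le> (2^(L-Min S) * 2^(Max S+1))
     * (4^L / 16 / 2^(L - Min S) / 2^(Max S+1) / 2^(Max S - Min S) * 2)"
    unfolding pairing_eq[OF S] abs_mult[of _ "_ * 2"]
    by (subst abs_of_nonneg[of "_ * 2"], simp, rule mult_right_mono, auto)
  then show ?thesis by simp
qed

text \<open>A strip of \<open>2^b\<close> rows meets at most \<open>2^b - 1\<close> of the \<open>2^(b+1)\<close> columns, so at least
  half of the rectangles at level \<open>b\<close> are free of points.\<close>

lemma pairing_singleton_ge:
  assumes b: "1 \<le> b" "b \<le> L"
  shows "pairing {b} \<ge> 4^L/16"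
proof -
  define w where "w = (2::nat)^(L+1-b)"
  have w: "w = 2 * 2^(L-b)" using b by (simp add: w_def Suc_diff_le)
  \<comment> \<open>At the corner of a rectangle both exponents are even, so the value on a free
    rectangle is 1.\<close>
  have corner: "haar b (j*w) (i*2^b) = of_bool (\<not> occupied b w i j)" for i j
  proof -
    obtain b' where b': "b = Suc b'" using b by (cases b) auto
    have "i*2^b div 2^(b-1) = 2*i" by (simp add: b')
    moreover have "j*w div 2^(L-b) = 2*j" unfolding w by simp
    moreover have "j*w div 2^(L+1-b) = j" by (simp add: w_def)
    ultimately show ?thesis
      unfolding haar_def by (simp add: w_def)
  qed
  have row: "(\<Sum>j<2^(b+1). haar b (j*w) (i*2^b)) \<ge> 2^b" for i
  proof -
    define H where "H = (\<lambda>m. \<xi> m div w) ` {i*2^b+1..<i*2^b+2^b}"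
    have "occupied b w i j \<Longrightarrow> j \<in> H" for j
    proof -
      assume "occupied b w i j"
      then obtain m where m: "m div 2^b = i" "m mod 2^b \<noteq> 0" "\<xi> m div w = j"
        unfolding occupied_def by auto
      have "m = i * 2^b + m mod 2^b" using m(1) by (metis div_mult_mod_eq)
      moreover have "m mod 2^b < 2^b" by simp
      ultimately have "m \<in> {i*2^b+1..<i*2^b+2^b}"
        using m(2) unfolding atLeastLessThan_iff by linarith
      with m(3) show "j \<in> H" unfolding H_def by auto
    qed
    then have sub: "{..<2^(b+1)} - H \<subseteq> {j\<in>{..<2^(b+1)}. \<not> occupied b w i j}" by auto
    have "card H \<le> card {i*2^b+1..<i*2^b+2^b}" unfolding H_def by (rule card_image_le) simp
    then have "2^b \<le> 2^(b+1) - card H" by simp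
    also have "\<dots> \<le> card ({..<2^(b+1)} - H)"
      using diff_card_le_card_Diff[of H "{..<2^(b+1)}"] by (simp add: H_def)
    also have "\<dots> \<le> card {j\<in>{..<2^(b+1)}. \<not> occupied b w i j}" by (rule card_mono[OF _ sub]) simp
    finally have "2^b \<le> card {j\<in>{..<2^(b+1)}. \<not> occupied b w i j}" .
    then have "real (2^b) \<le> real (card {j\<in>{..<2^(b+1)}. \<not> occupied b w i j})"
      by (rule of_nat_mono)
    then show ?thesis by (simp add: corner sum.If_cases Int_def)
  qed
  define X where "X = (\<Sum>i<(2::nat)^(L-b). \<Sum>j<(2::nat)^(b+1). haar b (j*w) (i*2^b))"
  define k :: real where "k = 4^L / 16 / 2^(L - b) / 2^(b+1) * 2"
  have "pairing {b} = X * k"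
    using b by (subst pairing_eq) (simp_all add: haar_prod_def w_def X_def k_def)
  moreover have "X \<ge> (\<Sum>i<(2::nat)^(L-b). 2^b)"
    unfolding X_def by (rule sum_mono) (rule row)
  then have "X * k \<ge> (2^(L-b) * 2^b) * k"
    by (intro mult_right_mono) (simp_all add: k_def)
  ultimately show ?thesis by (simp add: k_def)
qed

text \<open>Within a row the column sign of level \<open>Max S\<close> alternates on every block.
  The zero mean later bounds the row sums of the positive Riesz product and makes
  \<open>ramp\<close> periodic.\<close>

lemma sum_haar_prod_row:
  assumes S: "S \<noteq> {}" "S \<subseteq> {1..L}"
  shows "(\<Sum>q<2^(L+2). haar_prod S q M) = 0"
proof -
  have fin: "finite S" using S finite_subset by blast
  then have c: "Max S \<le> L" using S by auto
  define a c w where "a = Min S" and "c = Max S" and "w = (2::nat)^(L+1-c)"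
  have w: "w = 2 * 2^(L-c)" using c by (simp add: w_def c_def Suc_diff_le)
  have eK: "(2::nat)^(L+2) = 2^(c+1) * w" using c by (simp add: w_def c_def flip: power_add)
  define s where "s = (-1::real)^(M mod 2^a div 2^(a-1))"
  have "(\<Sum>q<2^(L+2). haar_prod S q M) = (\<Sum>j<2^(c+1). \<Sum>v<w. haar_prod S (j*w+v) M)"
    unfolding eK sum_lessThan_blocks ..
  also have "\<dots> = (\<Sum>j<2^(c+1). \<Sum>v<w. (-1)^(v div 2^(L-c)) * (haar_prod S (j*w) (M div 2^a * 2^a) * s))"
  proof (intro sum.cong refl)
    fix j v assume "v \<in> {..<w}"
    then have "haar_prod S (j*w+v) (M div 2^a * 2^a + M mod 2^a) = haar_prod S (j*w) (M div 2^a * 2^a)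
       * (-1)^(v div 2^(L-c)) * s"
      unfolding a_def c_def w_def s_def by (intro haar_prod_block[OF S]) auto
    then show "haar_prod S (j*w+v) M = (-1)^(v div 2^(L-c)) * (haar_prod S (j*w) (M div 2^a * 2^a) * s)"
      unfolding div_mult_mod_eq by (simp only: mult_ac)
  qed
  also have "\<dots> = 0"
    unfolding w by (intro sum.neutral ballI sum_alternating_const) simp
  finally show ?thesis .
qed

text \<open>In units of \<open>4^L/16\<close> the singletons give at least \<open>c * L\<close> and
  all larger sets at most \<open>2 * L * c / 3\<close>, so a third of the main term survives. Beyond
  singletons only the sizes of the weights enter, which covers real and imaginary Riesz products
  alike.\<close>

lemma weighted_pairing_ge:
  fixes c :: real
  assumes c: "0 \<le> c" "c \<le> 1/4"
    and w1: "\<And>b. w {b} = c" and w: "\<And>S. \<bar>w S\<bar> \<le> c ^ card S"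
  shows "(\<Sum>S\<in>Pow {1..L} - {{}}. w S * pairing S) \<ge> c/3 * L * (4^L/16)"
proof -
  have split: "Pow {1..L} - {{}} = (\<lambda>b. {b}) ` {1..L} \<union> {S. S \<subseteq> {1..L} \<and> 2 \<le> card S}"
  proof -
    have "S \<in> (\<lambda>b. {b}) ` {1..L}" if "S \<subseteq> {1..L}" "S \<noteq> {}" "\<not> 2 \<le> card S" for S
    proof -
      have "finite S" using that finite_subset by blast
      with that have "card S \<noteq> 0" by simp
      with that(3) have "card S = 1" by linarith
      then obtain x where "S = {x}" by (rule card_1_singletonE)
      then show ?thesis using that by auto
    qed
    then show ?thesis by auto
  qed
  have "(\<Sum>S\<in>Pow {1..L} - {{}}. w S * pairing S)
     = (\<Sum>S\<in>(\<lambda>b. {b}) ` {1..L}. w S * pairing S) + (\<Sum>S | S \<subseteq> {1..L} \<and> 2 \<le> card S. w S * pairing S)"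
    unfolding split by (rule sum.union_disjoint) auto
  also have "(\<Sum>S\<in>(\<lambda>b. {b}) ` {1..L}. w S * pairing S) = (\<Sum>b\<in>{1..L}. c * pairing {b})"
    by (subst sum.reindex) (auto simp: inj_on_def w1)
  finally have "(\<Sum>S\<in>Pow {1..L} - {{}}. w S * pairing S) = (\<Sum>b\<in>{1..L}. c * pairing {b})
      + (\<Sum>S | S \<subseteq> {1..L} \<and> 2 \<le> card S. w S * pairing S)" .
  moreover have "(\<Sum>b\<in>{1..L}. c * (4^L/16)) \<le> (\<Sum>b\<in>{1..L}. c * pairing {b})"
    using c pairing_singleton_ge by (intro sum_mono mult_left_mono) auto
  ultimately have 1: "(\<Sum>S\<in>Pow {1..L} - {{}}. w S * pairing S) \<ge> L * (c * (4^L/16))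
      + (\<Sum>S | S \<subseteq> {1..L} \<and> 2 \<le> card S. w S * pairing S)" by simp
  have "\<bar>\<Sum>S | S \<subseteq> {1..L} \<and> 2 \<le> card S. w S * pairing S\<bar>
     \<le> (\<Sum>S | S \<subseteq> {1..L} \<and> 2 \<le> card S. 2 * (4^L/16) * (c ^ card S / 2 ^ (Max S - Min S)))"
  proof (intro order_trans[OF sum_abs] sum_mono)
    fix S assume "S \<in> {S. S \<subseteq> {1..L} \<and> 2 \<le> card S}"
    then have S: "S \<noteq> {}" "S \<subseteq> {1..L}" by auto
    have "\<bar>w S * pairing S\<bar> \<le> c ^ card S * (2 * (4^L/16) / 2^(Max S - Min S))"
      unfolding abs_mult using w abs_pairing_le[OF S] c by (intro mult_mono) auto
    then show "\<bar>w S * pairing S\<bar> \<le> 2 * (4^L/16) * (c ^ card S / 2 ^ (Max S - Min S))"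
      by (simp add: mult_ac)
  qed
  also have "\<dots> \<le> 2 * (4^L/16) * (L * (c/3))"
    unfolding sum_distrib_left[symmetric] using higher_order_sum_le[OF c] by (intro mult_left_mono) auto
  finally have "\<bar>\<Sum>S | S \<subseteq> {1..L} \<and> 2 \<le> card S. w S * pairing S\<bar> \<le> c * L * 4^L / 24" by (simp add: mult_ac)
  moreover have "L * (c * (4^L/16)) = c * L * 4^L / 16" "c/3 * L * (4^L/16) = c * L * 4^L / 48" by simp_all
  ultimately show ?thesis using 1 by linarith
qed

section \<open>Riesz products and the two discrepancy bounds\<close>

lemma abs_disc_le: "q \<le> 2^(L+2) \<Longrightarrow> \<bar>disc M q\<bar> \<le> M"
proof -
  assume q: "q \<le> 2^(L+2)"
  have "card {m\<in>{1..M}. \<xi> m < q} \<le> card {1..M}" by (rule card_mono) auto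
  then have "real (card {m\<in>{1..M}. \<xi> m < q}) \<le> M" by simp
  moreover have "real q \<le> 2^(L+2)" using q by (metis of_nat_le_iff of_nat_numeral of_nat_power)
  then have "real M * real q / 2^(L+2) \<le> real M * 2^(L+2) / 2^(L+2)"
    by (intro divide_right_mono mult_left_mono) auto
  moreover have "0 \<le> real M * real q / 2^(L+2)" by simp
  moreover have "real M * 2^(L+2) / 2^(L+2) = M" by simp
  ultimately show ?thesis unfolding disc_def abs_le_iff by linarith
qed

text \<open>A Riesz product in expanded form without the term of the empty set. Arbitrary weights
  let both test functions share one pairing estimate.\<close>

definition riesz :: "(nat set \<Rightarrow> real) \<Rightarrow> nat \<Rightarrow> nat \<Rightarrow> real" where
  "riesz w q M = (\<Sum>S\<in>Pow {1..L} - {{}}. w S * haar_prod S q M)"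

lemma sum_riesz_row: "(\<Sum>q<2^(L+2). riesz w q M) = 0"
proof -
  have "(\<Sum>q<2^(L+2). riesz w q M) = (\<Sum>S\<in>Pow {1..L} - {{}}. w S * (\<Sum>q<2^(L+2). haar_prod S q M))"
    unfolding riesz_def sum_distrib_left by (rule sum.swap)
  also have "\<dots> = 0"
  proof (intro sum.neutral ballI)
    fix S assume "S \<in> Pow {1..L} - {{}}"
    then have "(\<Sum>q<2^(L+2). haar_prod S q M) = 0" by (intro sum_haar_prod_row) auto
    then show "w S * (\<Sum>q<2^(L+2). haar_prod S q M) = 0" by (simp only: mult_zero_right)
  qed
  finally show ?thesis .
qed

lemma sum_riesz_disc:
  "(\<Sum>M<2^L. \<Sum>q<2^(L+2). riesz w q M * disc M q) = (\<Sum>S\<in>Pow {1..L} - {{}}. w S * pairing S)"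
proof -
  have "(\<Sum>M<2^L. \<Sum>q<2^(L+2). riesz w q M * disc M q)
    = (\<Sum>M<2^L. \<Sum>q<2^(L+2). \<Sum>S\<in>Pow {1..L} - {{}}. w S * (haar_prod S q M * disc M q))"
    unfolding riesz_def sum_distrib_right mult.assoc ..
  also have "\<dots> = (\<Sum>M<2^L. \<Sum>S\<in>Pow {1..L} - {{}}. \<Sum>q<2^(L+2). w S * (haar_prod S q M * disc M q))"
    by (rule sum.cong[OF refl], rule sum.swap)
  also have "\<dots> = (\<Sum>S\<in>Pow {1..L} - {{}}. \<Sum>M<2^L. \<Sum>q<2^(L+2). w S * (haar_prod S q M * disc M q))"
    by (rule sum.swap)
  finally show ?thesis by (simp add: pairing_def sum_distrib_left)
qed

lemma exists_large_disc:
  assumes "L \<ge> 1"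
  shows "\<exists>M<2^L. \<exists>q<2^(L+2). \<bar>disc M q\<bar> \<ge> L / 2048"
proof (rule ccontr)
  assume "\<not> ?thesis"
  then have small: "\<bar>disc M q\<bar> \<le> L / 2048" if "M < 2^L" "q < 2^(L+2)" for M q
    using that by (meson less_eq_real_def not_le)
  define w :: "nat set \<Rightarrow> real" where "w = (\<lambda>S. (1/4) ^ card S)"
  have prod: "riesz w q M = (\<Prod>b\<in>{1..L}. haar b q M / 4 + 1) - 1" for q M
  proof -
    have "(\<Prod>b\<in>{1..L}. haar b q M / 4 + 1) = (\<Sum>S\<in>Pow {1..L}. w S * haar_prod S q M)"
      by (subst prod_add) (simp_all add: w_def haar_prod_def prod_dividef power_divide)
    also have "\<dots> = w {} * haar_prod {} q M + riesz w q M"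
      unfolding riesz_def by (rule sum.remove) auto
    finally show ?thesis by (simp add: w_def haar_prod_def)
  qed
  \<comment> \<open>A nonnegative \<open>P\<close> satisfies
    \<open>\<bar>P - 1\<bar> \<le> P + 1\<close>; summed over a row, the mean of
    \<open>riesz\<close> drops out and only the constant 2 remains.\<close>
  have "\<bar>riesz w q M\<bar> \<le> riesz w q M + 2" for q M
  proof -
    have "(\<Prod>b\<in>{1..L}. haar b q M / 4 + 1) \<ge> 0"
    proof (intro prod_nonneg ballI)
      fix b show "0 \<le> haar b q M / 4 + 1" using abs_haar_le[of b q M] by (simp add: abs_le_iff)
    qed
    then show ?thesis unfolding prod by linarith
  qed
  then have "(\<Sum>q<2^(L+2). \<bar>riesz w q M\<bar>) \<le> (\<Sum>q<2^(L+2). riesz w q M + 2)" for M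
    by (rule sum_mono)
  then have l1: "(\<Sum>q<2^(L+2). \<bar>riesz w q M\<bar>) \<le> 2 * 2^(L+2)" for M
    unfolding sum.distrib sum_riesz_row by simp
  \<comment> \<open>The left side is \<open>L * 4^L / 192\<close>, whereas discrepancies of at most
    \<open>L / 2048\<close> would allow only \<open>L * 4^L / 256\<close>.\<close>
  have "(1/4)/3 * L * (4^L/16) \<le> (\<Sum>M<2^L. \<Sum>q<2^(L+2). riesz w q M * disc M q)"
    unfolding sum_riesz_disc by (rule weighted_pairing_ge) (auto simp: w_def)
  also have "\<dots> \<le> (\<Sum>M<2^L. \<Sum>q<2^(L+2). \<bar>riesz w q M\<bar> * (L/2048))"
  proof (intro sum_mono)
    fix M q :: nat assume "M \<in> {..<2^L}" "q \<in> {..<2^(L+2)}"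
    then have "\<bar>riesz w q M * disc M q\<bar> \<le> \<bar>riesz w q M\<bar> * (L/2048)"
      unfolding abs_mult using small by (intro mult_left_mono) auto
    then show "riesz w q M * disc M q \<le> \<bar>riesz w q M\<bar> * (L/2048)" by linarith
  qed
  also have "\<dots> \<le> (\<Sum>M<(2::nat)^L. 2 * 2^(L+2) * (L/2048))"
  proof (rule sum_mono)
    fix M
    show "(\<Sum>q<2^(L+2). \<bar>riesz w q M\<bar> * (L/2048)) \<le> 2 * 2^(L+2) * (L/2048)"
      unfolding sum_distrib_right[symmetric] by (intro mult_right_mono l1) simp
  qed
  also have "\<dots> = 2^L * 2^L * (8 * L/2048)" by simp
  also have "2^L * 2^L = (4::real)^L" by (simp flip: power_mult_distrib)
  finally show False using assms by simp
qed

lemma exists_large_test_sum: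
  assumes "L \<ge> 1"
  shows "\<exists>M<2^L. \<exists>F. (\<forall>q. \<bar>F q\<bar> \<le> 2) \<and> (\<Sum>q<2^(L+2). F q) = 0
     \<and> sqrt L * 2^L / 192 \<le> (\<Sum>q<2^(L+2). F q * disc M q)"
proof -
  \<comment> \<open>This order of \<open>c\<close> keeps a product of \<open>L\<close> factors
    \<open>1 + c^2\<close> bounded; here \<open>c^2 * L = 1/16\<close>.\<close>
  define c where "c = 1 / (4 * sqrt L)"
  have c: "0 \<le> c" "c \<le> 1/4" using assms by (auto simp: c_def field_simps)
  have cL: "c\<^sup>2 * L \<le> 1" using assms by (simp add: c_def power_divide power_mult_distrib)
  \<comment> \<open>Sets of even size get weight 0, in particular the empty set, so no constant has
    to be subtracted from the product.\<close>
  define w :: "nat set \<Rightarrow> real" where "w = (\<lambda>S. Im ((\<i> * c) ^ card S))"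
  have w1: "w {b} = c" for b by (simp add: w_def)
  have w: "\<bar>w S\<bar> \<le> c ^ card S" for S
    unfolding w_def using abs_Im_le_cmod[of "(\<i> * c) ^ card S"] c by (simp add: norm_power norm_mult)
  have prod: "riesz w q M = Im (\<Prod>b\<in>{1..L}. \<i> * c * haar b q M + 1)" for q M
  proof -
    have "(\<Prod>b\<in>{1..L}. \<i> * c * haar b q M + 1) = (\<Sum>S\<in>Pow {1..L}. (\<i> * c) ^ card S * haar_prod S q M)"
      by (subst prod_add) (simp_all add: prod.distrib haar_prod_def)
    then have "Im (\<Prod>b\<in>{1..L}. \<i> * c * haar b q M + 1) = (\<Sum>S\<in>Pow {1..L}. w S * haar_prod S q M)"
      by (simp add: w_def)
    also have "\<dots> = w {} * haar_prod {} q M + riesz w q M"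
      unfolding riesz_def by (rule sum.remove) auto
    finally show ?thesis by (simp add: w_def)
  qed
  have bound: "\<bar>riesz w q M\<bar> \<le> 2" for q M
  proof -
    have "cmod (\<i> * c * haar b q M + 1) \<le> exp (c\<^sup>2 / 2)" for b
    proof -
      have "(haar b q M)\<^sup>2 \<le> 1" using abs_haar_le[of b q M] by (simp add: abs_square_le_1)
      then have "c\<^sup>2 * (haar b q M)\<^sup>2 \<le> c\<^sup>2" by (intro mult_left_le) auto
      then have "(cmod (\<i> * c * haar b q M + 1))\<^sup>2 \<le> 1 + c\<^sup>2"
        by (simp add: cmod_power2 power_mult_distrib)
      also have "\<dots> \<le> exp (c\<^sup>2)" by (rule exp_ge_add_one_self)
      also have "\<dots> = (exp (c\<^sup>2 / 2))\<^sup>2" by (simp add: power2_eq_square flip: exp_add)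
      finally show ?thesis by (rule power2_le_imp_le) simp
    qed
    then have "(\<Prod>b\<in>{1..L}. cmod (\<i> * c * haar b q M + 1)) \<le> (\<Prod>b\<in>{1..L}. exp (c\<^sup>2/2))"
      by (intro prod_mono) auto
    also have "\<dots> = exp (c\<^sup>2 * L / 2)" by (simp flip: exp_of_nat_mult add: mult_ac)
    also have "\<dots> \<le> exp (1/2)" using cL by simp
    also have "\<dots> \<le> 2"
    proof (rule power2_le_imp_le)
      have "(exp (1/2::real))\<^sup>2 = exp 1" by (simp add: power2_eq_square flip: exp_add)
      then show "(exp (1/2::real))\<^sup>2 \<le> 2\<^sup>2" using exp_le by simp
    qed simp
    finally show ?thesis
      unfolding prod using abs_Im_le_cmod[of "\<Prod>b\<in>{1..L}. \<i> * c * haar b q M + 1"]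
      by (simp add: prod_norm)
  qed
  \<comment> \<open>Averaging over the \<open>2^L\<close> rows: the total over all of them is at
    least \<open>sqrt L * 4^L / 192\<close>.\<close>
  have "\<exists>M<2^L. sqrt L * 2^L / 192 \<le> (\<Sum>q<2^(L+2). riesz w q M * disc M q)"
  proof (rule ccontr)
    assume "\<not> ?thesis"
    then have "(\<Sum>M<2^L. \<Sum>q<2^(L+2). riesz w q M * disc M q) < (\<Sum>M<(2::nat)^L. sqrt L * 2^L / 192)"
      by (intro sum_strict_mono) (auto simp: not_le lessThan_empty_iff)
    also have "\<dots> = sqrt L / 12 * ((2^L * 2^L) / 16)" by simp
    also have "2^L * 2^L = (4::real)^L" by (simp flip: power_mult_distrib)
    also have "sqrt L / 12 = c / 3 * L"
    proof -
      have "real L = sqrt L * sqrt L" by simp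
      then have "c / 3 * L = c / 3 * (sqrt L * sqrt L)" by (simp only:)
      then show ?thesis using assms by (simp add: c_def real_div_sqrt)
    qed
    also have "c / 3 * L * (4^L/16) \<le> (\<Sum>M<2^L. \<Sum>q<2^(L+2). riesz w q M * disc M q)"
      unfolding sum_riesz_disc by (rule weighted_pairing_ge[OF c w1 w])
    finally show False by simp
  qed
  then obtain M where M: "M < 2^L" "sqrt L * 2^L / 192 \<le> (\<Sum>q<2^(L+2). riesz w q M * disc M q)"
    by blast
  then show ?thesis
    by (intro exI[of _ M] conjI exI[of _ "\<lambda>q. riesz w q M"] allI bound sum_riesz_row)
qed

end

subsection \<open>Couplings on the circle\<close>

text \<open>The representative in \<open>[0,1)\<close>; \<open>rep_circle\<close> alone picks an
  arbitrary real of the class.\<close>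

definition coord :: "circle \<Rightarrow> real" where
  "coord z = frac (rep_circle z)"

lemma coord_bounds: "0 \<le> coord z" "coord z < 1"
  by (simp_all add: coord_def frac_lt_1)

lemma to_circle_eq_iff: "to_circle x = to_circle y \<longleftrightarrow> x - y \<in> \<int>"
  by (rule circle.abs_eq_iff)

lemma to_circle_coord [simp]: "to_circle (coord z) = z"
proof -
  have "to_circle (coord z) = to_circle (rep_circle z)"
    unfolding to_circle_eq_iff coord_def by (simp add: frac_def)
  also have "\<dots> = z" by (rule Quotient_abs_rep[OF Quotient_circle])
  finally show ?thesis .
qed

lemma coord_to_circle: "t \<in> {0..<1} \<Longrightarrow> coord (to_circle t) = t"
proof -
  assume t: "t \<in> {0..<1}"
  have "coord (to_circle t) - t \<in> \<int>"
    unfolding to_circle_eq_iff[symmetric] by simp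
  then obtain k :: int where k: "coord (to_circle t) - t = of_int k" by (auto elim: Ints_cases)
  then have "\<bar>real_of_int k\<bar> < 1" using t coord_bounds[of "to_circle t"] by auto
  then have "k = 0" by linarith
  then show ?thesis using k by simp
qed

text \<open>\<open>coord\<close> jumps at 0, so continuity cannot be used. For \<open>a < 1\<close>
  the sublevel set is the image of the compact interval \<open>{0..a}\<close>, hence closed.\<close>

lemma measurable_coord [measurable]: "coord \<in> borel_measurable borel"
proof (rule borel_measurableI_le)
  fix a
  have "{z. coord z \<le> a} \<in> sets borel"
  proof (cases "a < 1")
    case True
    have "{z. coord z \<le> a} = to_circle ` {0..a}"
    proof (intro set_eqI iffI)
      fix z assume "z \<in> {z. coord z \<le> a}"
      then have "z = to_circle (coord z)" "coord z \<in> {0..a}" using coord_bounds by auto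
      then show "z \<in> to_circle ` {0..a}" by blast
    next
      fix z assume "z \<in> to_circle ` {0..a}"
      then show "z \<in> {z. coord z \<le> a}" using True by (auto simp: coord_to_circle)
    qed
    moreover have "compact (to_circle ` {0..a})"
      by (intro compact_continuous_image continuous_on_to_circle) simp
    ultimately show ?thesis by (simp add: compact_imp_closed)
  next
    case False
    then have "coord z \<le> a" for z using coord_bounds(2)[of z] by linarith
    then have "{z. coord z \<le> a} = UNIV" by auto
    then show ?thesis by simp
  qed
  then show "{z \<in> space borel. coord z \<le> a} \<in> sets borel" by simp
qed

lemma sets_unif_circle [simp]: "sets unif_circle = sets borel"
  and space_unif_circle [simp]: "space unif_circle = UNIV"
  by (simp_all add: unif_circle_def)

lemma space_unif_interval [simp]: "space unif_interval = {0..<1}"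
  by (simp add: unif_interval_def space_restrict_space)

lemma emeasure_unif_circle_coord:
  assumes "A \<in> sets borel"
  shows "emeasure unif_circle {z. coord z \<in> A} = emeasure lborel (A \<inter> {0..<1})"
proof -
  have "{z. coord z \<in> A} = coord -` A \<inter> space borel" by auto
  then have m: "{z. coord z \<in> A} \<in> sets borel"
    using measurable_sets[OF measurable_coord assms] by simp
  have "to_circle -` {z. coord z \<in> A} \<inter> {0..<1} = A \<inter> {0..<1}"
    by (auto simp: coord_to_circle)
  then have "emeasure unif_circle {z. coord z \<in> A} = emeasure unif_interval (A \<inter> {0..<1})"
    unfolding unif_circle_def by (subst emeasure_distr[OF measurable_to_circle m]) simp
  also have "\<dots> = emeasure lborel (A \<inter> {0..<1})"
    unfolding unif_interval_def by (subst emeasure_restrict_space) auto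
  finally show ?thesis .
qed

lemma couplings_fst:
  assumes "\<pi> \<in> couplings \<mu> \<nu>" "A \<in> sets \<mu>"
  shows "emeasure \<pi> {z\<in>space \<pi>. fst z \<in> A} = emeasure \<mu> A" "{z\<in>space \<pi>. fst z \<in> A} \<in> sets \<pi>"
proof -
  have s: "sets \<pi> = sets (\<mu> \<Otimes>\<^sub>M \<nu>)" and d: "distr \<pi> \<mu> fst = \<mu>"
    using assms by (auto simp: couplings_def)
  have f: "fst \<in> \<pi> \<rightarrow>\<^sub>M \<mu>" unfolding measurable_cong_sets[OF s refl] by (rule measurable_fst)
  have e: "{z\<in>space \<pi>. fst z \<in> A} = fst -` A \<inter> space \<pi>" by auto
  show "emeasure \<pi> {z\<in>space \<pi>. fst z \<in> A} = emeasure \<mu> A"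
    using emeasure_distr[OF f assms(2)] unfolding d e by simp
  show "{z\<in>space \<pi>. fst z \<in> A} \<in> sets \<pi>"
    unfolding e by (rule measurable_sets[OF f assms(2)])
qed

lemma couplings_snd:
  assumes "\<pi> \<in> couplings \<mu> \<nu>" "A \<in> sets \<nu>"
  shows "emeasure \<pi> {z\<in>space \<pi>. snd z \<in> A} = emeasure \<nu> A" "{z\<in>space \<pi>. snd z \<in> A} \<in> sets \<pi>"
proof -
  have s: "sets \<pi> = sets (\<mu> \<Otimes>\<^sub>M \<nu>)" and d: "distr \<pi> \<nu> snd = \<nu>"
    using assms by (auto simp: couplings_def)
  have f: "snd \<in> \<pi> \<rightarrow>\<^sub>M \<nu>" unfolding measurable_cong_sets[OF s refl] by (rule measurable_snd)
  have e: "{z\<in>space \<pi>. snd z \<in> A} = snd -` A \<inter> space \<pi>" by auto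
  show "emeasure \<pi> {z\<in>space \<pi>. snd z \<in> A} = emeasure \<nu> A"
    using emeasure_distr[OF f assms(2)] unfolding d e by simp
  show "{z\<in>space \<pi>. snd z \<in> A} \<in> sets \<pi>"
    unfolding e by (rule measurable_sets[OF f assms(2)])
qed

lemma emeasure_empirical_card:
  assumes "A \<in> sets M" "N \<ge> 1"
  shows "emeasure (empirical M x N) A = ennreal (card {m\<in>{1..N}. x m \<in> A} / N)"
proof -
  have "(\<Sum>n = 1..N. indicator A (x n)) = (of_nat (card {m\<in>{1..N}. x m \<in> A}) :: ennreal)"
    by (simp add: indicator_def sum.If_cases Int_def)
  then show ?thesis
    using assms by (simp add: emeasure_empirical ennreal_of_nat_eq_real_of_nat divide_ennreal)
qed

text \<open>Either the short path avoids 0 and the distance is the real one, or it crosses 0 and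
  \<open>t\<close> is within \<open>r\<close> of an end of the unit interval.\<close>

lemma arc_dist_cases:
  assumes "s \<in> {0..<1}" "t \<in> {0..<1}" "arc_dist s t \<le> r" "r < 1/2"
  shows "\<bar>s - t\<bar> \<le> r \<or> t \<ge> 1 - r \<or> t \<le> r"
proof -
  obtain k where k: "\<bar>s - t + of_int k\<bar> \<le> r" using arc_dist_attained[of s t] assms(3) by auto
  consider "k \<le> -1" | "k = 0" | "k \<ge> 1" by linarith
  then show ?thesis
  proof cases
    case 1
    then have "real_of_int k \<le> -1" by linarith
    then show ?thesis using k assms by auto
  next
    case 2
    then show ?thesis using k by simp
  next
    case 3
    then have "real_of_int k \<ge> 1" by linarith
    then show ?thesis using k assms by auto
  qed
qed

lemma arc_dist_ge:
  assumes "0 \<le> s" "s \<le> t" "t < 1"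
  shows "arc_dist s t \<ge> t - s \<or> arc_dist s t \<ge> 1 - (t - s)"
proof -
  obtain k where k: "arc_dist s t = \<bar>s - t + of_int k\<bar>" using arc_dist_attained by auto
  consider "k \<le> 0" | "k \<ge> 1" by linarith
  then show ?thesis
  proof cases
    case 1
    then have "real_of_int k \<le> 0" by linarith
    then show ?thesis using k assms by auto
  next
    case 2
    then have "real_of_int k \<ge> 1" by linarith
    then show ?thesis using k assms by auto
  qed
qed

lemma dist_circle_coord: "dist z w = arc_dist (coord z) (coord w)"
  by (metis dist_circle.abs_eq to_circle_coord)

locale circle_coupling =
  fixes x :: "nat \<Rightarrow> circle" and M :: nat and \<pi> :: "(circle \<times> circle) measure"
  assumes M: "M \<ge> 1" and \<pi>: "\<pi> \<in> couplings (empirical unif_circle x M) unif_circle"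
begin

sublocale prob_space \<pi>
  using \<pi> by (simp add: couplings_def)

lemma sets_\<pi>: "sets \<pi> = sets borel"
proof -
  have "sets \<pi> = sets (empirical unif_circle x M \<Otimes>\<^sub>M unif_circle)" using \<pi> by (simp add: couplings_def)
  also have "\<dots> = sets borel" by (rule sets_pair_unif_circle) simp_all
  finally show ?thesis .
qed

lemma space_\<pi>: "space \<pi> = UNIV"
  using sets_eq_imp_space_eq[OF sets_\<pi>] by simp

lemma measurable_\<pi>: "f \<in> borel_measurable borel \<Longrightarrow> f \<in> borel_measurable \<pi>"
  using measurable_cong_sets[OF sets_\<pi> refl] by blast

lemma coord_event:
  assumes "A \<in> sets borel"
  shows "{z. coord z \<in> A} \<in> sets borel"
  using measurable_sets[OF measurable_coord assms] by (simp add: vimage_def)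

lemma prob_fst:
  assumes "A \<in> sets borel"
  shows "prob {z. coord (fst z) \<in> A} = card {m\<in>{1..M}. coord (x m) \<in> A} / M"
    and "{z. coord (fst z) \<in> A} \<in> events"
  using couplings_fst[OF \<pi>, of "{z. coord z \<in> A}"] coord_event[OF assms] M
  by (simp_all add: space_\<pi> emeasure_empirical_card measure_def)

lemma prob_snd:
  assumes "A \<in> sets borel"
  shows "prob {z. coord (snd z) \<in> A} = measure lborel (A \<inter> {0..<1})"
    and "{z. coord (snd z) \<in> A} \<in> events"
  using couplings_snd[OF \<pi>, of "{z. coord z \<in> A}"] coord_event[OF assms]
  by (simp_all add: space_\<pi> emeasure_unif_circle_coord[OF assms] measure_def)

text \<open>Mass starting in \<open>[a,b)\<close> ends in the \<open>r\<close>-neighbourhood of the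
  arc or, having wrapped around, in a piece of length \<open>r\<close> at either end of
  \<open>[0,1)\<close>. Ignoring overlaps, these lengths are
  \<open>(b - a + 2 * r) + r + r\<close>.\<close>

lemma card_arc_le:
  assumes close: "AE z in \<pi>. dist (fst z) (snd z) \<le> r" and r: "0 \<le> r" "r < 1/2"
    and ab: "0 \<le> a" "a \<le> b" "b \<le> 1"
  shows "card {m\<in>{1..M}. coord (x m) \<in> {a..<b}} / M \<le> b - a + 4 * r"
proof -
  define B where "B = {a-r..b+r} \<union> {1-r..1} \<union> {0..r}"
  have B: "B \<in> sets borel" by (simp add: B_def)
  have "prob {z. coord (fst z) \<in> {a..<b}} \<le> prob {z. coord (snd z) \<in> B}"
  proof (rule finite_measure_mono_AE)
    show "AE z in \<pi>. z \<in> {z. coord (fst z) \<in> {a..<b}} \<longrightarrow> z \<in> {z. coord (snd z) \<in> B}"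
      using close
    proof eventually_elim
      case (elim z)
      then have d: "arc_dist (coord (fst z)) (coord (snd z)) \<le> r" by (simp add: dist_circle_coord)
      have "coord (fst z) \<in> {0..<1}" "coord (snd z) \<in> {0..<1}" using coord_bounds by auto
      from arc_dist_cases[OF this d r(2)] show ?case
        using coord_bounds(1)[of "snd z"] coord_bounds(2)[of "snd z"] by (auto simp: B_def abs_le_iff)
    qed
  qed (rule prob_snd(2)[OF B])
  also have "\<dots> = measure lborel (B \<inter> {0..<1})" by (rule prob_snd(1)[OF B])
  also have "\<dots> \<le> measure lborel B"
  proof (rule measure_mono_fmeasurable)
    show "B \<in> fmeasurable lborel"
      unfolding B_def by (intro fmeasurable_compact compact_Un) auto
  qed (auto simp: B_def)
  also have "\<dots> \<le> measure lborel ({a-r..b+r} \<union> {1-r..1}) + measure lborel {0..r}"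
    unfolding B_def by (rule measure_Un_le) auto
  also have "measure lborel ({a-r..b+r} \<union> {1-r..1}) \<le> measure lborel {a-r..b+r} + measure lborel {1-r..1}"
    by (rule measure_Un_le) auto
  finally show ?thesis using r ab prob_fst(1)[of "{a..<b}"] by simp
qed

lemma count_close:
  assumes close: "AE z in \<pi>. dist (fst z) (snd z) \<le> r" and s: "0 \<le> s" "s \<le> 1"
  shows "\<bar>card {m\<in>{1..M}. coord (x m) < s} / M - s\<bar> \<le> 4 * r"
proof -
  define S where "S = {m\<in>{1..M}. coord (x m) < s}"
  have S: "finite S" "S \<subseteq> {1..M}" by (auto simp: S_def)
  have le: "card S \<le> M" using card_mono[OF _ S(2)] by simp
  have split: "card {m\<in>{1..M}. coord (x m) \<in> {s..<1}} = M - card S"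
  proof -
    have "{m\<in>{1..M}. coord (x m) \<in> {s..<1}} = {1..M} - S"
      using coord_bounds by (auto simp: S_def)
    then show ?thesis using card_Diff_subset[OF S] by simp
  qed
  have e: "S = {m\<in>{1..M}. coord (x m) \<in> {0..<s}}"
    using coord_bounds by (auto simp: S_def)
  have "0 \<le> r"
  proof (rule ccontr)
    assume "\<not> 0 \<le> r"
    from close have "AE z in \<pi>. False"
    proof eventually_elim
      case (elim z)
      then show False using zero_le_dist[of "fst z" "snd z"] \<open>\<not> 0 \<le> r\<close> by linarith
    qed
    then show False by simp
  qed
  \<comment> \<open>The arc \<open>[0,s)\<close> bounds the count from above and its complement
    \<open>[s,1)\<close> from below. For \<open>r \<ge> 1/2\<close> the claim is trivial, both
    numbers lying in \<open>[0,1]\<close>.\<close>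
  have "\<bar>card S / M - s\<bar> \<le> 4 * r"
  proof (cases "r < 1/2")
    case True
    have "card S / M \<le> s + 4 * r"
      using card_arc_le[OF close \<open>0 \<le> r\<close> True, of 0 s] s unfolding e by simp
    moreover have "1 - card S / M \<le> 1 - s + 4 * r"
      using card_arc_le[OF close \<open>0 \<le> r\<close> True, of s 1] s M le unfolding split
      by (simp add: of_nat_diff diff_divide_distrib)
    ultimately show ?thesis by (simp add: abs_le_iff)
  next
    case False
    have "card S / M \<le> 1" "0 \<le> card S / M"
      using le M by (simp_all add: divide_le_eq_1)
    then show ?thesis using False s unfolding abs_le_iff by linarith
  qed
  then show ?thesis unfolding S_def .
qed

end

section \<open>Step functions as dual test functions\<close>

lemma card_grid_between:
  fixes s t :: real and n :: nat
  assumes "0 \<le> s" "s \<le> t" "t < 1"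
  shows "real (card {q\<in>{..<n}. s * n < q \<and> q \<le> t * n}) = of_int \<lfloor>t * n\<rfloor> - of_int \<lfloor>s * n\<rfloor>"
proof (cases "n = 0")
  case False
  have tn: "t * n < n" "0 \<le> s * n" "s * n \<le> t * n" using assms False by (auto intro: mult_right_mono)
  have "{q\<in>{..<n}. s * n < q \<and> q \<le> t * n} = {nat \<lfloor>s * n\<rfloor><..nat \<lfloor>t * n\<rfloor>}"
  proof (intro set_eqI iffI)
    fix q assume "q \<in> {q\<in>{..<n}. s * n < q \<and> q \<le> t * n}"
    then show "q \<in> {nat \<lfloor>s * n\<rfloor><..nat \<lfloor>t * n\<rfloor>}"
      using tn by (auto simp: le_nat_floor) linarith
  next
    fix q assume q: "q \<in> {nat \<lfloor>s * n\<rfloor><..nat \<lfloor>t * n\<rfloor>}"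
    have "0 \<le> \<lfloor>s * n\<rfloor>" "0 \<le> \<lfloor>t * n\<rfloor>" using tn by auto
    then have "\<lfloor>s * n\<rfloor> < int q" "int q \<le> \<lfloor>t * n\<rfloor>" using q by auto
    then have "s * n < q" "q \<le> t * n" by (simp_all add: floor_less_iff le_floor_iff)
    then show "q \<in> {q\<in>{..<n}. s * n < q \<and> q \<le> t * n}" using tn by auto
  qed
  moreover have "0 \<le> \<lfloor>s * n\<rfloor>" "\<lfloor>s * n\<rfloor> \<le> \<lfloor>t * n\<rfloor>" using tn by (auto intro: floor_mono)
  moreover from this have "0 \<le> \<lfloor>t * n\<rfloor>" by linarith
  ultimately show ?thesis by (simp add: of_nat_diff nat_mono)
qed simp

text \<open>Integrated against a probability measure this is the sum of \<open>F q\<close> times the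
  mass to the left of \<open>q / n\<close>, so a single test function encodes the pairing of
  \<open>F\<close> with a distribution function.\<close>

definition ramp :: "nat \<Rightarrow> (nat \<Rightarrow> real) \<Rightarrow> real \<Rightarrow> real" where
  "ramp n F t = (\<Sum>q<n. F q * of_bool (t < q / n))"

text \<open>A step function with small jumps is Lipschitz on the circle up to one jump; the vanishing sum
  of the jumps makes it periodic.\<close>

lemma ramp_lipschitz:
  assumes F: "\<And>q. \<bar>F q\<bar> \<le> 2" and F0: "(\<Sum>q<n. F q) = 0" and n: "n > 0"
    and st: "s \<in> {0..<1}" "t \<in> {0..<1}"
  shows "\<bar>ramp n F s - ramp n F t\<bar> \<le> 2 * n * arc_dist s t + 2"
proof -
  have ord: "\<bar>ramp n F s - ramp n F t\<bar> \<le> 2 * n * arc_dist s t + 2"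
    if "0 \<le> s" "s \<le> t" "t < 1" for s t
  proof -
    define I where "I = {q\<in>{..<n}. s * n < q \<and> q \<le> t * n}"
    have fI: "finite I" "I \<subseteq> {..<n}" by (auto simp: I_def)
    have "ramp n F s - ramp n F t = (\<Sum>q<n. if q \<in> I then F q else 0)"
      unfolding ramp_def sum_subtractf[symmetric]
    proof (intro sum.cong refl)
      fix q assume "q \<in> {..<n}"
      have "s < q / n \<longleftrightarrow> s * n < q" "t < q / n \<longleftrightarrow> \<not> q \<le> t * n"
        using n by (auto simp: field_simps)
      moreover have "s * n \<le> t * n" using that by (intro mult_right_mono) auto
      ultimately show "F q * of_bool (s < q / n) - F q * of_bool (t < q / n) = (if q \<in> I then F q else 0)"
        using \<open>q \<in> {..<n}\<close> by (auto simp: I_def)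
    qed
    also have "\<dots> = sum F I" using fI by (simp add: sum.If_cases Int_absorb1)
    finally have d: "ramp n F s - ramp n F t = sum F I" .
    have sumle: "\<bar>sum F J\<bar> \<le> 2 * card J" for J
    proof -
      have "\<bar>sum F J\<bar> \<le> (\<Sum>q\<in>J. 2)" by (intro order_trans[OF sum_abs] sum_mono F)
      then show ?thesis by simp
    qed
    have cI: "real (card I) = of_int \<lfloor>t * n\<rfloor> - of_int \<lfloor>s * n\<rfloor>"
      unfolding I_def by (rule card_grid_between) fact+
    \<comment> \<open>As \<open>F\<close> sums to zero, the jumps between \<open>s\<close> and
      \<open>t\<close> can be traded for those on the complementary arc. The bounds
      \<open>b1\<close> and \<open>b2\<close> belong to the two ways round the circle.\<close>
    have "sum F ({..<n} - I) = - sum F I"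
      using F0 fI by (simp add: sum_diff)
    then have "\<bar>sum F I\<bar> = \<bar>sum F ({..<n} - I)\<bar>" by simp
    also have "\<dots> \<le> 2 * card ({..<n} - I)" by (rule sumle)
    finally have "\<bar>sum F I\<bar> \<le> 2 * real (card ({..<n} - I))" by simp
    moreover have "card ({..<n} - I) = n - card I" "card I \<le> n"
      using card_Diff_subset[OF fI] card_mono[OF _ fI(2)] by simp_all
    ultimately have b2: "\<bar>sum F I\<bar> \<le> 2 * (n - real (card I))"
      by (simp add: of_nat_diff)
    have b1: "\<bar>sum F I\<bar> \<le> 2 * real (card I)" using sumle[of I] by simp
    define y where "y = (t - s) * n"
    \<comment> \<open>A half-open interval of length \<open>y\<close> contains between
      \<open>y - 1\<close> and \<open>y + 1\<close> integers; this is the source of the additive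
      2.\<close>
    have "real (card I) \<le> y + 1" "real (card I) \<ge> y - 1"
      unfolding y_def cI left_diff_distrib by linarith+
    then have c1: "\<bar>sum F I\<bar> \<le> 2 * y + 2" and "n - real (card I) \<le> n - y + 1"
      using b1 by linarith+
    with b2 have c2: "\<bar>sum F I\<bar> \<le> 2 * (n - y) + 2" by simp
    have e: "2 * n * arc_dist s t = 2 * (arc_dist s t * n)" by simp
    from arc_dist_ge[OF that] show ?thesis
    proof
      assume "t - s \<le> arc_dist s t"
      then have "y \<le> arc_dist s t * n" unfolding y_def by (rule mult_right_mono) simp
      with c1 show ?thesis unfolding d e by linarith
    next
      assume "1 - (t - s) \<le> arc_dist s t"
      then have "(1 - (t - s)) * n \<le> arc_dist s t * n" by (rule mult_right_mono) simp
      then have "n - y \<le> arc_dist s t * n" by (simp add: y_def left_diff_distrib)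
      then have "2 * (n - y) + 2 \<le> 2 * (arc_dist s t * n) + 2" by simp
      with c2 show ?thesis unfolding d e by (rule order_trans)
    qed
  qed
  have sym: "arc_dist s t = arc_dist t s"
    by (metis dist_circle.abs_eq dist_commute)
  show ?thesis
  proof (cases "s \<le> t")
    case True
    then show ?thesis using ord st by auto
  next
    case False
    then have "\<bar>ramp n F t - ramp n F s\<bar> \<le> 2 * n * arc_dist t s + 2" using ord st by auto
    then show ?thesis unfolding sym by linarith
  qed
qed

lemma circle_dist_bounds: "0 \<le> dist (z::circle) w" "dist (z::circle) w \<le> 1"
proof -
  have "dist z w \<le> \<bar>coord z - coord w\<bar>"
    unfolding dist_circle_coord using arc_dist_le[of "coord z" "coord w" 0] by simp
  also have "\<dots> \<le> 1" using coord_bounds[of z] coord_bounds[of w] by auto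
  finally show "dist z w \<le> 1" .
qed simp

context circle_coupling begin

lemma measurable_dist: "(\<lambda>z. dist (fst z) (snd z)) \<in> borel_measurable \<pi>"
  by (intro measurable_\<pi> borel_measurable_continuous_onI continuous_intros)

lemma integrable_dist_powr:
  assumes "a \<ge> 0"
  shows "integrable \<pi> (\<lambda>z. dist (fst z) (snd z) powr a)"
proof (rule integrable_const_bound[of _ 1])
  show "AE z in \<pi>. norm (dist (fst z) (snd z) powr a) \<le> 1"
    using circle_dist_bounds powr_mono2[OF assms, of _ 1] by (intro AE_I2) simp
qed (use measurable_dist in simp)

lemma integrable_dist: "integrable \<pi> (\<lambda>z. dist (fst z) (snd z))"
  by (rule integrable_const_bound[of _ 1]) (use circle_dist_bounds measurable_dist in auto)

text \<open>The easy half of Kantorovich duality: the marginals turn the sum into the integral of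
  the difference of \<open>ramp\<close> at the two ends of the transport, and the Lipschitz bound
  applies under the integral.\<close>

lemma test_sum_le:
  fixes F :: "nat \<Rightarrow> real" and n :: nat
  assumes F: "\<And>q. \<bar>F q\<bar> \<le> 2" and F0: "(\<Sum>q<n. F q) = 0" and n: "n > 0"
  shows "(\<Sum>q<n. F q * (q / n - card {m\<in>{1..M}. coord (x m) < q / n} / M))
    \<le> 2 * n * (\<integral>z. dist (fst z) (snd z) \<partial>\<pi>) + 2"
proof -
  let ?B1 = "\<lambda>q::nat. {z. coord (fst z) \<in> {..<q / n}}" and ?B2 = "\<lambda>q::nat. {z. coord (snd z) \<in> {..<q / n}}"
  have ev: "?B1 q \<in> events" "?B2 q \<in> events" for q :: nat
    by (rule prob_fst(2) prob_snd(2), simp)+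
  have p2: "prob (?B2 q) = q / n" if "q < n" for q
  proof -
    have "q / n \<le> 1" using that n by simp
    then have e: "{..<q / n} \<inter> {0..<1} = {0..<q / n}" by auto
    have "prob (?B2 q) = measure lborel ({..<q / n} \<inter> {0..<1})" by (rule prob_snd(1)) simp
    then show ?thesis unfolding e by simp
  qed
  have r1: "ramp n F (coord (fst z)) = (\<Sum>q<n. F q * indicator (?B1 q) z)" for z
    unfolding ramp_def by (intro sum.cong refl) (simp add: indicator_def)
  have r2: "ramp n F (coord (snd z)) = (\<Sum>q<n. F q * indicator (?B2 q) z)" for z
    unfolding ramp_def by (intro sum.cong refl) (simp add: indicator_def)
  have i1: "integrable \<pi> (\<lambda>z. F q * indicator (?B1 q) z)" for q
    using ev by (intro integrable_mult_right integrable_real_indicator) (auto simp: emeasure_eq_measure)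
  have i2: "integrable \<pi> (\<lambda>z. F q * indicator (?B2 q) z)" for q
    using ev by (intro integrable_mult_right integrable_real_indicator) (auto simp: emeasure_eq_measure)
  have "(\<Sum>q<n. F q * (q / n - card {m\<in>{1..M}. coord (x m) < q / n} / M))
     = (\<Sum>q<n. F q * prob (?B2 q)) - (\<Sum>q<n. F q * prob (?B1 q))"
    unfolding sum_subtractf[symmetric]
  proof (intro sum.cong refl)
    fix q assume "q \<in> {..<n}"
    then have "prob (?B2 q) = q / n" by (intro p2) simp
    moreover have "prob (?B1 q) = card {m\<in>{1..M}. coord (x m) < q / n} / M"
      using prob_fst(1)[of "{..<q / n}"] by simp
    ultimately show "F q * (q / n - card {m\<in>{1..M}. coord (x m) < q / n} / M)
        = F q * prob (?B2 q) - F q * prob (?B1 q)"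
      by (simp only: right_diff_distrib)
  qed
  also have "(\<Sum>q<n. F q * prob (?B2 q)) = (\<integral>z. ramp n F (coord (snd z)) \<partial>\<pi>)"
    unfolding r2 using i2 ev by (subst Bochner_Integration.integral_sum) auto
  also have "(\<Sum>q<n. F q * prob (?B1 q)) = (\<integral>z. ramp n F (coord (fst z)) \<partial>\<pi>)"
    unfolding r1 using i1 ev by (subst Bochner_Integration.integral_sum) auto
  also have "(\<integral>z. ramp n F (coord (snd z)) \<partial>\<pi>) - (\<integral>z. ramp n F (coord (fst z)) \<partial>\<pi>)
     = (\<integral>z. ramp n F (coord (snd z)) - ramp n F (coord (fst z)) \<partial>\<pi>)"
    by (rule Bochner_Integration.integral_diff[symmetric];
        unfold r1 r2; intro Bochner_Integration.integrable_sum i1 i2)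
  also have "\<dots> \<le> (\<integral>z. 2 * n * dist (fst z) (snd z) + 2 \<partial>\<pi>)"
  proof (rule integral_mono)
    show "integrable \<pi> (\<lambda>z. ramp n F (coord (snd z)) - ramp n F (coord (fst z)))"
      unfolding r1 r2 by (intro Bochner_Integration.integrable_diff Bochner_Integration.integrable_sum i1 i2)
    show "integrable \<pi> (\<lambda>z. 2 * n * dist (fst z) (snd z) + 2)"
      using integrable_dist by simp
    fix z
    have "\<bar>ramp n F (coord (fst z)) - ramp n F (coord (snd z))\<bar> \<le> 2 * n * dist (fst z) (snd z) + 2"
      using ramp_lipschitz[OF F F0 n, of "coord (fst z)" "coord (snd z)"] coord_bounds
      by (simp add: dist_circle_coord)
    then show "ramp n F (coord (snd z)) - ramp n F (coord (fst z)) \<le> 2 * n * dist (fst z) (snd z) + 2"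
      by linarith
  qed
  also have "\<dots> = 2 * n * (\<integral>z. dist (fst z) (snd z) \<partial>\<pi>) + 2"
    using integrable_dist by (simp add: prob_space)
  finally show ?thesis .
qed

text \<open>Integrating \<open>d \<le> a + a powr (1 - P) * d powr P\<close> loses a factor 2 against Hoelder's
  inequality, which is harmless here.\<close>

lemma integral_dist_le_Lp_norm:
  assumes p: "1 \<le> p" "p \<noteq> \<infinity>" and a: "a > 0" and lt: "Lp_norm p \<pi> (\<lambda>(z, w). dist z w) < ennreal a"
  shows "(\<integral>z. dist (fst z) (snd z) \<partial>\<pi>) \<le> 2 * a"
proof -
  define P where "P = enn2real p"
  have P: "P \<ge> 1" using p enn2real_mono[of 1 p] by (simp add: P_def top.not_eq_extremum)
  define J where "J = (\<integral>z. dist (fst z) (snd z) powr P \<partial>\<pi>)"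
  have iP: "integrable \<pi> (\<lambda>z. dist (fst z) (snd z) powr P)" using P by (intro integrable_dist_powr) simp
  have J0: "J \<ge> 0" unfolding J_def by simp
  have "(\<integral>\<^sup>+ z. ennreal (\<bar>(\<lambda>(z, w). dist z w) z\<bar> powr P) \<partial>\<pi>) = ennreal J"
    unfolding J_def using nn_integral_eq_integral[OF iP] by (simp add: case_prod_beta)
  then have "Lp_norm p \<pi> (\<lambda>(z, w). dist z w) = ennreal (J powr (1 / P))"
    using p J0 unfolding Lp_norm_def Let_def P_def[symmetric] by simp
  with lt have "J powr (1 / P) < a" by (simp add: ennreal_less_iff)
  then have "(J powr (1 / P)) powr P \<le> a powr P" using P by (intro powr_mono2) auto
  then have JP: "J \<le> a powr P" using P J0 by (simp add: powr_powr)
  \<comment> \<open>Above \<open>a\<close> the factor \<open>(d / a) powr (P - 1)\<close> is at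
    least 1.\<close>
  have pt: "d \<le> a + a powr (1 - P) * d powr P" if "d \<ge> 0" for d
  proof (cases "d \<le> a")
    case True
    have "0 \<le> a powr (1 - P) * d powr P" by simp
    with True show ?thesis by linarith
  next
    case False
    then have "a powr (1 - P) * d powr P = a powr (1 - P) * d powr (P - 1) * d"
      using a by (simp add: powr_diff)
    moreover have "a powr (1 - P) * d powr (P - 1) \<ge> a powr (1 - P) * a powr (P - 1)"
      using False a P by (intro mult_left_mono powr_mono2) auto
    moreover have "a powr (1 - P) * a powr (P - 1) = 1" using a by (simp flip: powr_add)
    ultimately have "a powr (1 - P) * d powr P \<ge> 1 * d"
      using that by (simp only:) (rule mult_right_mono, auto)
    then show ?thesis using a by linarith
  qed
  have "(\<integral>z. dist (fst z) (snd z) \<partial>\<pi>) \<le> (\<integral>z. a + a powr (1 - P) * dist (fst z) (snd z) powr P \<partial>\<pi>)"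
    using integrable_dist iP pt by (intro integral_mono) auto
  also have "\<dots> = a + a powr (1 - P) * J"
    using iP by (simp add: J_def prob_space)
  also have "a powr (1 - P) * J \<le> a powr (1 - P) * a powr P"
    using JP by (intro mult_left_mono) auto
  also have "\<dots> = a" using a by (simp flip: powr_add)
  finally show ?thesis by simp
qed

lemma AE_dist_le_esssup:
  assumes a: "a > 0" and lt: "Lp_norm \<infinity> \<pi> (\<lambda>(z, w). dist z w) < ennreal a"
  shows "AE z in \<pi>. dist (fst z) (snd z) \<le> a"
proof -
  have "AE z in \<pi>. ennreal \<bar>(\<lambda>(z, w). dist z w) z\<bar> \<le> esssup \<pi> (\<lambda>z. ennreal \<bar>(\<lambda>(z, w). dist z w) z\<bar>)"
    by (rule esssup_AE)
  then show ?thesis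
  proof eventually_elim
    case (elim z)
    then have "ennreal \<bar>(\<lambda>(z, w). dist z w) z\<bar> < ennreal a"
      using lt unfolding Lp_norm_def by simp
    then show ?case by (simp add: case_prod_beta ennreal_less_iff)
  qed
qed

end

subsection \<open>Lower bounds on the circle\<close>

lemma ln_le_of_less_power2:
  assumes "M \<ge> 1" "M < 2^L"
  shows "ln (real M) \<le> L"
proof -
  have "real M \<le> real (2^L)" using assms by (intro of_nat_mono) simp
  then have "ln (real M) \<le> ln (real (2^L))" using assms by (intro ln_mono) auto
  also have "\<dots> = L * ln 2" by (simp add: ln_realpow)
  also have "\<dots> \<le> real L * 1" using ln_2_less_1 by (intro mult_left_mono) auto
  finally show ?thesis by simp
qed

text \<open>As \<open>q\<close> is an integer, rounding down to the grid does not change which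
  points lie below it, so the grid discrepancy is the true one at grid points.\<close>

lemma count_floor_coord:
  assumes "n > 0"
  shows "{m\<in>{1..M}. nat \<lfloor>coord (x m) * real n\<rfloor> < q} = {m\<in>{1..M}. coord (x m) < q / n}"
proof -
  have "nat \<lfloor>coord z * real n\<rfloor> < q \<longleftrightarrow> coord z < q / n" for z
  proof -
    have "nat \<lfloor>coord z * real n\<rfloor> < q \<longleftrightarrow> coord z * real n < q"
      using coord_bounds(1)[of z] by (simp add: nat_less_iff floor_less_iff)
    also have "\<dots> \<longleftrightarrow> coord z < q / n" using assms by (simp add: pos_less_divide_eq)
    finally show ?thesis .
  qed
  then show ?thesis by simp
qed

lemma disc_coord:
  assumes "M \<ge> 1"
  shows "row_discrepancy.disc L (\<lambda>m. nat \<lfloor>coord (x m) * real (2^(L+2))\<rfloor>) M q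
     = M * (q / real (2^(L+2)) - card {m\<in>{1..M}. coord (x m) < q / real (2^(L+2))} / M)"
  unfolding row_discrepancy.disc_def using assms
  by (subst count_floor_coord) (simp_all add: right_diff_distrib)

lemma circle_lower_bound_infinity:
  "\<exists>\<^sub>\<infinity>N. ennreal (1/10000 * ln (real N) / real N) \<le> wasserstein \<infinity> (empirical unif_circle x N) unif_circle"
  unfolding INFM_nat
proof
  fix m :: nat
  \<comment> \<open>Now \<open>L / 2048 = m + 1\<close>; since a discrepancy is at most
    \<open>M\<close> in size, the row \<open>M\<close> that is found lies beyond
    \<open>m\<close>.\<close>
  define L where "L = 2048 * (m + 1)"
  interpret row_discrepancy L "\<lambda>m. nat \<lfloor>coord (x m) * real (2^(L+2))\<rfloor>" .
  have L: "L \<ge> 1" by (simp add: L_def)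
  obtain M q where M: "M < 2^L" and q: "q < 2^(L+2)" and big: "\<bar>disc M q\<bar> \<ge> L / 2048"
    using exists_large_disc[OF L] by blast
  have "real L / 2048 = m + 1" by (simp add: L_def)
  then have "m < M" using big abs_disc_le[of q M] q by simp
  then have M1: "M \<ge> 1" by simp
  have lnM: "ln (real M) \<le> L" by (rule ln_le_of_less_power2[OF M1 M])
  have "ennreal (1/10000 * ln (real M) / real M) \<le> wasserstein \<infinity> (empirical unif_circle x M) unif_circle"
    unfolding wasserstein_def
  proof (rule INF_greatest, rule ccontr)
    fix \<pi> assume \<pi>: "\<pi> \<in> couplings (empirical unif_circle x M) unif_circle"
    assume "\<not> ennreal (1/10000 * ln (real M) / real M) \<le> Lp_norm \<infinity> \<pi> (\<lambda>(x, y). dist x y)"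
    then have lt: "Lp_norm \<infinity> \<pi> (\<lambda>(x, y). dist x y) < ennreal (1/10000 * ln (real M) / real M)" by simp
    then have pos: "1/10000 * ln (real M) / real M > 0" by (metis ennreal_neg not_le not_less_zero)
    interpret circle_coupling x M \<pi> by unfold_locales (fact M1, fact \<pi>)
    have "real q \<le> real (2^(L+2))" using q by (intro of_nat_mono) simp
    then have "q / real (2^(L+2)) \<le> 1" by (subst divide_le_eq_1_pos) simp_all
    then have "\<bar>card {m\<in>{1..M}. coord (x m) < q / real (2^(L+2))} / M - q / real (2^(L+2))\<bar>
        \<le> 4 * (1/10000 * ln (real M) / real M)"
      using AE_dist_le_esssup[OF pos lt] by (intro count_close) auto
    then have "M * \<bar>q / real (2^(L+2)) - card {m\<in>{1..M}. coord (x m) < q / real (2^(L+2))} / M\<bar>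
        \<le> M * (4 * (1/10000 * ln (real M) / real M))"
      by (subst abs_minus_commute) (intro mult_left_mono, simp_all)
    moreover have "\<bar>disc M q\<bar> = M * \<bar>q / real (2^(L+2)) - card {m\<in>{1..M}. coord (x m) < q / real (2^(L+2))} / M\<bar>"
      unfolding disc_coord[OF M1] by (simp add: abs_mult)
    \<comment> \<open>The right side is \<open>ln M / 2500\<close> with \<open>ln M \<le> L\<close>,
      which is too small.\<close>
    ultimately have "L / 2048 \<le> M * (4 * (1/10000 * ln (real M) / real M))" using big by linarith
    also have "\<dots> = ln (real M) / 2500" using M1 by simp
    finally show False using lnM L by linarith
  qed
  with \<open>m < M\<close> show "\<exists>n>m. ennreal (1/10000 * ln (real n) / real n)
      \<le> wasserstein \<infinity> (empirical unif_circle x n) unif_circle" by blast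
qed

lemma circle_lower_bound_finite:
  assumes p: "1 \<le> p" "p \<noteq> \<infinity>"
  shows "\<exists>\<^sub>\<infinity>N. ennreal (1/10000 * sqrt (ln (real N)) / real N) \<le> wasserstein p (empirical unif_circle x N) unif_circle"
  unfolding INFM_nat
proof
  fix m :: nat
  \<comment> \<open>A perfect square with \<open>sqrt L = 4096 * (m + 1)\<close>. It forces
    \<open>M \<ge> sqrt L / 1536 > m\<close> and is large enough to absorb the rounding term 2 at
    the end.\<close>
  define L where "L = (4096 * (m + 1))\<^sup>2"
  define K where "K = (2::nat)^(L+2)"
  interpret row_discrepancy L "\<lambda>m. nat \<lfloor>coord (x m) * real (2^(L+2))\<rfloor>" .
  have L: "L \<ge> 1" by (simp add: L_def)
  have sL: "sqrt L = 4096 * (real m + 1)" by (simp add: L_def)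
  obtain M F where M: "M < 2^L" and F: "\<And>q. \<bar>F q\<bar> \<le> 2" and F0: "(\<Sum>q<K. F q) = 0"
    and big: "sqrt L * 2^L / 192 \<le> (\<Sum>q<K. F q * disc M q)"
    using exists_large_test_sum[OF L] unfolding K_def by blast
  have "\<bar>\<Sum>q<K. F q * disc M q\<bar> \<le> (\<Sum>q<K. 2 * real M)"
    using F abs_disc_le unfolding K_def
    by (intro order_trans[OF sum_abs] sum_mono) (auto simp: abs_mult intro!: mult_mono)
  also have "\<dots> = 8 * 2^L * real M" by (simp add: K_def)
  finally have "sqrt L * 2^L / 192 \<le> 8 * 2^L * real M" using big by linarith
  then have "sqrt L \<le> 1536 * real M" by (simp add: field_simps)
  then have "real (4096 * (m + 1)) \<le> real (1536 * M)" unfolding sL by simp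
  then have "4096 * (m + 1) \<le> 1536 * M" by (simp only: of_nat_le_iff)
  then have "m < M" by simp
  then have M1: "M \<ge> 1" by simp
  have lnM: "sqrt (ln (real M)) \<le> sqrt L" using ln_le_of_less_power2[OF M1 M] by simp
  have "real M \<le> real (2^L)" using M by (intro of_nat_mono) simp
  then have "real M \<le> 2^L" by simp
  define e where "e = 1/10000 * sqrt (ln (real M)) / real M"
  have "ennreal e \<le> wasserstein p (empirical unif_circle x M) unif_circle"
    unfolding wasserstein_def
  proof (rule INF_greatest, rule ccontr)
    fix \<pi> assume \<pi>: "\<pi> \<in> couplings (empirical unif_circle x M) unif_circle"
    assume "\<not> ennreal e \<le> Lp_norm p \<pi> (\<lambda>(x, y). dist x y)"
    then have lt: "Lp_norm p \<pi> (\<lambda>(x, y). dist x y) < ennreal e" by simp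
    then have pos: "e > 0" by (metis ennreal_neg not_le not_less_zero)
    interpret circle_coupling x M \<pi> by unfold_locales (fact M1, fact \<pi>)
    define S where "S = (\<Sum>q<K. F q * (q / K - card {m\<in>{1..M}. coord (x m) < q / K} / M))"
    have "S \<le> 2 * K * (\<integral>z. dist (fst z) (snd z) \<partial>\<pi>) + 2"
      unfolding S_def using F F0 by (intro test_sum_le) (simp_all add: K_def)
    also have "\<dots> \<le> 2 * K * (2 * e) + 2"
      using integral_dist_le_Lp_norm[OF p pos lt] by (intro add_mono mult_left_mono) auto
    finally have "M * S \<le> M * (2 * K * (2 * e) + 2)" by (intro mult_left_mono) auto
    moreover have "(\<Sum>q<K. F q * disc M q) = M * S"
      unfolding S_def sum_distrib_left disc_coord[OF M1] K_def by (intro sum.cong refl) (simp only: mult_ac)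
    ultimately have "sqrt L * 2^L / 192 \<le> M * (2 * K * (2 * e) + 2)" using big by linarith
    also have "\<dots> = 16 * 2^L * (M * e) + 2 * M" by (simp add: K_def algebra_simps)
    also have "M * e = sqrt (ln (real M)) / 10000" using M1 by (simp add: e_def)
    also have "16 * 2^L * (sqrt (ln (real M)) / 10000) + 2 * M \<le> 16 * 2^L * (sqrt L / 10000) + 2 * 2^L"
      using lnM \<open>real M \<le> 2^L\<close> by (intro add_mono mult_left_mono divide_right_mono) auto
    finally have "2^L * (sqrt L / 192) \<le> 2^L * (16 * (sqrt L / 10000) + 2)" by (simp add: algebra_simps)
    \<comment> \<open>Since \<open>1/192 - 16/10000 > 1/300\<close>, this would give
      \<open>sqrt L < 600\<close>.\<close>
    then have "sqrt L / 192 \<le> 16 * (sqrt L / 10000) + 2" by simp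
    then show False unfolding sL by simp
  qed
  with \<open>m < M\<close> show "\<exists>n>m. ennreal (1/10000 * sqrt (ln (real n)) / real n)
      \<le> wasserstein p (empirical unif_circle x n) unif_circle" unfolding e_def by blast
qed

lemma circle_lower_bound:
  assumes "1 \<le> p"
  shows "\<exists>\<^sub>\<infinity>N. ennreal (1/10000 * ln (real N) powr log_exponent p / real N)
     \<le> wasserstein p (empirical unif_circle x N) unif_circle"
proof -
  have ln0: "ln (real N) \<ge> 0" for N by (cases "N = 0") auto
  show ?thesis
  proof (cases "p = \<infinity>")
    case True
    then show ?thesis using circle_lower_bound_infinity[of x] ln0 by (simp add: log_exponent_def)
  next
    case False
    then show ?thesis using circle_lower_bound_finite[OF assms False, of x] ln0
      by (simp add: log_exponent_def powr_half_sqrt)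
  qed
qed

subsection \<open>A rotor sequence\<close>

text \<open>Points visiting a node of the dyadic tree go to its two halves in turn, the first one to the left
  iff the node is a right child (\<open>b = True\<close>). The first visitor of a node thus has alternating binary
  digits, whence the values \<open>1/3\<close> and \<open>2/3\<close>.\<close>

fun rotor_point :: "nat \<Rightarrow> bool \<Rightarrow> real" where
  "rotor_point i b = (if i = 0 then (if b then 1/3 else 2/3)
     else (of_bool (even i \<noteq> b) + rotor_point (i div 2) (even i \<noteq> b)) / 2)"

declare rotor_point.simps [simp del]

text \<open>At \<open>i = 0\<close> this reads \<open>1/3 = (0 + 2/3) / 2\<close> and
  \<open>2/3 = (1 + 1/3) / 2\<close>, so the base values obey the same recursion.\<close>

lemma rotor_point_rec:
  "rotor_point i b = (of_bool (even i \<noteq> b) + rotor_point (i div 2) (even i \<noteq> b)) / 2"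
proof (cases "i = 0")
  case True
  have "rotor_point 0 b = (if b then 1/3 else 2/3)" for b by (simp add: rotor_point.simps)
  with True show ?thesis by simp
next
  case False
  then show ?thesis by (subst rotor_point.simps) simp
qed

lemma rotor_point_bounds: "0 < rotor_point i b \<and> rotor_point i b < 1"
proof (induction i arbitrary: b rule: less_induct)
  case (less i)
  show ?case
  proof (cases "i = 0")
    case True
    then show ?thesis by (simp add: rotor_point.simps)
  next
    case False
    then have "i div 2 < i" by simp
    define d where "d \<longleftrightarrow> even i \<noteq> b"
    have "rotor_point i b = (of_bool d + rotor_point (i div 2) d) / 2"
      unfolding d_def by (rule rotor_point_rec)
    with less[OF \<open>i div 2 < i\<close>, of d] show ?thesis by (cases d) auto
  qed
qed

text \<open>How many of the first \<open>N\<close> visitors of a node of type \<open>b\<close> go to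
  its left half.\<close>

definition lcount :: "nat \<Rightarrow> bool \<Rightarrow> nat" where
  "lcount N b = (if b then (N + 1) div 2 else N div 2)"

definition rcount :: "nat \<Rightarrow> bool \<Rightarrow> nat" where
  "rcount N b = lcount N (\<not> b)"

text \<open>The excess of left over right visitors.\<close>

definition balance :: "nat \<Rightarrow> bool \<Rightarrow> real" where
  "balance N b = (if even N then 0 else if b then 1 else -1)"

lemma lcount_balance: "real (lcount N b) = (N + balance N b) / 2"
  and rcount_balance: "real (rcount N b) = (N - balance N b) / 2"
  by (auto simp: lcount_def rcount_def balance_def elim!: evenE oddE)

lemma lcount_le: "N \<le> 2 ^ Suc L \<Longrightarrow> lcount N b \<le> 2 ^ L"
  and rcount_le: "N \<le> 2 ^ Suc L \<Longrightarrow> rcount N b \<le> 2 ^ L"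
  by (auto simp: lcount_def rcount_def)

lemma abs_balance_le: "\<bar>balance N b\<bar> \<le> 1"
  by (simp add: balance_def)

section \<open>Discrepancy recursion along the dyadic tree\<close>

definition rotor_disc :: "nat \<Rightarrow> bool \<Rightarrow> real \<Rightarrow> real" where
  "rotor_disc N b t = real (card {i\<in>{..<N}. rotor_point i b < t}) - real N * t"

lemma sum_even_odd:
  fixes f :: "nat \<Rightarrow> real"
  shows "(\<Sum>i<N. f i) = (\<Sum>k<(N + 1) div 2. f (2*k)) + (\<Sum>k<N div 2. f (2*k+1))"
proof (induction N)
  case (Suc N)
  show ?case
  proof (cases "even N")
    case True
    then obtain m where "N = 2 * m" by (elim evenE)
    then show ?thesis using Suc by simp
  next
    case False
    then obtain m where "N = 2 * m + 1" by (elim oddE)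
    then show ?thesis using Suc by simp
  qed
qed simp

text \<open>The visitors sent to one half are every second index. After rescaling they form the
  rotor sequence of that child, with index \<open>i div 2\<close> and the side of the child as its
  type.\<close>

lemma rotor_count_rec:
  "real (card {i\<in>{..<N}. rotor_point i b < t}) =
     real (card {i\<in>{..<lcount N b}. rotor_point i False < 2 * t})
   + real (card {i\<in>{..<rcount N b}. rotor_point i True < 2 * t - 1})"
proof -
  define c where "c = (\<lambda>N b t. \<Sum>i<N. of_bool (rotor_point i b < t) :: real)"
  have c: "real (card {i\<in>{..<N}. rotor_point i b < t}) = c N b t" for N b t
    unfolding c_def by (simp add: of_bool_def sum.If_cases Int_def)
  have l: "rotor_point i b < t \<longleftrightarrow> rotor_point (i div 2) False < 2 * t" if "even i = b" for i
    using that by (subst rotor_point_rec) auto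
  have r: "rotor_point i b < t \<longleftrightarrow> rotor_point (i div 2) True < 2 * t - 1" if "even i \<noteq> b" for i
    using that by (subst rotor_point_rec) auto
  have "c N b t = c (lcount N b) False (2 * t) + c (rcount N b) True (2 * t - 1)"
  proof (cases b)
    case True
    have "rotor_point (2*k) b < t \<longleftrightarrow> rotor_point k False < 2 * t"
      "rotor_point (2*k+1) b < t \<longleftrightarrow> rotor_point k True < 2 * t - 1" for k
      using l[of "2*k"] r[of "2*k+1"] True by simp_all
    then show ?thesis unfolding c_def by (subst sum_even_odd) (simp add: lcount_def rcount_def True)
  next
    case False
    have "rotor_point (2*k) b < t \<longleftrightarrow> rotor_point k True < 2 * t - 1"
      "rotor_point (2*k+1) b < t \<longleftrightarrow> rotor_point k False < 2 * t" for k
      using r[of "2*k"] l[of "2*k+1"] False by simp_all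
    then show ?thesis unfolding c_def by (subst sum_even_odd) (simp add: lcount_def rcount_def False)
  qed
  then show ?thesis unfolding c .
qed

text \<open>No point of the right half counts below 1/2. Together with the formula for the right
  half this says that a node adds \<open>balance\<close> times the tent function
  \<open>min t (1 - t)\<close>.\<close>

lemma rotor_disc_left:
  assumes "t \<le> 1/2"
  shows "rotor_disc N b t = rotor_disc (lcount N b) False (2 * t) + balance N b * t"
proof -
  have "\<not> rotor_point i True < 2 * t - 1" for i
    using rotor_point_bounds[of i True] assms by auto
  then have "card {i\<in>{..<rcount N b}. rotor_point i True < 2 * t - 1} = 0" by simp
  then show ?thesis
    unfolding rotor_disc_def rotor_count_rec[of N b t]
    by (simp add: lcount_balance field_simps)
qed

lemma rotor_disc_right:
  assumes "t \<ge> 1/2"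
  shows "rotor_disc N b t = rotor_disc (rcount N b) True (2 * t - 1) + balance N b * (1 - t)"
proof -
  have "rotor_point i False < 2 * t" for i
    using rotor_point_bounds[of i False] assms by auto
  then have "card {i\<in>{..<lcount N b}. rotor_point i False < 2 * t} = lcount N b" by simp
  then show ?thesis
    unfolding rotor_disc_def rotor_count_rec[of N b t]
    by (simp add: lcount_balance rcount_balance field_simps)
qed

lemma abs_rotor_disc_trivial:
  assumes "0 \<le> t" "t \<le> 1"
  shows "\<bar>rotor_disc N b t\<bar> \<le> N"
proof -
  have "card {i\<in>{..<N}. rotor_point i b < t} \<le> card {..<N}" by (rule card_mono) auto
  then have "real (card {i\<in>{..<N}. rotor_point i b < t}) \<le> N" by simp
  moreover have "0 \<le> N * t" "N * t \<le> N" using assms by (auto intro: mult_left_le)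
  ultimately show ?thesis unfolding rotor_disc_def by auto
qed

text \<open>Each of the \<open>L\<close> levels adds a tent of height at most 1/2, and at the bottom
  at most one point is left.\<close>

lemma abs_rotor_disc_le:
  assumes "N \<le> 2^L" "0 \<le> t" "t \<le> 1"
  shows "\<bar>rotor_disc N b t\<bar> \<le> L / 2 + 1"
  using assms
proof (induction L arbitrary: N b t)
  case 0
  then show ?case using abs_rotor_disc_trivial[of t N b] by simp
next
  case (Suc L)
  have half: "\<bar>balance N b * y\<bar> \<le> 1/2" if "0 \<le> y" "y \<le> 1/2" for y
    using that mult_mono[OF abs_balance_le[of N b] that(2)] by (simp add: abs_mult)
  show ?case
  proof (cases "t \<le> 1/2")
    case True
    then have "\<bar>rotor_disc (lcount N b) False (2 * t)\<bar> \<le> L / 2 + 1"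
      using Suc.prems by (intro Suc.IH lcount_le) auto
    then show ?thesis using half[of t] Suc.prems True unfolding rotor_disc_left[OF True]
      by (simp add: add_divide_distrib)
  next
    case False
    then have "\<bar>rotor_disc (rcount N b) True (2 * t - 1)\<bar> \<le> L / 2 + 1"
      using Suc.prems by (intro Suc.IH rcount_le) auto
    moreover have "t \<ge> 1/2" using False by simp
    ultimately show ?thesis using half[of "1 - t"] Suc.prems unfolding rotor_disc_right[OF \<open>t \<ge> 1/2\<close>]
      by (simp add: add_divide_distrib)
  qed
qed

text \<open>Up to a bounded error at the leaves this is the mean of the discrepancy over the dyadic cells of
  level \<open>L\<close>. It stays bounded
  because below an even node the two subtrees cancel, so that only a run of odd nodes contributes.\<close>

fun drift :: "nat \<Rightarrow> nat \<Rightarrow> bool \<Rightarrow> real" where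
  "drift 0 N b = 0"
| "drift (Suc L) N b = balance N b / 4 + (drift L (lcount N b) False + drift L (rcount N b) True) / 2"

text \<open>Changing the type of a node exchanges the visitor counts of its children, whose types
  are opposite; the tree below is mirrored.\<close>

lemma drift_antisym: "drift L N (\<not> b) = - drift L N b"
proof (induction L arbitrary: N b)
  case (Suc L)
  have "drift L M True = - drift L M False" for M using Suc[of M False] by simp
  then show ?case by (simp add: rcount_def balance_def field_simps)
qed simp

lemma drift_even: "even N \<Longrightarrow> drift L N b = 0"
proof (cases L)
  case (Suc M)
  assume "even N"
  then have "lcount N b = N div 2" "rcount N b = N div 2" by (auto simp: lcount_def rcount_def elim!: evenE)
  then show ?thesis using Suc \<open>even N\<close> drift_antisym[of M "N div 2" False] by (simp add: balance_def)
qed simp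

lemma abs_drift_le: "\<bar>drift L N b\<bar> \<le> 1/2"
proof (induction L arbitrary: N b)
  case (Suc L)
  show ?case
  proof (cases "even N")
    case True
    then show ?thesis using drift_even[of N "Suc L" b] by (simp del: drift.simps)
  next
    case False
    \<comment> \<open>For odd \<open>N\<close> the two child counts are consecutive, so one of them
      is even and has no drift. The bound is then \<open>1/4 + (1/2) / 2\<close>.\<close>
    then have "even (lcount N b) \<or> even (rcount N b)"
      by (auto simp: lcount_def rcount_def elim!: oddE)
    then have "\<bar>drift L (lcount N b) False + drift L (rcount N b) True\<bar> \<le> 1/2"
      using Suc[of "lcount N b" False] Suc[of "rcount N b" True] drift_even by auto
    moreover define A where "A = drift L (lcount N b) False + drift L (rcount N b) True"
    ultimately have "\<bar>A\<bar> \<le> 1/2" by simp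
    then have "\<bar>balance N b / 4 + A / 2\<bar> \<le> 1/2"
      using abs_balance_le[of N b] unfolding abs_le_iff by linarith
    then show ?thesis by (simp add: A_def)
  qed
qed simp

section \<open>Exponential moments of the discrepancy\<close>

lemma cosh_le_exp_square: "cosh (x::real) \<le> exp (x\<^sup>2 / 2)"
proof -
  \<comment> \<open>This compares the power series of \<open>cosh x\<close> and
    \<open>exp (x^2 / 2)\<close> term by term.\<close>
  have fact_le: "2 ^ n * fact n \<le> (fact (2 * n) :: real)" for n
  proof (induction n)
    case (Suc n)
    have "2 ^ Suc n * fact (Suc n) = (2 * real n + 2) * (2 ^ n * fact n)" by (simp add: field_simps)
    also have "\<dots> \<le> (2 * real n + 2) * fact (2 * n)" using Suc by (intro mult_left_mono) auto
    also have "\<dots> \<le> (2 * real n + 2) * ((2 * real n + 1) * fact (2 * n))"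
      by (intro mult_left_mono) (auto simp: distrib_right)
    also have "\<dots> = fact (2 * Suc n)" by (simp add: algebra_simps)
    finally show ?case .
  qed simp
  have even: "(\<lambda>n. if even n then x ^ n /\<^sub>R fact n else 0) sums cosh x" by (rule cosh_converges)
  have "(\<lambda>n. if even (2 * n) then x ^ (2 * n) /\<^sub>R fact (2 * n) else 0) sums cosh x"
    using even by (subst sums_mono_reindex[of "\<lambda>n. 2 * n"]) (auto simp: strict_mono_def elim!: evenE)
  then have "(\<lambda>n. x ^ (2 * n) /\<^sub>R fact (2 * n)) sums cosh x" by simp
  moreover have "(\<lambda>n. (x\<^sup>2 / 2) ^ n /\<^sub>R fact n) sums exp (x\<^sup>2 / 2)" by (rule exp_converges)
  ultimately show ?thesis
  proof (rule sums_le[rotated])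
    fix n
    have "x ^ (2 * n) / fact (2 * n) \<le> x ^ (2 * n) / (2 ^ n * fact n)"
      by (intro divide_left_mono fact_le) (auto simp: power_mult)
    also have "\<dots> = (x\<^sup>2 / 2) ^ n / fact n" by (simp add: power_mult power_divide)
    finally show "x ^ (2 * n) /\<^sub>R fact (2 * n) \<le> (x\<^sup>2 / 2) ^ n /\<^sub>R fact n"
      by (simp only: real_scaleR_def divide_real_def mult.commute)
  qed
qed

text \<open>Hoeffding's bound for a symmetric two-point variable with mean \<open>m\<close> and
  deviation \<open>y\<close>.\<close>

lemma exp_add_exp_le:
  fixes y :: real
  assumes "\<bar>y\<bar> \<le> 1"
  shows "exp (\<theta> * (m + y)) + exp (\<theta> * (m - y)) \<le> 2 * exp (\<theta>\<^sup>2 / 2 + \<theta> * m)"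
proof -
  have "cosh (\<theta> * y) \<le> exp ((\<theta> * y)\<^sup>2 / 2)" by (rule cosh_le_exp_square)
  also have "\<dots> \<le> exp (\<theta>\<^sup>2 / 2)"
    using assms by (simp add: power_mult_distrib mult_left_le abs_square_le_1)
  finally have "exp (\<theta> * y) + exp (- (\<theta> * y)) \<le> 2 * exp (\<theta>\<^sup>2 / 2)" by (simp add: cosh_def)
  then have "exp (\<theta> * m) * (exp (\<theta> * y) + exp (- (\<theta> * y))) \<le> exp (\<theta> * m) * (2 * exp (\<theta>\<^sup>2 / 2))"
    by (rule mult_left_mono) simp
  moreover have "\<theta> * (m + y) = \<theta> * m + \<theta> * y" "\<theta> * (m - y) = \<theta> * m + - (\<theta> * y)"
    by (simp_all add: algebra_simps)
  ultimately show ?thesis by (simp only: exp_add distrib_left mult_ac)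
qed

text \<open>The linear term with slope \<open>s\<close> closes the induction: on each half the tent
  of the node is linear and merges with it into slope \<open>(s + e) / 2\<close> or
  \<open>(s - e) / 2\<close>, again at most 1 in size. The summand
  \<open>\<bar>\<theta>\<bar>\<close> pays for the discrepancy left at a leaf.\<close>

lemma rotor_disc_exp_moment:
  assumes "N \<le> 2^L" "\<bar>s\<bar> \<le> 1"
  shows "(\<Sum>q<(2::nat)^L. exp (\<theta> * (rotor_disc N b ((q + 1/2) / 2^L) + s * ((q + 1/2) / 2^L - 1/2))))
    \<le> 2^L * exp (\<theta>\<^sup>2 * L / 2 + \<theta> * drift L N b + \<bar>\<theta>\<bar>)"
  using assms
proof (induction L arbitrary: N b s)
  case 0
  have "\<bar>\<theta> * rotor_disc N b (1/2)\<bar> \<le> \<bar>\<theta>\<bar> * 1"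
    unfolding abs_mult using abs_rotor_disc_trivial[of "1/2" N b] 0 by (intro mult_left_mono) auto
  then show ?case by (simp add: lessThan_Suc)
next
  case (Suc L)
  define e where "e = balance N b"
  define hl hr where "hl = drift L (lcount N b) False" and "hr = drift L (rcount N b) True"
  define c where "c = (\<lambda>q::nat. (real q + 1/2) / 2^L)"
  define K where "K = \<theta>\<^sup>2 * L / 2 + \<bar>\<theta>\<bar>"
  have c: "0 \<le> c q" "c q \<le> 1" if "q < 2^L" for q
  proof -
    have "real (q + 1) \<le> real (2^L)" using that by (intro of_nat_mono) simp
    then have "real q + 1 \<le> 2^L" by simp
    then show "0 \<le> c q" "c q \<le> 1" by (simp_all add: c_def)
  qed
  let ?f = "\<lambda>t. exp (\<theta> * (rotor_disc N b t + s * (t - 1/2)))"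
  have left: "?f (c q / 2) = exp (\<theta> * (e/4 - s/4)) *
      exp (\<theta> * (rotor_disc (lcount N b) False (c q) + ((s+e)/2) * (c q - 1/2)))" if "q < 2^L" for q
  proof -
    have "rotor_disc N b (c q / 2) + s * (c q / 2 - 1/2) = (e/4 - s/4) +
        (rotor_disc (lcount N b) False (c q) + ((s+e)/2) * (c q - 1/2))"
      using c[OF that] by (subst rotor_disc_left) (auto simp: e_def field_simps)
    then show ?thesis by (simp add: distrib_left exp_add)
  qed
  have right: "?f ((1 + c q) / 2) = exp (\<theta> * (e/4 + s/4)) *
      exp (\<theta> * (rotor_disc (rcount N b) True (c q) + ((s-e)/2) * (c q - 1/2)))" if "q < 2^L" for q
  proof -
    have "rotor_disc N b ((1 + c q) / 2) + s * ((1 + c q) / 2 - 1/2) = (e/4 + s/4) +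
        (rotor_disc (rcount N b) True (c q) + ((s-e)/2) * (c q - 1/2))"
      using c[OF that] by (subst rotor_disc_right) (auto simp: e_def field_simps)
    then show ?thesis by (simp add: distrib_left exp_add)
  qed
  have se: "\<bar>(s+e)/2\<bar> \<le> 1" "\<bar>(s-e)/2\<bar> \<le> 1"
    using Suc.prems(2) abs_balance_le[of N b] unfolding e_def by (auto simp: abs_le_iff)
  have "(\<Sum>q<(2::nat) ^ Suc L. ?f ((q + 1/2) / 2 ^ Suc L))
     = (\<Sum>q<(2::nat)^L. ?f (c q / 2)) + (\<Sum>q<(2::nat)^L. ?f ((1 + c q) / 2))"
  proof -
    have "(\<Sum>q<(2::nat) ^ Suc L. ?f ((q + 1/2) / 2 ^ Suc L))
       = (\<Sum>q\<in>{0..<(2::nat)^L}. ?f ((q + 1/2) / 2 ^ Suc L)) + (\<Sum>q\<in>{(2::nat)^L..<2^L+2^L}. ?f ((q + 1/2) / 2 ^ Suc L))"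
    proof -
      have e: "(2::nat) ^ Suc L = 2^L + 2^L" by simp
      show ?thesis unfolding lessThan_atLeast0 e by (rule sum.atLeastLessThan_concat[symmetric]) auto
    qed
    also have "(\<Sum>q\<in>{(2::nat)^L..<2^L+2^L}. ?f ((q + 1/2) / 2 ^ Suc L)) = (\<Sum>q\<in>{0..<(2::nat)^L}. ?f ((real (q + 2^L) + 1/2) / 2 ^ Suc L))"
      using sum.shift_bounds_nat_ivl[of "\<lambda>q. ?f ((real q + 1/2) / 2 ^ Suc L)" 0 "2^L" "2^L"] by simp
    moreover have "(real q + 1/2) / 2 ^ Suc L = c q / 2" "c (q + 2^L) = 1 + c q" for q
      by (auto simp: c_def field_simps)
    ultimately show ?thesis by (simp only: lessThan_atLeast0)
  qed
  also have "\<dots> = exp (\<theta> * (e/4 - s/4)) *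
        (\<Sum>q<(2::nat)^L. exp (\<theta> * (rotor_disc (lcount N b) False (c q) + ((s+e)/2) * (c q - 1/2))))
      + exp (\<theta> * (e/4 + s/4)) *
        (\<Sum>q<(2::nat)^L. exp (\<theta> * (rotor_disc (rcount N b) True (c q) + ((s-e)/2) * (c q - 1/2))))"
    unfolding sum_distrib_left using left right by (intro arg_cong2[where f="(+)"] sum.cong refl) auto
  also have "\<dots> \<le> exp (\<theta> * (e/4 - s/4)) * (2^L * exp (\<theta>\<^sup>2 * L / 2 + \<theta> * hl + \<bar>\<theta>\<bar>))
      + exp (\<theta> * (e/4 + s/4)) * (2^L * exp (\<theta>\<^sup>2 * L / 2 + \<theta> * hr + \<bar>\<theta>\<bar>))"
    unfolding c_def hl_def hr_def using Suc.prems se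
    by (intro add_mono mult_left_mono Suc.IH lcount_le rcount_le) auto
  also have "\<dots> = 2^L * exp K * (exp (\<theta> * (e/4 - s/4 + hl)) + exp (\<theta> * (e/4 + s/4 + hr)))"
  proof -
    have "exp (\<theta> * u) * (2^L * exp (\<theta>\<^sup>2 * L / 2 + \<theta> * h + \<bar>\<theta>\<bar>)) = 2^L * exp K * exp (\<theta> * (u + h))" for u h
      unfolding K_def distrib_left exp_add by (simp only: mult_ac)
    then show ?thesis by (simp only: distrib_left[of "2^L * exp K"])
  qed
  \<comment> \<open>The shifts of the two halves have the drift of the node as their mean and
    deviate from it by at most \<open>1/2 + 1/4\<close>, so each level costs one Hoeffding
    factor.\<close>
  also have "exp (\<theta> * (e/4 - s/4 + hl)) + exp (\<theta> * (e/4 + s/4 + hr))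
      = exp (\<theta> * (drift (Suc L) N b + ((hl - hr) / 2 - s/4))) + exp (\<theta> * (drift (Suc L) N b - ((hl - hr) / 2 - s/4)))"
  proof -
    have d: "drift (Suc L) N b = e/4 + (hl + hr) / 2" by (simp add: e_def hl_def hr_def)
    have "e/4 - s/4 + hl = drift (Suc L) N b + ((hl - hr) / 2 - s/4)"
      "e/4 + s/4 + hr = drift (Suc L) N b - ((hl - hr) / 2 - s/4)"
      unfolding d by (simp_all add: field_simps)
    then show ?thesis by (simp only:)
  qed
  also have "2^L * exp K * \<dots> \<le> 2^L * exp K * (2 * exp (\<theta>\<^sup>2 / 2 + \<theta> * drift (Suc L) N b))"
  proof (intro mult_left_mono exp_add_exp_le)
    show "\<bar>(hl - hr) / 2 - s/4\<bar> \<le> 1"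
      using abs_drift_le[of L "lcount N b" False] abs_drift_le[of L "rcount N b" True] Suc.prems(2)
      unfolding hl_def[symmetric] hr_def[symmetric] diff_divide_distrib by linarith
  qed simp
  also have "\<dots> = 2 ^ Suc L * exp (\<theta>\<^sup>2 * Suc L / 2 + \<theta> * drift (Suc L) N b + \<bar>\<theta>\<bar>)"
    by (simp only: K_def exp_add power_Suc of_nat_Suc distrib_left add_divide_distrib mult_1_right) (simp add: mult_ac)
  finally show ?case .
qed

text \<open>Given the type of the node, the leading digit reveals the parity of the index and the
  remaining digits the index \<open>i div 2\<close> in the child. So the first \<open>2^L\<close>
  points occupy different dyadic cells of level \<open>L\<close>.\<close>

lemma rotor_cell_inj:
  assumes "i < 2^L" "j < 2^L" "\<lfloor>rotor_point i b * 2^L\<rfloor> = \<lfloor>rotor_point j b * 2^L\<rfloor>"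
  shows "i = j"
  using assms
proof (induction L arbitrary: i j b)
  case (Suc L)
  define d e where "d \<longleftrightarrow> even i \<noteq> b" and "e \<longleftrightarrow> even j \<noteq> b"
  have gi: "rotor_point i b * 2 ^ Suc L = of_bool d * 2^L + rotor_point (i div 2) d * 2^L"
    and gj: "rotor_point j b * 2 ^ Suc L = of_bool e * 2^L + rotor_point (j div 2) e * 2^L"
    unfolding d_def e_def by (subst rotor_point_rec, simp add: field_simps)+
  have fl: "\<lfloor>of_bool d * 2^L + y\<rfloor> = of_bool d * 2^L + \<lfloor>y\<rfloor>" for d and y :: real
    using floor_add_int[of y "of_bool d * 2^L"] by (cases d) (simp_all add: add.commute)
  have range: "0 \<le> \<lfloor>rotor_point k c * 2^L\<rfloor>" "\<lfloor>rotor_point k c * 2^L\<rfloor> < 2^L" for k c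
  proof -
    have "rotor_point k c * 2^L < 1 * 2^L" using rotor_point_bounds[of k c] by (intro mult_strict_right_mono) auto
    then show "\<lfloor>rotor_point k c * 2^L\<rfloor> < 2^L" by (simp add: floor_less_iff)
    show "0 \<le> \<lfloor>rotor_point k c * 2^L\<rfloor>" using rotor_point_bounds[of k c] by simp
  qed
  have eq: "of_bool d * 2^L + \<lfloor>rotor_point (i div 2) d * 2^L\<rfloor> = of_bool e * 2^L + \<lfloor>rotor_point (j div 2) e * 2^L\<rfloor>"
    using Suc.prems(3) unfolding gi gj fl .
  define A B where "A = \<lfloor>rotor_point (i div 2) d * 2^L\<rfloor>" and "B = \<lfloor>rotor_point (j div 2) e * 2^L\<rfloor>"
  have "of_bool d * 2^L + A = of_bool e * 2^L + B" "0 \<le> A" "A < 2^L" "0 \<le> B" "B < 2^L"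
    unfolding A_def B_def by (rule eq range)+
  then have de: "d = e" by (cases d; cases e; simp)
  with eq have "\<lfloor>rotor_point (i div 2) d * 2^L\<rfloor> = \<lfloor>rotor_point (j div 2) d * 2^L\<rfloor>" by simp
  then have "i div 2 = j div 2" using Suc.prems by (intro Suc.IH[of _ _ d]) auto
  moreover have "even i = even j" using de by (auto simp: d_def e_def)
  ultimately show ?case by (metis even_iff_mod_2_eq_zero not_mod_2_eq_0_eq_1 div_mult_mod_eq)
qed simp

lemma rotor_point_inj: "inj (\<lambda>i. rotor_point i b)"
proof (rule injI)
  fix i j assume "rotor_point i b = rotor_point j b"
  then show "i = j"
    using rotor_cell_inj[of i "i + j" j b] less_exp[of "i + j"] by simp
qed

text \<open>A cell contains at most one of the \<open>N\<close> points, and across it the linear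
  part changes by at most \<open>N / 2^L \<le> 1\<close>.\<close>

lemma rotor_disc_cell_centre:
  assumes N: "N \<le> 2^L" and q: "\<lfloor>y * 2^L\<rfloor> = int q"
  shows "\<bar>rotor_disc N b y - rotor_disc N b ((q + 1/2) / 2^L)\<bar> \<le> 2"
proof -
  define c :: real where "c = (q + 1/2) / 2^L"
  have close: "\<bar>rotor_disc N b u - rotor_disc N b v\<bar> \<le> 2"
    if uv: "u \<le> v" and qu: "\<lfloor>u * 2^L\<rfloor> = int q" and qv: "\<lfloor>v * 2^L\<rfloor> = int q" for u v :: real
  proof -
    define A B where "A = {i\<in>{..<N}. rotor_point i b < u}" and "B = {i\<in>{..<N}. rotor_point i b < v}"
    have AB: "A \<subseteq> B" "finite A" "finite B" using uv by (auto simp: A_def B_def)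
    have cell: "\<lfloor>rotor_point i b * 2^L\<rfloor> = int q" if "i \<in> B - A" for i
    proof -
      have "u \<le> rotor_point i b" "rotor_point i b \<le> v" using that by (auto simp: A_def B_def)
      then have "\<lfloor>u * 2^L\<rfloor> \<le> \<lfloor>rotor_point i b * 2^L\<rfloor>" "\<lfloor>rotor_point i b * 2^L\<rfloor> \<le> \<lfloor>v * 2^L\<rfloor>"
        by (intro floor_mono mult_right_mono; simp)+
      with qu qv show ?thesis by simp
    qed
    have "i = j" if "i \<in> B - A" "j \<in> B - A" for i j
    proof (rule rotor_cell_inj)
      show "i < 2^L" "j < 2^L" using that N by (auto simp: B_def)
      show "\<lfloor>rotor_point i b * 2^L\<rfloor> = \<lfloor>rotor_point j b * 2^L\<rfloor>" using cell that by simp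
    qed
    then have "card (B - A) \<le> 1" using AB by (simp add: card_le_Suc0_iff_eq)
    moreover have "card (B - A) = card B - card A" "card A \<le> card B"
      using AB by (auto intro: card_Diff_subset card_mono)
    ultimately have "\<bar>real (card A) - real (card B)\<bar> \<le> 1" by linarith
    moreover have "\<bar>real N * u - real N * v\<bar> \<le> 1"
    proof -
      have "v * 2^L < q + 1" "q \<le> u * 2^L" using qu qv by linarith+
      then have "(v - u) * 2^L \<le> 1" by (simp add: left_diff_distrib)
      moreover have "real N \<le> real (2^L)" using N by (rule of_nat_mono)
      then have "real N * (v - u) \<le> 2^L * (v - u)" using uv by (intro mult_right_mono) auto
      ultimately have "real N * (v - u) \<le> 1" by (simp add: mult.commute)
      moreover have "0 \<le> real N * (v - u)" using uv by simp
      ultimately show ?thesis by (simp add: right_diff_distrib abs_le_iff)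
    qed
    ultimately show ?thesis
      unfolding rotor_disc_def A_def[symmetric] B_def[symmetric] by linarith
  qed
  have qc: "\<lfloor>c * 2^L\<rfloor> = int q" by (simp add: c_def floor_eq_iff)
  show ?thesis
    using close[of y c] close[of c y] q qc unfolding c_def[symmetric] by linarith
qed

text \<open>Moments are known at cell centres. Moving a point to the centre of its cell costs at
  most a factor \<open>exp 2\<close>, and distinct points have distinct cells, so the sum over
  points is dominated by the sum over all cells.\<close>

lemma sum_exp_rotor_disc_le:
  assumes N: "N \<le> 2^L" and L: "L \<ge> 1"
  shows "(\<Sum>i<N. exp (\<bar>rotor_disc N b (rotor_point i b)\<bar> / sqrt L)) \<le> 2 * 2^L * exp 4"
proof -
  \<comment> \<open>The variance term \<open>\<theta>^2 * L / 2\<close> becomes 1/2; drift and leaf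
    term add at most 1/2 and 1, whence \<open>exp 2\<close>.\<close>
  define \<theta> where "\<theta> = 1 / sqrt L"
  have th: "0 \<le> \<theta>" "\<theta> \<le> 1" "\<theta>\<^sup>2 * L = 1" using L by (simp_all add: \<theta>_def power_divide)
  define D where "D = (\<lambda>q::nat. rotor_disc N b ((q + 1/2) / 2^L))"
  have moment: "(\<Sum>q<(2::nat)^L. exp (\<tau> * D q)) \<le> 2^L * exp 2" if "\<tau> = \<theta> \<or> \<tau> = -\<theta>" for \<tau>
  proof -
    have "(\<Sum>q<(2::nat)^L. exp (\<tau> * D q)) \<le> 2^L * exp (\<tau>\<^sup>2 * L / 2 + \<tau> * drift L N b + \<bar>\<tau>\<bar>)"
      using rotor_disc_exp_moment[OF N, of 0 \<tau> b] by (simp add: D_def)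
    also have "\<tau>\<^sup>2 * L / 2 + \<tau> * drift L N b + \<bar>\<tau>\<bar> \<le> 2"
    proof -
      have "\<bar>\<tau> * drift L N b\<bar> \<le> 1 * (1/2)"
        unfolding abs_mult using that th abs_drift_le by (intro mult_mono) auto
      moreover have "\<tau>\<^sup>2 * L = 1" "\<bar>\<tau>\<bar> \<le> 1" using that th by auto
      ultimately show ?thesis by linarith
    qed
    finally show ?thesis by simp
  qed
  define q where "q = (\<lambda>i. nat \<lfloor>rotor_point i b * 2^L\<rfloor>)"
  have q: "\<lfloor>rotor_point i b * 2^L\<rfloor> = int (q i)" for i
    using rotor_point_bounds[of i b] by (simp add: q_def)
  have qlt: "q i < 2^L" for i
  proof -
    have "rotor_point i b * 2^L < 1 * 2^L" using rotor_point_bounds[of i b] by (intro mult_strict_right_mono) auto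
    then have "\<lfloor>rotor_point i b * 2^L\<rfloor> < 2^L" by (simp add: floor_less_iff)
    then show ?thesis unfolding q by (simp flip: of_nat_less_iff)
  qed
  have inj: "inj_on q {..<N}"
    using N by (intro inj_onI rotor_cell_inj[of _ L _ b]) (auto simp: q)
  have "(\<Sum>i<N. exp (\<bar>rotor_disc N b (rotor_point i b)\<bar> / sqrt L)) \<le> (\<Sum>i<N. exp 2 * exp (\<theta> * \<bar>D (q i)\<bar>))"
  proof (rule sum_mono)
    fix i
    have "\<bar>rotor_disc N b (rotor_point i b)\<bar> \<le> \<bar>D (q i)\<bar> + 2"
      using rotor_disc_cell_centre[OF N q[of i], of b] unfolding D_def by linarith
    then have "\<theta> * \<bar>rotor_disc N b (rotor_point i b)\<bar> \<le> \<theta> * (\<bar>D (q i)\<bar> + 2)"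
      using th by (intro mult_left_mono) auto
    also have "\<dots> \<le> 2 + \<theta> * \<bar>D (q i)\<bar>" using th by (simp add: distrib_left)
    finally show "exp (\<bar>rotor_disc N b (rotor_point i b)\<bar> / sqrt L) \<le> exp 2 * exp (\<theta> * \<bar>D (q i)\<bar>)"
      by (simp add: \<theta>_def flip: exp_add)
  qed
  also have "\<dots> = exp 2 * (\<Sum>k\<in>q ` {..<N}. exp (\<theta> * \<bar>D k\<bar>))"
    by (simp add: sum.reindex[OF inj] sum_distrib_left)
  also have "\<dots> \<le> exp 2 * (\<Sum>k<(2::nat)^L. exp (\<theta> * \<bar>D k\<bar>))"
    using qlt by (intro mult_left_mono sum_mono2) auto
  also have "(\<Sum>k<(2::nat)^L. exp (\<theta> * \<bar>D k\<bar>)) \<le> (\<Sum>k<(2::nat)^L. exp (\<theta> * D k) + exp (-\<theta> * D k))"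
    by (intro sum_mono) (auto simp: abs_if)
  also have "\<dots> \<le> 2^L * exp 2 + 2^L * exp 2"
    unfolding sum.distrib by (intro add_mono moment) auto
  also have "exp 2 * (2^L * exp 2 + 2^L * exp 2) = 2 * 2^L * (exp 2 * exp 2 :: real)" by simp
  also have "exp 2 * exp 2 = (exp 4 :: real)" by (simp flip: exp_add)
  finally show ?thesis by simp
qed

subsection \<open>Transport to the uniform measure\<close>

lemma measurable_unif_interval: "f \<in> borel_measurable borel \<Longrightarrow> f \<in> borel_measurable unif_interval"
  unfolding unif_interval_def by (intro measurable_restrict_space1) simp

lemma nn_integral_unif_grid:
  fixes g :: "nat \<Rightarrow> ennreal"
  assumes N: "N \<ge> 1"
  shows "(\<integral>\<^sup>+u. g (nat \<lfloor>real N * u\<rfloor>) \<partial>unif_interval) = (\<Sum>k<N. g k * ennreal (1 / N))"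
proof -
  define I where "I = (\<lambda>k::nat. {k / N..<(k + 1) / N})"
  have mem: "nat \<lfloor>real N * u\<rfloor> = k \<longleftrightarrow> u \<in> I k" if "0 \<le> u" for u k
  proof -
    have "nat \<lfloor>real N * u\<rfloor> = k \<longleftrightarrow> \<lfloor>real N * u\<rfloor> = int k" using that by auto
    also have "\<dots> \<longleftrightarrow> k \<le> real N * u \<and> real N * u < k + 1" by (simp add: floor_eq_iff add.commute)
    also have "\<dots> \<longleftrightarrow> u \<in> I k" using N by (simp add: I_def field_simps)
    finally show ?thesis .
  qed
  have sub: "I k \<subseteq> {0..<1}" if "k < N" for k
  proof -
    have "real (k + 1) / N \<le> 1" using that N by simp
    moreover have "0 \<le> real k / N" by simp
    ultimately show ?thesis unfolding I_def by (intro subsetI) (simp only: atLeastLessThan_iff, linarith)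
  qed
  have Im: "I k \<in> sets unif_interval" if "k < N" for k
    using sub[OF that] unfolding unif_interval_def sets_restrict_space
    by (intro image_eqI[of _ _ "I k"]) (auto simp: I_def)
  have "(\<integral>\<^sup>+u. g (nat \<lfloor>real N * u\<rfloor>) \<partial>unif_interval) = (\<integral>\<^sup>+u. (\<Sum>k<N. g k * indicator (I k) u) \<partial>unif_interval)"
  proof (rule nn_integral_cong)
    fix u assume "u \<in> space unif_interval"
    then have u: "0 \<le> u" "u < 1" by auto
    have "real N * u < real N" using u N by simp
    then have k: "nat \<lfloor>real N * u\<rfloor> < N" using u by (simp add: nat_less_iff floor_less_iff)
    have "(\<Sum>k<N. g k * indicator (I k) u) = (\<Sum>k<N. if k = nat \<lfloor>real N * u\<rfloor> then g k else 0)"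
      by (intro sum.cong refl) (auto simp: indicator_def mem[OF u(1), symmetric])
    also have "\<dots> = g (nat \<lfloor>real N * u\<rfloor>)" using k by (simp add: sum.delta)
    finally show "g (nat \<lfloor>real N * u\<rfloor>) = (\<Sum>k<N. g k * indicator (I k) u)" by simp
  qed
  also have "\<dots> = (\<Sum>k<N. g k * emeasure unif_interval (I k))"
    using Im by (subst nn_integral_sum) (auto simp: nn_integral_cmult_indicator)
  also have "\<dots> = (\<Sum>k<N. g k * ennreal (1 / N))"
  proof (intro sum.cong refl arg_cong2[where f="(*)"])
    fix k assume "k \<in> {..<N}"
    then have "emeasure unif_interval (I k) = emeasure lborel (I k)"
      using sub unfolding unif_interval_def by (subst emeasure_restrict_space) auto
    also have "\<dots> = ennreal (1 / N)"
      using N by (simp add: I_def divide_right_mono add_divide_distrib)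
    finally show "emeasure unif_interval (I k) = ennreal (1 / N)" .
  qed
  finally show ?thesis .
qed

locale sorted_transport =
  fixes y :: "nat \<Rightarrow> real" and N :: nat
  assumes N: "N \<ge> 1" and inj: "inj_on y {..<N}" and range: "\<And>i. y i \<in> {0..<1}"
begin

definition rank :: "nat \<Rightarrow> nat" where
  "rank i = card {j\<in>{..<N}. y j < y i}"

lemma rank_less: "i < N \<Longrightarrow> rank i < N"
proof -
  assume "i < N"
  then have "rank i < card {..<N}" unfolding rank_def by (intro psubset_card_mono) auto
  then show ?thesis by simp
qed

lemma rank_strict: "i < N \<Longrightarrow> y i < y j \<Longrightarrow> rank i < rank j"
  unfolding rank_def by (intro psubset_card_mono) auto

lemma bij_rank: "bij_betw rank {..<N} {..<N}"
proof -
  have "inj_on rank {..<N}"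
  proof (rule inj_onI)
    fix i j assume ij: "i \<in> {..<N}" "j \<in> {..<N}" "rank i = rank j"
    then have "\<not> y i < y j" "\<not> y j < y i" using rank_strict[of i j] rank_strict[of j i] by auto
    then show "i = j" using inj ij by (auto simp: inj_on_def)
  qed
  moreover have "rank ` {..<N} \<subseteq> {..<N}" using rank_less by auto
  ultimately show ?thesis by (simp add: bij_betw_def endo_inj_surj)
qed

definition point :: "nat \<Rightarrow> nat" where
  "point = inv_into {..<N} rank"

lemma bij_point: "bij_betw point {..<N} {..<N}"
  unfolding point_def by (rule bij_betw_inv_into[OF bij_rank])

lemma rank_point: "k < N \<Longrightarrow> rank (point k) = k"
  unfolding point_def using bij_betw_inv_into_right[OF bij_rank] by simp

text \<open>The quantile function of the empirical measure: on \<open>[k/N, (k+1)/N)\<close> it is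
  the point of rank \<open>k\<close>.\<close>

definition quantile :: "real \<Rightarrow> real" where
  "quantile u = y (point (nat \<lfloor>real N * u\<rfloor>))"

lemma nn_integral_quantile:
  fixes g :: "nat \<Rightarrow> ennreal"
  shows "(\<integral>\<^sup>+u. g (point (nat \<lfloor>real N * u\<rfloor>)) \<partial>unif_interval) = (\<Sum>i<N. g i * ennreal (1 / N))"
  unfolding nn_integral_unif_grid[OF N, of "\<lambda>k. g (point k)"]
  by (rule sum.reindex_bij_betw[OF bij_point])

text \<open>\<open>u\<close> is within \<open>1 / N\<close> of \<open>rank i / N\<close>, and
  \<open>rank i - N * y i\<close> is the discrepancy at the point \<open>y i\<close> itself.
  Transport cost is thus a mean of the discrepancy over the points.\<close>

lemma quantile_close:
  assumes u: "0 \<le> u" "u < 1"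
  defines "i \<equiv> point (nat \<lfloor>real N * u\<rfloor>)"
  shows "\<bar>quantile u - u\<bar> \<le> (\<bar>real (rank i) - N * y i\<bar> + 1) / N"
proof -
  have k: "nat \<lfloor>real N * u\<rfloor> < N" using u N by (simp add: nat_less_iff floor_less_iff)
  then have "real (rank i) = of_int \<lfloor>real N * u\<rfloor>"
    unfolding i_def using u by (simp add: rank_point)
  then have "real (rank i) \<le> N * u" "N * u < real (rank i) + 1" by linarith+
  then have "\<bar>N * y i - N * u\<bar> \<le> \<bar>real (rank i) - N * y i\<bar> + 1" by linarith
  moreover have "\<bar>N * y i - N * u\<bar> = N * \<bar>y i - u\<bar>" by (simp add: abs_mult flip: right_diff_distrib)
  ultimately show ?thesis using N unfolding quantile_def i_def[symmetric] by (simp add: field_simps)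
qed

abbreviation emp :: "real measure" where
  "emp \<equiv> empirical unif_interval (\<lambda>n. y (n - 1)) N"

lemma emp_emeasure:
  assumes "A \<in> sets unif_interval"
  shows "emeasure emp A = (\<Sum>i<N. indicator A (y i) * ennreal (1 / N))"
proof -
  have "(\<Sum>n = 1..N. indicator A (y (n - 1)) :: ennreal) = (\<Sum>i<N. indicator A (y i))"
    by (rule sum.reindex_bij_witness[of _ Suc "\<lambda>n. n - 1"]) auto
  moreover have "inverse (of_nat N) = ennreal (1 / N)"
    using N by (simp add: ennreal_of_nat_eq_real_of_nat inverse_ennreal inverse_eq_divide)
  ultimately show ?thesis
    using assms by (simp add: emeasure_empirical divide_ennreal_def sum_distrib_right)
qed

lemma measurable_quantile: "quantile \<in> unif_interval \<rightarrow>\<^sub>M unif_interval"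
proof -
  have "(\<lambda>u. nat \<lfloor>real N * u\<rfloor>) \<in> borel \<rightarrow>\<^sub>M count_space UNIV" by measurable
  then have "(\<lambda>u. y (point (nat \<lfloor>real N * u\<rfloor>))) \<in> borel_measurable borel"
    by (rule measurable_compose) simp
  then have "quantile \<in> borel_measurable unif_interval"
    using measurable_unif_interval unfolding quantile_def[abs_def] by blast
  moreover have "quantile \<in> space unif_interval \<rightarrow> {0..<1}" using range by (auto simp: quantile_def)
  ultimately show ?thesis
    unfolding unif_interval_def[of ] by (intro measurable_restrict_space2) (auto simp: unif_interval_def)
qed

definition plan :: "(real \<times> real) measure" where
  "plan = distr unif_interval (emp \<Otimes>\<^sub>M unif_interval) (\<lambda>u. (quantile u, u))"

lemma measurable_quantile_emp: "quantile \<in> unif_interval \<rightarrow>\<^sub>M emp"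
  using measurable_quantile measurable_cong_sets[OF refl sets_empirical] by blast

lemma measurable_plan: "(\<lambda>u. (quantile u, u)) \<in> unif_interval \<rightarrow>\<^sub>M emp \<Otimes>\<^sub>M unif_interval"
  by (intro measurable_Pair measurable_quantile_emp measurable_ident_sets[OF refl])

lemma plan_coupling: "plan \<in> couplings emp unif_interval"
  unfolding couplings_def
proof (intro CollectI conjI)
  show "prob_space plan"
    unfolding plan_def by (rule prob_space.prob_space_distr[OF prob_space_unif_interval measurable_plan])
  show "sets plan = sets (emp \<Otimes>\<^sub>M unif_interval)" by (simp add: plan_def)
  have "distr plan emp fst = distr unif_interval emp quantile"
    unfolding plan_def by (subst distr_distr[OF measurable_fst measurable_plan]) (simp add: comp_def)
  also have "\<dots> = emp"
  proof (rule measure_eqI)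
    fix A assume "A \<in> sets (distr unif_interval emp quantile)"
    then have A: "A \<in> sets unif_interval" by simp
    have "emeasure (distr unif_interval emp quantile) A = (\<integral>\<^sup>+x. indicator A x \<partial>distr unif_interval emp quantile)"
      using A by simp
    also have "\<dots> = (\<integral>\<^sup>+u. indicator A (quantile u) \<partial>unif_interval)"
      using A by (intro nn_integral_distr measurable_quantile_emp borel_measurable_indicator) simp
    also have "\<dots> = emeasure emp A"
      unfolding quantile_def emp_emeasure[OF A] by (rule nn_integral_quantile)
    finally show "emeasure (distr unif_interval emp quantile) A = emeasure emp A" .
  qed simp
  finally show "distr plan emp fst = emp" .
  have "distr plan unif_interval snd = distr unif_interval unif_interval (\<lambda>u. u)"
    unfolding plan_def by (subst distr_distr[OF measurable_snd measurable_plan]) (simp add: comp_def)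
  then show "distr plan unif_interval snd = unif_interval" by (simp add: distr_id2)
qed

lemma measurable_dist_plan: "(\<lambda>(x, y). dist x y) \<in> borel_measurable (emp \<Otimes>\<^sub>M unif_interval)"
proof -
  have m: "(\<lambda>x. x) \<in> borel_measurable unif_interval" by (rule measurable_unif_interval) simp
  then have "(\<lambda>x. x) \<in> borel_measurable emp" using measurable_cong_sets[OF sets_empirical refl] by blast
  then show ?thesis using m unfolding case_prod_beta
    by (intro borel_measurable_dist measurable_compose[OF measurable_fst] measurable_compose[OF measurable_snd])
qed

lemma Lp_norm_plan_finite:
  assumes p: "1 \<le> p" "p \<noteq> \<infinity>" and P: "P = enn2real p" and B: "B \<ge> 0"
    and le: "(\<Sum>i<N. ((\<bar>real (rank i) - N * y i\<bar> + 1) / N) powr P / N) \<le> B powr P"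
  shows "Lp_norm p plan (\<lambda>(x, y). dist x y) \<le> ennreal B"
proof -
  have P1: "P \<ge> 1" using p enn2real_mono[of 1 p] by (simp add: P top.not_eq_extremum)
  define I where "I = (\<integral>\<^sup>+z. ennreal (\<bar>(\<lambda>(x, y). dist x y) z\<bar> powr P) \<partial>plan)"
  have "I = (\<integral>\<^sup>+u. ennreal (\<bar>dist (quantile u) u\<bar> powr P) \<partial>unif_interval)"
    unfolding I_def plan_def using measurable_dist_plan
    by (subst nn_integral_distr[OF measurable_plan]) auto
  also have "\<dots> \<le> (\<integral>\<^sup>+u. (\<lambda>i. ennreal (((\<bar>real (rank i) - N * y i\<bar> + 1) / N) powr P))
      (point (nat \<lfloor>real N * u\<rfloor>)) \<partial>unif_interval)"
  proof (rule nn_integral_mono)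
    fix u assume "u \<in> space unif_interval"
    then have "0 \<le> u" "u < 1" by auto
    from quantile_close[OF this] show "ennreal (\<bar>dist (quantile u) u\<bar> powr P)
      \<le> (\<lambda>i. ennreal (((\<bar>real (rank i) - N * y i\<bar> + 1) / N) powr P)) (point (nat \<lfloor>real N * u\<rfloor>))"
      using P1 by (intro ennreal_leI) (auto intro!: powr_mono2 simp: dist_real_def)
  qed
  also have "\<dots> = (\<Sum>i<N. ennreal (((\<bar>real (rank i) - N * y i\<bar> + 1) / N) powr P) * ennreal (1 / N))"
    by (rule nn_integral_quantile)
  also have "\<dots> = ennreal (\<Sum>i<N. ((\<bar>real (rank i) - N * y i\<bar> + 1) / N) powr P / N)"
    by (simp flip: ennreal_mult)
  also have "\<dots> \<le> ennreal (B powr P)" using le by (rule ennreal_leI)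
  finally have I: "I \<le> ennreal (B powr P)" .
  also have "\<dots> < \<infinity>" by simp
  finally have fin: "I \<noteq> \<infinity>" by simp
  have "enn2real I \<le> B powr P" using enn2real_mono[OF I] by simp
  then have "enn2real I powr (1 / P) \<le> (B powr P) powr (1 / P)" using P1 by (intro powr_mono2) auto
  also have "\<dots> = B" using P1 B by (simp add: powr_powr)
  finally have "enn2real I powr (1 / P) \<le> B" .
  then show ?thesis using p fin unfolding Lp_norm_def P[symmetric] I_def[symmetric] Let_def
    by (simp add: ennreal_leI)
qed

lemma Lp_norm_plan_infinity:
  assumes le: "\<And>i. i < N \<Longrightarrow> (\<bar>real (rank i) - N * y i\<bar> + 1) / N \<le> B"
  shows "Lp_norm \<infinity> plan (\<lambda>(x, y). dist x y) \<le> ennreal B"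
proof -
  have m: "(\<lambda>z. ennreal \<bar>(\<lambda>(x, y). dist x y) z\<bar>) \<in> borel_measurable (emp \<Otimes>\<^sub>M unif_interval)"
    using measurable_dist_plan by simp
  have "AE u in unif_interval. ennreal \<bar>dist (quantile u) u\<bar> \<le> ennreal B"
  proof (rule AE_I2)
    fix u assume "u \<in> space unif_interval"
    then have u: "0 \<le> u" "u < 1" by auto
    have "nat \<lfloor>real N * u\<rfloor> < N" using u N by (simp add: nat_less_iff floor_less_iff)
    then have "point (nat \<lfloor>real N * u\<rfloor>) < N" using bij_point by (auto simp: bij_betw_def)
    from le[OF this] quantile_close[OF u] show "ennreal \<bar>dist (quantile u) u\<bar> \<le> ennreal B"
      by (intro ennreal_leI) (simp add: dist_real_def)
  qed
  then have "AE z in plan. ennreal \<bar>(\<lambda>(x, y). dist x y) z\<bar> \<le> ennreal B"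
    unfolding plan_def
  proof (subst AE_distr_iff[OF measurable_plan])
    show "{z \<in> space (emp \<Otimes>\<^sub>M unif_interval). ennreal \<bar>(\<lambda>(x, y). dist x y) z\<bar> \<le> ennreal B}
        \<in> sets (emp \<Otimes>\<^sub>M unif_interval)"
      using m by (intro borel_measurable_le) auto
  qed simp
  moreover have "(\<lambda>z. ennreal \<bar>(\<lambda>(x, y). dist x y) z\<bar>) \<in> borel_measurable plan"
    unfolding plan_def using m by simp
  ultimately show ?thesis unfolding Lp_norm_def by (simp add: esssup_I)
qed

end

section \<open>Transport cost of the rotor sequence\<close>

lemma dyadic_bracket:
  fixes N :: nat
  assumes "N \<ge> 2"
  shows "\<exists>L\<ge>1. N \<le> 2^L \<and> 2^L \<le> 2 * N \<and> real L \<le> 3 * ln N"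
proof -
  obtain n where n: "2^n < N" "N \<le> 2^(n+1)" using ex_power_ivl2[of 2 N] assms by auto
  have ln2: "ln (2::real) \<ge> 2/3" by (rule ln2_ge_two_thirds)
  have "real (n + 1) \<le> 3 * ln N"
  proof (cases "n = 0")
    case True
    have "ln (2::real) \<le> ln N" using assms by simp
    then show ?thesis using True ln2 by simp
  next
    case False
    have "real (2^n) \<le> real N" using n by (intro of_nat_mono) simp
    then have "ln (2^n) \<le> ln (real N)" using assms by simp
    then have "n * ln 2 \<le> ln (real N)" by (simp add: ln_realpow)
    moreover have "n * (2/3) \<le> n * ln (2::real)" using ln2 by (intro mult_left_mono) auto
    moreover have "real n \<ge> 1" using False by simp
    ultimately show ?thesis unfolding of_nat_add of_nat_1 by linarith
  qed
  moreover have "2^(n+1) \<le> 2 * N" using n by simp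
  ultimately show ?thesis using n by (intro exI[of _ "n+1"]) auto
qed

text \<open>Raise \<open>z / P \<le> exp (z / P)\<close> to the power \<open>P\<close>. This trades
  moments of order \<open>P\<close> for exponential ones.\<close>

lemma powr_le_exp:
  fixes z :: real
  assumes "z \<ge> 0" "P > 0"
  shows "z powr P \<le> P powr P * exp z"
proof -
  have "z / P \<le> exp (z / P)" using exp_ge_add_one_self[of "z / P"] by linarith
  then have "z \<le> P * exp (z / P)" using assms by (simp add: field_simps)
  then have "z powr P \<le> (P * exp (z / P)) powr P" using assms by (intro powr_mono2) auto
  also have "\<dots> = P powr P * exp z" using assms by (simp add: powr_mult exp_powr_real)
  finally show ?thesis .
qed

abbreviation rotor_seq :: "nat \<Rightarrow> real" where
  "rotor_seq n \<equiv> rotor_point (n - 1) False"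

lemma rotor_transport: "N \<ge> 1 \<Longrightarrow> sorted_transport (\<lambda>i. rotor_point i False) N"
proof
  show "inj_on (\<lambda>i. rotor_point i False) {..<N}" using rotor_point_inj by (rule inj_on_subset) simp
  show "rotor_point i False \<in> {0..<1}" for i using rotor_point_bounds[of i False] by auto
qed

lemma rotor_wasserstein_finite:
  assumes p: "1 \<le> p" "p \<noteq> \<infinity>" and N: "N \<ge> 2"
  shows "wasserstein p (empirical unif_interval rotor_seq N) unif_interval
    \<le> ennreal (8 * exp 5 * enn2real p * ln (real N) powr log_exponent p / real N)"
proof -
  define P where "P = enn2real p"
  have P1: "P \<ge> 1" using p enn2real_mono[of 1 p] by (simp add: P_def top.not_eq_extremum)
  obtain L where L: "L \<ge> 1" "N \<le> 2^L" "2^L \<le> 2 * N" "real L \<le> 3 * ln N"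
    using dyadic_bracket[OF N] by blast
  interpret sorted_transport "\<lambda>i. rotor_point i False" N using N by (intro rotor_transport) simp
  define D where "D = (\<lambda>i. \<bar>rotor_disc N False (rotor_point i False)\<bar>)"
  have D: "\<bar>real (rank i) - N * rotor_point i False\<bar> = D i" for i
    by (simp add: D_def rotor_disc_def rank_def)
  \<comment> \<open>The 4 comes from the cell sum \<open>2 * 2^L\<close> with
    \<open>2^L \<le> 2 * N\<close>; \<open>exp 5\<close> is \<open>exp 4\<close> from the moments
    times \<open>exp 1\<close> from the summand 1 in \<open>D i + 1\<close>.\<close>
  define B where "B = 4 * exp 5 * P * (sqrt L / N)"
  have sL: "sqrt L \<ge> 1" using L by simp
  have pointwise: "((D i + 1) / N) powr P / N \<le> (P * (sqrt L / N)) powr P * exp 1 / N * exp (D i / sqrt L)" for i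
  proof -
    have D0: "D i \<ge> 0" by (simp add: D_def)
    have "((D i + 1) / N) powr P = (sqrt L / N * ((D i + 1) / sqrt L)) powr P" using sL by simp
    also have "\<dots> = (sqrt L / N) powr P * ((D i + 1) / sqrt L) powr P" by (rule powr_mult)
    also have "\<dots> \<le> (sqrt L / N) powr P * (P powr P * exp ((D i + 1) / sqrt L))"
      using sL D0 P1 by (intro mult_left_mono powr_le_exp) auto
    also have "(D i + 1) / sqrt L \<le> 1 + D i / sqrt L"
      using sL by (simp add: add_divide_distrib)
    then have "(sqrt L / N) powr P * (P powr P * exp ((D i + 1) / sqrt L))
        \<le> (sqrt L / N) powr P * (P powr P * exp (1 + D i / sqrt L))"
      by (intro mult_left_mono) auto
    also have "\<dots> = (P * (sqrt L / N)) powr P * exp 1 * exp (D i / sqrt L)"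
      by (simp only: powr_mult[of P "sqrt L / N"] exp_add mult_ac)
    finally have "((D i + 1) / N) powr P / N \<le> (P * (sqrt L / N)) powr P * exp 1 * exp (D i / sqrt L) / N"
      by (rule divide_right_mono) simp
    then show ?thesis by simp
  qed
  have "(\<Sum>i<N. ((D i + 1) / N) powr P / N)
      \<le> (\<Sum>i<N. (P * (sqrt L / N)) powr P * exp 1 / N * exp (D i / sqrt L))"
    by (rule sum_mono) (rule pointwise)
  also have "\<dots> = (P * (sqrt L / N)) powr P * exp 1 / N * (\<Sum>i<N. exp (D i / sqrt L))"
    by (rule sum_distrib_left[symmetric])
  also have "\<dots> \<le> (P * (sqrt L / N)) powr P * exp 1 / N * (2 * 2^L * exp 4)"
    unfolding D_def using L by (intro mult_left_mono sum_exp_rotor_disc_le) auto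
  also have "\<dots> \<le> (P * (sqrt L / N)) powr P * exp 1 / N * (2 * (2 * real N) * exp 4)"
  proof -
    have "real (2^L) \<le> real (2 * N)" using L by (intro of_nat_mono) simp
    then show ?thesis by (intro mult_left_mono mult_right_mono) auto
  qed
  also have "\<dots> = (P * (sqrt L / N)) powr P * (4 * (exp 1 * exp 4))" using N by simp
  also have "exp 1 * exp 4 = (exp 5 :: real)" by (simp flip: exp_add)
  \<comment> \<open>A constant that is at least 1 may be raised to the power
    \<open>P \<ge> 1\<close>; the bound becomes a pure \<open>P\<close>-th power.\<close>
  also have "(P * (sqrt L / N)) powr P * (4 * exp 5) \<le> (P * (sqrt L / N)) powr P * (4 * exp 5) powr P"

  proof -
    have "1 * 1 \<le> 4 * exp (5::real)" by (intro mult_mono) auto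
    then show ?thesis using powr_mono[of 1 P "4 * exp 5"] P1 by (intro mult_left_mono) auto
  qed
  also have "\<dots> = B powr P" using P1 by (simp add: B_def powr_mult[symmetric] mult_ac)
  finally have "Lp_norm p plan (\<lambda>(x, y). dist x y) \<le> ennreal B"
    using P1 sL by (intro Lp_norm_plan_finite[OF p P_def]) (auto simp: D B_def)
  then have "wasserstein p emp unif_interval \<le> ennreal B"
    unfolding wasserstein_def by (rule INF_lower2[OF plan_coupling])
  also have "B \<le> 8 * exp 5 * P * (sqrt (ln N) / N)"
  proof -
    have "0 \<le> ln (real N)" using N by simp
    then have "sqrt L \<le> sqrt (4 * ln N)" using L(4) by (intro real_sqrt_le_mono) linarith
    also have "\<dots> = 2 * sqrt (ln N)" by (simp add: real_sqrt_mult)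
    finally have "4 * exp 5 * P * (sqrt L / N) \<le> 4 * exp 5 * P * (2 * sqrt (ln N) / N)"
      using P1 by (intro mult_left_mono divide_right_mono) auto
    then show ?thesis by (simp add: B_def)
  qed
  finally show ?thesis
    using p N by (simp add: P_def log_exponent_def powr_half_sqrt ennreal_leI order_trans)
qed

lemma rotor_wasserstein_infinity:
  assumes N: "N \<ge> 2"
  shows "wasserstein \<infinity> (empirical unif_interval rotor_seq N) unif_interval
    \<le> ennreal (9 * ln (real N) powr log_exponent \<infinity> / real N)"
proof -
  obtain L where L: "L \<ge> 1" "N \<le> 2^L" "2^L \<le> 2 * N" "real L \<le> 3 * ln N"
    using dyadic_bracket[OF N] by blast
  interpret sorted_transport "\<lambda>i. rotor_point i False" N using N by (intro rotor_transport) simp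
  have "Lp_norm \<infinity> plan (\<lambda>(x, y). dist x y) \<le> ennreal (9 * ln N / N)"
  proof (rule Lp_norm_plan_infinity)
    fix i
    have "\<bar>rotor_disc N False (rotor_point i False)\<bar> \<le> L / 2 + 1"
      using L rotor_point_bounds[of i False] by (intro abs_rotor_disc_le) auto
    \<comment> \<open>Here \<open>L / 2 + 2 \<le> 3 * L\<close> because \<open>L \<ge> 1\<close>,
      and \<open>L \<le> 3 * ln N\<close>.\<close>
    then have "\<bar>real (rank i) - N * rotor_point i False\<bar> + 1 \<le> 9 * ln N"
      using L by (simp add: rotor_disc_def rank_def)
    then show "(\<bar>real (rank i) - N * rotor_point i False\<bar> + 1) / N \<le> 9 * ln N / N"
      by (rule divide_right_mono) simp
  qed
  then have "wasserstein \<infinity> emp unif_interval \<le> ennreal (9 * ln N / N)"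
    unfolding wasserstein_def by (rule INF_lower2[OF plan_coupling])
  then show ?thesis using N by (simp add: log_exponent_def)
qed

section \<open>Passage from the interval to the circle\<close>

lemma to_circle_measurable_unif: "to_circle \<in> unif_interval \<rightarrow>\<^sub>M unif_circle"
  using measurable_to_circle measurable_cong_sets[OF refl sets_unif_circle] by blast

lemma empirical_circle_eq_distr:
  "empirical unif_circle (\<lambda>n. to_circle (x n)) N = distr (empirical unif_interval x N) unif_circle to_circle"
  if x: "\<And>n. x n \<in> {0..<1}"
proof (rule measure_eqI)
  fix A assume "A \<in> sets (empirical unif_circle (\<lambda>n. to_circle (x n)) N)"
  then have A: "A \<in> sets unif_circle" by simp
  have m: "to_circle \<in> empirical unif_interval x N \<rightarrow>\<^sub>M unif_circle"
    using to_circle_measurable_unif measurable_cong_sets[OF sets_empirical refl] by blast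
  have "to_circle -` A \<inter> {0..<1} \<in> sets unif_interval"
    using measurable_sets[OF to_circle_measurable_unif A] by simp
  then show "emeasure (empirical unif_circle (\<lambda>n. to_circle (x n)) N) A
      = emeasure (distr (empirical unif_interval x N) unif_circle to_circle) A"
    using x A by (simp add: emeasure_distr[OF m A] emeasure_empirical indicator_def)
qed simp

lemma unif_circle_eq_distr: "distr unif_interval unif_circle to_circle = unif_circle"
  unfolding unif_circle_def by (rule distr_cong) simp_all

text \<open>\<open>to_circle\<close> does not increase distances, so the image of a coupling under
  it in both coordinates couples the image measures at no larger cost.\<close>

lemma wasserstein_circle_le_interval:
  assumes x: "\<And>n. x n \<in> {0..<1}"
  shows "wasserstein p (empirical unif_circle (\<lambda>n. to_circle (x n)) N) unif_circle
    \<le> wasserstein p (empirical unif_interval x N) unif_interval"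
  unfolding wasserstein_def[of p "empirical unif_interval x N"]
proof (rule INF_greatest)
  fix \<pi> assume \<pi>: "\<pi> \<in> couplings (empirical unif_interval x N) unif_interval"
  define \<mu> \<mu>' where "\<mu> = empirical unif_interval x N" and "\<mu>' = empirical unif_circle (\<lambda>n. to_circle (x n)) N"
  define f where "f = (\<lambda>z::real \<times> real. (to_circle (fst z), to_circle (snd z)))"
  have sp: "sets \<pi> = sets (\<mu> \<Otimes>\<^sub>M unif_interval)" and d1: "distr \<pi> \<mu> fst = \<mu>"
    and d2: "distr \<pi> unif_interval snd = unif_interval" and pr: "prob_space \<pi>"
    using \<pi> by (auto simp: couplings_def \<mu>_def)
  have m1: "fst \<in> \<pi> \<rightarrow>\<^sub>M \<mu>" unfolding measurable_cong_sets[OF sp refl] by (rule measurable_fst)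
  have m2: "snd \<in> \<pi> \<rightarrow>\<^sub>M unif_interval" unfolding measurable_cong_sets[OF sp refl] by (rule measurable_snd)
  have t: "to_circle \<in> \<mu> \<rightarrow>\<^sub>M unif_circle"
    using to_circle_measurable_unif measurable_cong_sets[OF sets_empirical refl] unfolding \<mu>_def by blast
  have t': "to_circle \<in> \<mu> \<rightarrow>\<^sub>M \<mu>'"
    using t measurable_cong_sets[OF refl sets_empirical] unfolding \<mu>'_def by blast
  have f: "f \<in> \<pi> \<rightarrow>\<^sub>M \<mu>' \<Otimes>\<^sub>M unif_circle"
    unfolding f_def by (intro measurable_Pair measurable_compose[OF m1 t'] measurable_compose[OF m2 to_circle_measurable_unif])
  define \<rho> where "\<rho> = distr \<pi> (\<mu>' \<Otimes>\<^sub>M unif_circle) f"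
  have "\<rho> \<in> couplings \<mu>' unif_circle"
    unfolding couplings_def
  proof (intro CollectI conjI)
    show "prob_space \<rho>" unfolding \<rho>_def by (rule prob_space.prob_space_distr[OF pr f])
    show "sets \<rho> = sets (\<mu>' \<Otimes>\<^sub>M unif_circle)" by (simp add: \<rho>_def)
    have "distr \<rho> \<mu>' fst = distr \<pi> \<mu>' (to_circle \<circ> fst)"
      unfolding \<rho>_def by (subst distr_distr[OF measurable_fst f]) (simp add: f_def comp_def)
    also have "\<dots> = distr (distr \<pi> \<mu> fst) \<mu>' to_circle"
      by (rule distr_distr[OF t' m1, symmetric])
    also have "\<dots> = distr \<mu> unif_circle to_circle"
      unfolding d1 by (rule distr_cong) (simp_all add: \<mu>'_def)
    also have "\<dots> = \<mu>'" unfolding \<mu>_def \<mu>'_def by (rule empirical_circle_eq_distr[OF x, symmetric])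
    finally show "distr \<rho> \<mu>' fst = \<mu>'" .
    have "distr \<rho> unif_circle snd = distr \<pi> unif_circle (to_circle \<circ> snd)"
      unfolding \<rho>_def by (subst distr_distr[OF measurable_snd f]) (simp add: f_def comp_def)
    also have "\<dots> = distr (distr \<pi> unif_interval snd) unif_circle to_circle"
      by (rule distr_distr[OF to_circle_measurable_unif m2, symmetric])
    also have "\<dots> = unif_circle" unfolding d2 by (rule unif_circle_eq_distr)
    finally show "distr \<rho> unif_circle snd = unif_circle" .
  qed
  moreover have "Lp_norm p \<rho> (\<lambda>(x, y). dist x y) \<le> Lp_norm p \<pi> (\<lambda>(x, y). dist x y)"
  proof -
    have sb: "sets (\<mu>' \<Otimes>\<^sub>M unif_circle) = sets borel" unfolding \<mu>'_def by (rule sets_pair_unif_circle) simp_all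
    have md: "(\<lambda>(x, y). dist x y) \<in> borel_measurable (\<mu>' \<Otimes>\<^sub>M unif_circle)"
      unfolding measurable_cong_sets[OF sb refl] case_prod_beta
      by (intro borel_measurable_continuous_onI continuous_intros)
    have le: "\<bar>(\<lambda>(x, y). dist x y) (f z)\<bar> \<le> \<bar>(\<lambda>(x, y). dist x y) z\<bar>" for z
    proof -
      have "dist (to_circle (fst z)) (to_circle (snd z)) \<le> dist (fst z) (snd z)"
        using arc_dist_le[of "fst z" "snd z" 0] by (simp add: dist_circle.abs_eq dist_real_def)
      then show ?thesis by (simp add: f_def case_prod_beta)
    qed
    show ?thesis
    proof (cases "p = \<infinity>")
      case True
      have "AE z in \<pi>. ennreal \<bar>(\<lambda>(x, y). dist x y) (f z)\<bar> \<le> Lp_norm p \<pi> (\<lambda>(x, y). dist x y)"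
        using esssup_AE[of "\<lambda>z. ennreal \<bar>(\<lambda>(x, y). dist x y) z\<bar>" \<pi>]
      proof eventually_elim
        case (elim z)
        have "ennreal \<bar>(\<lambda>(x, y). dist x y) (f z)\<bar> \<le> ennreal \<bar>(\<lambda>(x, y). dist x y) z\<bar>"
          by (rule ennreal_leI[OF le])
        also have "\<dots> \<le> Lp_norm p \<pi> (\<lambda>(x, y). dist x y)" using elim True by (simp add: Lp_norm_def)
        finally show ?case .
      qed
      then have "AE z in \<rho>. ennreal \<bar>(\<lambda>(x, y). dist x y) z\<bar> \<le> Lp_norm p \<pi> (\<lambda>(x, y). dist x y)"
        unfolding \<rho>_def
      proof (subst AE_distr_iff[OF f])
        show "{z \<in> space (\<mu>' \<Otimes>\<^sub>M unif_circle). ennreal \<bar>(\<lambda>(x, y). dist x y) z\<bar> \<le> Lp_norm p \<pi> (\<lambda>(x, y). dist x y)}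
          \<in> sets (\<mu>' \<Otimes>\<^sub>M unif_circle)"
          using md by (intro borel_measurable_le) auto
      qed simp
      moreover have "(\<lambda>z. ennreal \<bar>(\<lambda>(x, y). dist x y) z\<bar>) \<in> borel_measurable \<rho>"
        using md by (simp add: \<rho>_def)
      ultimately have "esssup \<rho> (\<lambda>z. ennreal \<bar>(\<lambda>(x, y). dist x y) z\<bar>) \<le> Lp_norm p \<pi> (\<lambda>(x, y). dist x y)"
        by (intro esssup_I)
      then show ?thesis using True unfolding Lp_norm_def[of p \<rho>] by simp
    next
      case False
      define I I' where "I = (\<integral>\<^sup>+z. ennreal (\<bar>(\<lambda>(x, y). dist x y) z\<bar> powr enn2real p) \<partial>\<pi>)"
        and "I' = (\<integral>\<^sup>+z. ennreal (\<bar>(\<lambda>(x, y). dist x y) z\<bar> powr enn2real p) \<partial>\<rho>)"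
      have "I' = (\<integral>\<^sup>+z. ennreal (\<bar>(\<lambda>(x, y). dist x y) (f z)\<bar> powr enn2real p) \<partial>\<pi>)"
        unfolding I'_def \<rho>_def using md by (subst nn_integral_distr[OF f]) auto
      also have "\<dots> \<le> I"
        unfolding I_def by (intro nn_integral_mono ennreal_leI powr_mono2 le) auto
      finally have "I' \<le> I" .
      moreover from this have "enn2real I' powr (1 / enn2real p) \<le> enn2real I powr (1 / enn2real p)" if "I \<noteq> \<infinity>"
        using that by (intro powr_mono2 enn2real_mono) (auto simp: top.not_eq_extremum)
      ultimately show ?thesis
        using False unfolding Lp_norm_def Let_def I_def[symmetric] I'_def[symmetric]
        by (auto intro: ennreal_leI simp: top_unique)
    qed
  qed
  ultimately show "wasserstein p (empirical unif_circle (\<lambda>n. to_circle (x n)) N) unif_circle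
      \<le> Lp_norm p \<pi> (\<lambda>(x, y). dist x y)"
    unfolding wasserstein_def \<mu>'_def[symmetric] by (rule INF_lower2)
qed

lemma rotor_wasserstein_le:
  assumes "1 \<le> p"
  shows "\<exists>C. \<forall>N\<ge>2. wasserstein p (empirical unif_interval rotor_seq N) unif_interval
     \<le> ennreal (C * ln (real N) powr log_exponent p / real N)"
  using rotor_wasserstein_finite[OF assms] rotor_wasserstein_infinity by (cases "p = \<infinity>") blast+

theorem theorem1p3:
  shows
    "(\<forall>p::ennreal. 1 \<le> p \<longrightarrow> (\<exists>C::real. C > 0 \<and>
        (\<forall>x :: nat \<Rightarrow> real. (\<forall>n. x n \<in> {0..<1}) \<longrightarrow>
           (\<exists>\<^sub>\<infinity>N::nat. wasserstein p (empirical unif_interval x N) unif_interval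
                     \<ge> ennreal (C * ln (real N) powr log_exponent p / real N)))))
   \<and> (\<forall>p::ennreal. 1 \<le> p \<longrightarrow> (\<exists>C::real. C > 0 \<and>
        (\<forall>x :: nat \<Rightarrow> circle.
           (\<exists>\<^sub>\<infinity>N::nat. wasserstein p (empirical unif_circle x N) unif_circle
                     \<ge> ennreal (C * ln (real N) powr log_exponent p / real N)))))
   \<and> (\<forall>p::ennreal. 1 \<le> p \<longrightarrow> (\<exists>(x :: nat \<Rightarrow> real) (C::real). (\<forall>n. x n \<in> {0..<1}) \<and>
        (\<forall>N::nat. N \<ge> 2 \<longrightarrow>
           wasserstein p (empirical unif_interval x N) unif_interval
             \<le> ennreal (C * ln (real N) powr log_exponent p / real N))))
   \<and> (\<forall>p::ennreal. 1 \<le> p \<longrightarrow> (\<exists>(x :: nat \<Rightarrow> circle) (C::real).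
        (\<forall>N::nat. N \<ge> 2 \<longrightarrow>
           wasserstein p (empirical unif_circle x N) unif_circle
             \<le> ennreal (C * ln (real N) powr log_exponent p / real N))))"
proof (intro conjI allI impI)
  fix p :: ennreal assume p: "1 \<le> p"
  show "\<exists>C::real. C > 0 \<and> (\<forall>x :: nat \<Rightarrow> real. (\<forall>n. x n \<in> {0..<1}) \<longrightarrow>
      (\<exists>\<^sub>\<infinity>N::nat. wasserstein p (empirical unif_interval x N) unif_interval
         \<ge> ennreal (C * ln (real N) powr log_exponent p / real N)))"
  proof (intro exI[of _ "1/10000"] conjI allI impI)
    fix x :: "nat \<Rightarrow> real" assume "\<forall>n. x n \<in> {0..<1}"
    then have x: "x n \<in> {0..<1}" for n by blast
    \<comment> \<open>The circle bound is applied to the image sequence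
      \<open>to_circle (x n)\<close>, whose distances to the uniform measure are the smaller
      ones.\<close>
    show "\<exists>\<^sub>\<infinity>N. ennreal (1/10000 * ln (real N) powr log_exponent p / real N)
        \<le> wasserstein p (empirical unif_interval x N) unif_interval"
      by (rule INFM_mono[OF circle_lower_bound[OF p]], erule order_trans)
         (rule wasserstein_circle_le_interval[OF x])
  qed simp
  show "\<exists>C::real. C > 0 \<and> (\<forall>x :: nat \<Rightarrow> circle.
      (\<exists>\<^sub>\<infinity>N::nat. wasserstein p (empirical unif_circle x N) unif_circle
         \<ge> ennreal (C * ln (real N) powr log_exponent p / real N)))"
    by (intro exI[of _ "1/10000"] conjI allI circle_lower_bound[OF p]) simp
  obtain C where C: "\<forall>N\<ge>2. wasserstein p (empirical unif_interval rotor_seq N) unif_interval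
      \<le> ennreal (C * ln (real N) powr log_exponent p / real N)"
    using rotor_wasserstein_le[OF p] by blast
  have range: "rotor_seq n \<in> {0..<1}" for n
    using rotor_point_bounds[of "n - 1" False] by simp
  show "\<exists>(x :: nat \<Rightarrow> real) (C::real). (\<forall>n. x n \<in> {0..<1}) \<and> (\<forall>N::nat. N \<ge> 2 \<longrightarrow>
      wasserstein p (empirical unif_interval x N) unif_interval
        \<le> ennreal (C * ln (real N) powr log_exponent p / real N))"
    using C by (intro exI[of _ rotor_seq] exI[of _ C] conjI allI impI range) blast
  show "\<exists>(x :: nat \<Rightarrow> circle) (C::real). \<forall>N::nat. N \<ge> 2 \<longrightarrow>
      wasserstein p (empirical unif_circle x N) unif_circle
        \<le> ennreal (C * ln (real N) powr log_exponent p / real N)"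
    using C by (intro exI[of _ "\<lambda>n. to_circle (rotor_seq n)"] exI[of _ C] allI impI
      order_trans[OF wasserstein_circle_le_interval[OF range]]) blast
qed

end
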